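(* For integers $1\le m\le n$, the lower-upper scheme $E=\{(X,Y)\in\mathrm{Mat}(m,n,\mathbb C)\times\mathrm{Mat}(n,m,\mathbb C): XY \text{ lower triangular},\ YX\text{ upper triangular}\}$ is equidimensional. *)

theory Defs
  imports
    "HOL-Algebra.QuotRing"
    "HOL-Analysis.Abstract_Topology"
    "HOL-Library.Extended_Nat"
    "HOL-Library.Poly_Mapping"
    "Jordan_Normal_Form.Matrix"
begin

section \<open>Equidimensional topological spaces\<close>

definition irreducible_in :: "'a topology \<Rightarrow> 'a set \<Rightarrow> bool" where
  "irreducible_in T S \<longleftrightarrow> S \<subseteq> topspace T \<and> S \<noteq> {} \<and>
     (\<forall>F G. closedin T F \<and> closedin T G \<and> S \<subseteq> F \<union> G \<longrightarrow> S \<subseteq> F \<or> S \<subseteq> G)"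

definition irreducible_components :: "'a topology \<Rightarrow> 'a set set" where
  "irreducible_components T =
     {Z. irreducible_in T Z \<and> (\<forall>W. irreducible_in T W \<and> Z \<subseteq> W \<longrightarrow> W = Z)}"

text \<open>The empty space gets dimension \<open>0\<close> here; irreducible components are never empty.\<close>

definition krull_dim :: "'a topology \<Rightarrow> enat" where
  "krull_dim T = Sup {enat k | k. \<exists>Z :: nat \<Rightarrow> 'a set.
     (\<forall>i\<le>k. closedin T (Z i) \<and> irreducible_in T (Z i)) \<and> (\<forall>i<k. Z i \<subset> Z (Suc i))}"

definition equidimensional :: "'a topology \<Rightarrow> bool" where
  "equidimensional T \<longleftrightarrow>
     (\<forall>Z \<in> irreducible_components T. \<forall>W \<in> irreducible_components T.
        krull_dim (subtopology T Z) = krull_dim (subtopology T W))"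


section \<open>The prime spectrum with its Zariski topology\<close>

definition zariski_closed :: "('a, 'b) ring_scheme \<Rightarrow> 'a set \<Rightarrow> 'a set set" where
  "zariski_closed R S = {P. primeideal P R \<and> S \<subseteq> P}"

definition Spec :: "('a, 'b) ring_scheme \<Rightarrow> 'a set topology" where
  "Spec R = topology (\<lambda>U. \<exists>S \<subseteq> carrier R. U = {P. primeideal P R} - zariski_closed R S)"

lemma zariski_closed_Un:
  assumes "S \<subseteq> carrier R" "S' \<subseteq> carrier R"
  shows "zariski_closed R S \<union> zariski_closed R S' =
    zariski_closed R {a \<otimes>\<^bsub>R\<^esub> b | a b. a \<in> S \<and> b \<in> S'}"
proof (intro equalityI subsetI)
  fix P assume "P \<in> zariski_closed R S \<union> zariski_closed R S'"
  then have P: "primeideal P R" and *: "S \<subseteq> P \<or> S' \<subseteq> P"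
    by (auto simp: zariski_closed_def)
  interpret primeideal P R by (rule P)
  have "a \<otimes>\<^bsub>R\<^esub> b \<in> P" if "a \<in> S" "b \<in> S'" for a b
    using * that assms I_l_closed I_r_closed by blast
  with P show "P \<in> zariski_closed R {a \<otimes>\<^bsub>R\<^esub> b | a b. a \<in> S \<and> b \<in> S'}"
    by (auto simp: zariski_closed_def)
next
  fix P assume *: "P \<in> zariski_closed R {a \<otimes>\<^bsub>R\<^esub> b | a b. a \<in> S \<and> b \<in> S'}"
  then have P: "primeideal P R" by (auto simp: zariski_closed_def)
  interpret primeideal P R by (rule P)
  have "S \<subseteq> P \<or> S' \<subseteq> P"
  proof (rule ccontr)
    assume "\<not> (S \<subseteq> P \<or> S' \<subseteq> P)"
    then obtain a b where ab: "a \<in> S" "b \<in> S'" "a \<notin> P" "b \<notin> P" by blast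
    then have "a \<otimes>\<^bsub>R\<^esub> b \<in> P" using * by (auto simp: zariski_closed_def)
    with ab I_prime assms show False by blast
  qed
  with P show "P \<in> zariski_closed R S \<union> zariski_closed R S'"
    by (auto simp: zariski_closed_def)
qed

lemma istopology_zariski:
  "istopology (\<lambda>U. \<exists>S \<subseteq> carrier R. U = {P. primeideal P R} - zariski_closed R S)"
  unfolding istopology_def
proof (intro conjI allI impI)
  fix U V
  assume "\<exists>S \<subseteq> carrier R. U = {P. primeideal P R} - zariski_closed R S"
    and "\<exists>S \<subseteq> carrier R. V = {P. primeideal P R} - zariski_closed R S"
  then obtain S S' where S: "S \<subseteq> carrier R" "U = {P. primeideal P R} - zariski_closed R S"
    and S': "S' \<subseteq> carrier R" "V = {P. primeideal P R} - zariski_closed R S'" by blast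
  show "\<exists>S \<subseteq> carrier R. U \<inter> V = {P. primeideal P R} - zariski_closed R S"
  proof (cases "\<exists>P. primeideal P R")
    case True
    then obtain P where "primeideal P R" by blast
    then interpret primeideal P R .
    show ?thesis
      using S S' zariski_closed_Un[OF S(1) S'(1)]
      by (intro exI[of _ "{a \<otimes>\<^bsub>R\<^esub> b | a b. a \<in> S \<and> b \<in> S'}"]) blast
  next
    case False
    then show ?thesis using S by auto
  qed
next
  fix \<U> :: "'a set set set"
  assume "\<forall>U\<in>\<U>. \<exists>S \<subseteq> carrier R. U = {P. primeideal P R} - zariski_closed R S"
  then obtain f where f: "\<And>U. U \<in> \<U> \<Longrightarrow> f U \<subseteq> carrier R"
    "\<And>U. U \<in> \<U> \<Longrightarrow> U = {P. primeideal P R} - zariski_closed R (f U)" by metis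
  have "P \<in> \<Union>\<U> \<longleftrightarrow> P \<in> {P. primeideal P R} - zariski_closed R (\<Union>(f ` \<U>))" for P
  proof
    assume "P \<in> \<Union>\<U>"
    then obtain U where U: "U \<in> \<U>" "P \<in> U" by blast
    with f(2)[OF U(1)] have "primeideal P R" "\<not> f U \<subseteq> P"
      by (auto simp: zariski_closed_def)
    with U show "P \<in> {P. primeideal P R} - zariski_closed R (\<Union>(f ` \<U>))"
      by (auto simp: zariski_closed_def)
  next
    assume "P \<in> {P. primeideal P R} - zariski_closed R (\<Union>(f ` \<U>))"
    then obtain U where U: "U \<in> \<U>" "primeideal P R" "\<not> f U \<subseteq> P"
      by (auto simp: zariski_closed_def)
    then have "P \<in> {P. primeideal P R} - zariski_closed R (f U)"
      by (auto simp: zariski_closed_def)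
    with f(2)[OF U(1)] U(1) show "P \<in> \<Union>\<U>" by blast
  qed
  then have "\<Union>\<U> = {P. primeideal P R} - zariski_closed R (\<Union>(f ` \<U>))" by blast
  moreover have "\<Union>(f ` \<U>) \<subseteq> carrier R" using f(1) by blast
  ultimately show "\<exists>S \<subseteq> carrier R. \<Union>\<U> = {P. primeideal P R} - zariski_closed R S" by blast
qed

lemma openin_Spec:
  "openin (Spec R) U \<longleftrightarrow> (\<exists>S \<subseteq> carrier R. U = {P. primeideal P R} - zariski_closed R S)"
  unfolding Spec_def by (simp add: topology_inverse'[OF istopology_zariski])

lemma topspace_Spec: "topspace (Spec R) = {P. primeideal P R}"
proof
  have "openin (Spec R) (topspace (Spec R))" by (rule openin_topspace)
  then obtain S where "topspace (Spec R) = {P. primeideal P R} - zariski_closed R S"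
    unfolding openin_Spec by (elim exE conjE)
  then show "topspace (Spec R) \<subseteq> {P. primeideal P R}" by (simp add: Diff_subset)
next
  have "\<not> carrier R \<subseteq> P" if "primeideal P R" for P
  proof
    interpret primeideal P R by (rule that)
    assume "carrier R \<subseteq> P"
    moreover have "P \<subseteq> carrier R" by (rule a_subset)
    ultimately show False using I_notcarr by simp
  qed
  then have "zariski_closed R (carrier R) = {}" by (simp add: zariski_closed_def)
  then have "openin (Spec R) {P. primeideal P R}"
    unfolding openin_Spec by (intro exI[of _ "carrier R"]) simp
  then show "{P. primeideal P R} \<subseteq> topspace (Spec R)" by (rule openin_subset)
qed

lemma closedin_Spec:
  "closedin (Spec R) F \<longleftrightarrow> (\<exists>S \<subseteq> carrier R. F = zariski_closed R S)"
proof -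
  have sub: "zariski_closed R S \<subseteq> {P. primeideal P R}" for S
    by (auto simp: zariski_closed_def)
  have "closedin (Spec R) F \<longleftrightarrow> F \<subseteq> {P. primeideal P R} \<and>
      (\<exists>S \<subseteq> carrier R. {P. primeideal P R} - F = {P. primeideal P R} - zariski_closed R S)"
    by (simp add: closedin_def openin_Spec topspace_Spec)
  also have "\<dots> \<longleftrightarrow> (\<exists>S \<subseteq> carrier R. F = zariski_closed R S)"
  proof
    assume "F \<subseteq> {P. primeideal P R} \<and>
      (\<exists>S \<subseteq> carrier R. {P. primeideal P R} - F = {P. primeideal P R} - zariski_closed R S)"
    then obtain S where S: "F \<subseteq> {P. primeideal P R}" "S \<subseteq> carrier R"
      "{P. primeideal P R} - F = {P. primeideal P R} - zariski_closed R S"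
      by (elim exE conjE)
    have "F = {P. primeideal P R} - ({P. primeideal P R} - F)"
      by (simp only: double_diff[OF S(1) subset_refl])
    also have "\<dots> = zariski_closed R S"
      by (simp only: S(3) double_diff[OF sub subset_refl])
    finally have "F = zariski_closed R S" .
    with S(2) show "\<exists>S \<subseteq> carrier R. F = zariski_closed R S" by (intro exI[of _ S]) simp
  next
    assume "\<exists>S \<subseteq> carrier R. F = zariski_closed R S"
    then obtain S where "S \<subseteq> carrier R" "F = zariski_closed R S" by (elim exE conjE)
    with sub[of S] show "F \<subseteq> {P. primeideal P R} \<and>
      (\<exists>S \<subseteq> carrier R. {P. primeideal P R} - F = {P. primeideal P R} - zariski_closed R S)"
      by (intro conjI exI[of _ S]) simp_all
  qed
  finally show ?thesis .
qed


section \<open>Polynomial rings\<close>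

text \<open>Polynomials are finitely supported families of coefficients indexed by monomials, and
  monomials are finitely supported families of exponents indexed by variables. The ring below
  consists of the polynomials in which only variables from \<open>V\<close> occur.\<close>

definition poly_ring :: "'v set \<Rightarrow> (('v \<Rightarrow>\<^sub>0 nat) \<Rightarrow>\<^sub>0 'k::comm_ring_1) ring" where
  "poly_ring V = \<lparr>carrier = {p. \<forall>t \<in> Poly_Mapping.keys p. Poly_Mapping.keys t \<subseteq> V},
     monoid.mult = (*), one = 1, zero = 0, add = (+)\<rparr>"

definition poly_var :: "'v \<Rightarrow> (('v \<Rightarrow>\<^sub>0 nat) \<Rightarrow>\<^sub>0 'k::comm_ring_1)" where
  "poly_var v = Poly_Mapping.single (Poly_Mapping.single v 1) 1"

lemma cring_poly_ring: "cring (poly_ring V :: (('v \<Rightarrow>\<^sub>0 nat) \<Rightarrow>\<^sub>0 'k::comm_ring_1) ring)"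
proof -
  have add: "Poly_Mapping.keys t \<subseteq> V"
    if "\<forall>t \<in> Poly_Mapping.keys p. Poly_Mapping.keys t \<subseteq> V"
      "\<forall>t \<in> Poly_Mapping.keys q. Poly_Mapping.keys t \<subseteq> V" "t \<in> Poly_Mapping.keys (p + q)"
    for t and p q :: "('v \<Rightarrow>\<^sub>0 nat) \<Rightarrow>\<^sub>0 'k"
    using that Poly_Mapping.keys_add[of p q] by blast
  have mult: "Poly_Mapping.keys t \<subseteq> V"
    if p: "\<forall>t \<in> Poly_Mapping.keys p. Poly_Mapping.keys t \<subseteq> V"
      and q: "\<forall>t \<in> Poly_Mapping.keys q. Poly_Mapping.keys t \<subseteq> V"
      and t: "t \<in> Poly_Mapping.keys (p * q)"
    for t and p q :: "('v \<Rightarrow>\<^sub>0 nat) \<Rightarrow>\<^sub>0 'k"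
  proof -
    obtain a b where "t = a + b" "a \<in> Poly_Mapping.keys p" "b \<in> Poly_Mapping.keys q"
      using t Poly_Mapping.keys_mult[of p q] by blast
    then show ?thesis using p q Poly_Mapping.keys_add[of a b] by blast
  qed
  let ?R = "poly_ring V :: (('v \<Rightarrow>\<^sub>0 nat) \<Rightarrow>\<^sub>0 'k) ring"
  have sel: "p \<oplus>\<^bsub>?R\<^esub> q = p + q" "p \<otimes>\<^bsub>?R\<^esub> q = p * q" "\<zero>\<^bsub>?R\<^esub> = 0" "\<one>\<^bsub>?R\<^esub> = 1" for p q
    by (simp_all add: poly_ring_def)
  have mem: "p \<in> carrier ?R \<longleftrightarrow> (\<forall>t \<in> Poly_Mapping.keys p. Poly_Mapping.keys t \<subseteq> V)" for p
    by (simp add: poly_ring_def)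
  have add': "p + q \<in> carrier ?R" if "p \<in> carrier ?R" "q \<in> carrier ?R" for p q
    unfolding mem by (rule ballI, rule add[OF that[unfolded mem]])
  have mult': "p * q \<in> carrier ?R" if "p \<in> carrier ?R" "q \<in> carrier ?R" for p q
    unfolding mem by (rule ballI, rule mult[OF that[unfolded mem]])
  have zero: "0 \<in> carrier ?R" and one: "1 \<in> carrier ?R"
    by (simp_all add: mem)
  have minus: "- p \<in> carrier ?R" if "p \<in> carrier ?R" for p
    using that by (simp add: mem)
  show ?thesis
  proof (rule cringI)
    show "abelian_group ?R"
    proof (rule abelian_groupI)
      show "\<exists>q \<in> carrier ?R. q \<oplus>\<^bsub>?R\<^esub> p = \<zero>\<^bsub>?R\<^esub>" if "p \<in> carrier ?R" for p
        unfolding sel by (rule bexI[of _ "- p"]) (simp_all add: minus that)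
    qed (simp_all only: sel add' zero ac_simps add_0 add_0_right)
    show "Group.comm_monoid ?R"
      by (rule comm_monoidI) (simp_all only: sel mult' one ac_simps mult_1 mult_1_right)
  qed (simp only: sel distrib_right)
qed

lemma poly_var_closed:
  "v \<in> V \<Longrightarrow> (poly_var v :: ('v \<Rightarrow>\<^sub>0 nat) \<Rightarrow>\<^sub>0 'k::comm_ring_1) \<in> carrier (poly_ring V)"
  by (simp add: poly_ring_def poly_var_def)


section \<open>The lower-upper scheme\<close>

text \<open>Matrix indices start at 0, as in the matrix library.\<close>

datatype lu_var = VX nat nat | VY nat nat

definition lu_vars :: "nat \<Rightarrow> nat \<Rightarrow> lu_var set" where
  "lu_vars m n = {VX i j | i j. i < m \<and> j < n} \<union> {VY j i | i j. i < m \<and> j < n}"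

type_synonym lu_poly = "(lu_var \<Rightarrow>\<^sub>0 nat) \<Rightarrow>\<^sub>0 complex"

definition generic_X :: "nat \<Rightarrow> nat \<Rightarrow> lu_poly mat" where
  "generic_X m n = mat m n (\<lambda>(i, j). poly_var (VX i j))"

definition generic_Y :: "nat \<Rightarrow> nat \<Rightarrow> lu_poly mat" where
  "generic_Y m n = mat n m (\<lambda>(i, j). poly_var (VY i j))"

text \<open>The entries of \<open>XY\<close> above the diagonal and those of \<open>YX\<close> below the diagonal.\<close>

definition lu_equations :: "nat \<Rightarrow> nat \<Rightarrow> lu_poly set" where
  "lu_equations m n =
     {(generic_X m n * generic_Y m n) $$ (i, j) | i j. i < j \<and> j < m} \<union>
     {(generic_Y m n * generic_X m n) $$ (i, j) | i j. j < i \<and> i < n}"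

definition lu_coordinate_ring :: "nat \<Rightarrow> nat \<Rightarrow> lu_poly set ring" where
  "lu_coordinate_ring m n =
     poly_ring (lu_vars m n) Quot (Idl\<^bsub>poly_ring (lu_vars m n)\<^esub> (lu_equations m n))"

text \<open>The underlying space of the affine scheme of pairs \<open>(X, Y)\<close> with \<open>XY\<close> lower triangular
  and \<open>YX\<close> upper triangular; equidimensionality depends only on this space.\<close>

definition lower_upper_scheme :: "nat \<Rightarrow> nat \<Rightarrow> lu_poly set set topology" where
  "lower_upper_scheme m n = Spec (lu_coordinate_ring m n)"

text \<open>A ring homomorphism to \<open>\<complex>\<close> kills the equations iff the matrices of values of the
  variables satisfy the two triangularity conditions.\<close>

lemma lu_equations_vanish_iff:
  fixes \<phi> :: "lu_poly \<Rightarrow> complex" and m n :: nat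
  assumes "semiring_hom \<phi>"
  defines "A \<equiv> map_mat \<phi> (generic_X m n)" and "B \<equiv> map_mat \<phi> (generic_Y m n)"
  shows "(\<forall>p \<in> lu_equations m n. \<phi> p = 0) \<longleftrightarrow>
    upper_triangular (transpose_mat (A * B)) \<and> upper_triangular (B * A)"
proof -
  interpret semiring_hom \<phi> by (rule assms(1))
  have c: "generic_X m n \<in> carrier_mat m n" "generic_Y m n \<in> carrier_mat n m"
    by (auto simp: generic_X_def generic_Y_def)
  have XY: "generic_X m n * generic_Y m n \<in> carrier_mat m m"
    and YX: "generic_Y m n * generic_X m n \<in> carrier_mat n n"
    using c by auto
  have hom: "A * B = map_mat \<phi> (generic_X m n * generic_Y m n)"
    "B * A = map_mat \<phi> (generic_Y m n * generic_X m n)"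
    using mat_hom_mult[OF c] mat_hom_mult[OF c(2,1)] by (simp_all add: A_def B_def)
  have entry: "\<phi> (M $$ (i, j)) = map_mat \<phi> M $$ (i, j)"
    if "M \<in> carrier_mat k k" "i < k" "j < k" for M k i j
    using that by simp
  have e1: "\<phi> ((generic_X m n * generic_Y m n) $$ (i, j)) = (A * B) $$ (i, j)"
    if "i < j" "j < m" for i j
    unfolding hom(1) using that by (intro entry[OF XY]) linarith+
  have e2: "\<phi> ((generic_Y m n * generic_X m n) $$ (i, j)) = (B * A) $$ (i, j)"
    if "j < i" "i < n" for i j
    unfolding hom(2) using that by (intro entry[OF YX]) linarith+
  have dim: "A * B \<in> carrier_mat m m" "B * A \<in> carrier_mat n n"
    unfolding hom using XY YX by (meson map_carrier_mat)+
  have "upper_triangular (transpose_mat (A * B)) \<longleftrightarrow> (\<forall>j<m. \<forall>i<j. (A * B) $$ (i, j) = 0)"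
    unfolding upper_triangular_def using dim(1)
    by (metis carrier_matD index_transpose_mat less_trans)
  moreover have "upper_triangular (B * A) \<longleftrightarrow> (\<forall>i<n. \<forall>j<i. (B * A) $$ (i, j) = 0)"
    unfolding upper_triangular_def using dim(2) by (metis carrier_matD(1))
  moreover have "(\<forall>p \<in> lu_equations m n. \<phi> p = 0) \<longleftrightarrow>
      (\<forall>j<m. \<forall>i<j. \<phi> ((generic_X m n * generic_Y m n) $$ (i, j)) = 0) \<and>
      (\<forall>i<n. \<forall>j<i. \<phi> ((generic_Y m n * generic_X m n) $$ (i, j)) = 0)"
    unfolding lu_equations_def by blast
  moreover have "(\<forall>j<m. \<forall>i<j. \<phi> ((generic_X m n * generic_Y m n) $$ (i, j)) = 0) \<longleftrightarrow>
      (\<forall>j<m. \<forall>i<j. (A * B) $$ (i, j) = 0)"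
    by (simp only: e1 cong: imp_cong)
  moreover have "(\<forall>i<n. \<forall>j<i. \<phi> ((generic_Y m n * generic_X m n) $$ (i, j)) = 0) \<longleftrightarrow>
      (\<forall>i<n. \<forall>j<i. (B * A) $$ (i, j) = 0)"
    by (simp only: e2 cong: imp_cong)
  ultimately show ?thesis by simp
qed

lemma lu_equations_closed: "lu_equations m n \<subseteq> carrier (poly_ring (lu_vars m n))"
proof -
  let ?R = "poly_ring (lu_vars m n) :: lu_poly ring"
  interpret cring ?R by (rule cring_poly_ring)
  have mult: "p * q \<in> carrier ?R" if "p \<in> carrier ?R" "q \<in> carrier ?R" for p q
    using m_closed[OF that] by (simp add: poly_ring_def)
  have sum: "sum f K \<in> carrier ?R" if "\<And>k. k \<in> K \<Longrightarrow> f k \<in> carrier ?R"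
    for f and K :: "nat set"
    using that
  proof (induction K rule: infinite_finite_induct)
    case (insert k K)
    then have "f k \<oplus>\<^bsub>?R\<^esub> sum f K \<in> carrier ?R" by (intro a_closed) auto
    with insert show ?case by (simp add: poly_ring_def)
  qed (simp_all add: poly_ring_def)
  have X: "poly_var (VX i j) \<in> carrier ?R" "poly_var (VY j i) \<in> carrier ?R"
    if "i < m" "j < n" for i j
    using that by (auto intro!: poly_var_closed simp: lu_vars_def)
  have "(generic_X m n * generic_Y m n) $$ (i, j) \<in> carrier ?R" if "i < j" "j < m" for i j
  proof -
    have "(generic_X m n * generic_Y m n) $$ (i, j) =
        (\<Sum>k = 0..<n. poly_var (VX i k) * poly_var (VY k j))"
      using that by (simp add: generic_X_def generic_Y_def scalar_prod_def)
    also have "\<dots> \<in> carrier ?R"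
      using that by (intro sum mult X) auto
    finally show ?thesis .
  qed
  moreover have "(generic_Y m n * generic_X m n) $$ (i, j) \<in> carrier ?R" if "j < i" "i < n" for i j
  proof -
    have "(generic_Y m n * generic_X m n) $$ (i, j) =
        (\<Sum>k = 0..<m. poly_var (VY i k) * poly_var (VX k j))"
      using that by (simp add: generic_X_def generic_Y_def scalar_prod_def)
    also have "\<dots> \<in> carrier ?R"
      using that by (intro sum mult X) auto
    finally show ?thesis .
  qed
  ultimately show ?thesis unfolding lu_equations_def by blast
qed

end

theory Submission
  imports Defs "HOL-Analysis.Continuum_Not_Denumerable" "Jordan_Normal_Form.Spectral_Radius"
begin

text \<open>
  Every component is shown to have dimension \<open>mn + m\<close>. Let \<open>X\<close> have independent rows. Eliminating
  with the first nonzero entry of its first row removes one row and one column from \<open>X\<close>; the two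
  triangularity conditions then determine all but \<open>p\<close> of the corresponding entries of \<open>Y\<close> (\<open>p\<close> being
  the position of the pivot) and pass to the submatrix of \<open>Y\<close>. Iterating, the points with \<open>X\<close> of rank
  \<open>m\<close> are covered by the images of finitely many polynomial maps from affine spaces of dimension
  \<open>mn + m\<close>, each with a rational left inverse.

  These points are dense: for fixed \<open>Y\<close> the conditions on \<open>X\<close> are linear, and the same elimination,
  after transposition and reversal of the index sets, yields a right invertible solution \<open>A\<close> when
  \<open>m \<le> n\<close>; almost all points of the line through \<open>X\<close> and \<open>A\<close> have independent rows.

  By the Nullstellensatz, every prime ideal over the equations contains the vanishing ideal of one
  of the images. The left inverse yields a chain of \<open>mn + m + 1\<close> primes over that vanishing ideal.
  No chain is longer, since modulo the vanishing ideal any \<open>mn + m + 1\<close> elements satisfy a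
  polynomial relation.
\<close>

text \<open>The source of equidimensionality is a balance. For an m by n matrix \<open>X\<close>
  whose pivot is in column p, counted from 1, the pivot row keeps n - p + 1 free entries, the pivot
  column adds m - 1, and the first column of \<open>Y\<close> keeps p. The sum m + n does not depend
  on p: zeros of \<open>X\<close> before the pivot are paid for by freedom in \<open>Y\<close>. The
  dimension then satisfies mn + m = (m - 1)(n - 1) + (m - 1) + (m + n).

  The pivot row is written as a(1, r) and the rest of the pivot column as av. This makes the
  parametrisation polynomial, and it stays on the scheme for a = 0; division occurs only in its
  inverse.

  A minimal prime over the equations contains, hence equals, the vanishing ideal of one of the
  images. So the chain built over that ideal bounds the dimension of the component from below, and a
  single bound on all chains of primes over the equations bounds it from above.\<close>

section \<open>Homogeneous linear systems\<close>

text \<open>Each equation eliminates one unknown; \<open>B\<close> indexes the equations and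
  \<open>A\<close> the unknowns. All linear counting below rests on this: dependence of inverses in
  the Nullstellensatz, algebraic dependence of polynomials, and a vector orthogonal to too few
  columns.\<close>

lemma homogeneous_system_nontrivial:
  fixes M :: "'b \<Rightarrow> 'a \<Rightarrow> 'f::field"
  assumes "finite B" "finite A" "card B < card A"
  shows "\<exists>c. (\<exists>a\<in>A. c a \<noteq> 0) \<and> (\<forall>b\<in>B. (\<Sum>a\<in>A. M b a * c a) = 0)"
  using assms
proof (induction B arbitrary: A M rule: finite_induct)
  case empty
  then obtain a where "a \<in> A" by fastforce
  then show ?case by (intro exI[of _ "\<lambda>_. 1"]) auto
next
  case (insert b B)
  have finA: "finite A" and lt: "card B < card A" using insert by auto
  show ?case
  proof (cases "\<forall>a\<in>A. M b a = 0")
    case True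
    obtain c where "\<exists>a\<in>A. c a \<noteq> 0" "\<forall>b\<in>B. (\<Sum>a\<in>A. M b a * c a) = 0"
      using insert.IH[OF finA lt, of M] by blast
    with True show ?thesis by (intro exI[of _ c]) simp
  next
    case False
    then obtain a0 where a0: "a0 \<in> A" "M b a0 \<noteq> 0" by blast
    define A' where "A' = A - {a0}"
    have A': "finite A'" "card B < card A'"
      using insert a0 by (auto simp: A'_def)
    define M' where "M' b' a = M b' a - M b' a0 * M b a / M b a0" for b' a
    obtain c where c: "\<exists>a\<in>A'. c a \<noteq> 0" "\<And>b'. b' \<in> B \<Longrightarrow> (\<Sum>a\<in>A'. M' b' a * c a) = 0"
      using insert.IH[OF A', of M'] by blast
    \<comment> \<open>The value of the eliminated unknown that solves equation
      \<open>b\<close>.\<close>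
    define c0 where "c0 = - (\<Sum>a\<in>A'. M b a * c a) / M b a0"
    define c' where "c' = c(a0 := c0)"
    have split: "(\<Sum>a\<in>A. M b' a * c' a) = M b' a0 * c0 + (\<Sum>a\<in>A'. M b' a * c a)" for b'
    proof -
      have "(\<Sum>a\<in>A. M b' a * c' a) = M b' a0 * c' a0 + (\<Sum>a\<in>A'. M b' a * c' a)"
        unfolding A'_def by (rule sum.remove[OF finA a0(1)])
      also have "(\<Sum>a\<in>A'. M b' a * c' a) = (\<Sum>a\<in>A'. M b' a * c a)"
        by (intro sum.cong) (auto simp: A'_def c'_def)
      finally show ?thesis by (simp add: c'_def)
    qed
    have "(\<Sum>a\<in>A. M b' a * c' a) = 0" if "b' \<in> insert b B" for b'
    proof (cases "b' = b")
      case True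
      then show ?thesis unfolding split using a0 by (simp add: c0_def)
    next
      case False
      with that have "b' \<in> B" by simp
      have "(\<Sum>a\<in>A'. M' b' a * c a) =
          (\<Sum>a\<in>A'. M b' a * c a) - (\<Sum>a\<in>A'. M b' a0 / M b a0 * (M b a * c a))"
        unfolding sum_subtractf[symmetric] by (intro sum.cong) (auto simp: M'_def field_simps)
      also have "\<dots> = (\<Sum>a\<in>A'. M b' a * c a) + M b' a0 * c0"
        unfolding sum_distrib_left[symmetric] by (simp add: c0_def)
      finally show ?thesis unfolding split using c(2)[OF \<open>b' \<in> B\<close>] by (simp add: add.commute)
    qed
    moreover have "\<exists>a\<in>A. c' a \<noteq> 0" using c(1) by (auto simp: A'_def c'_def)
    ultimately show ?thesis by blast
  qed
qed

section \<open>Polynomials as functions\<close>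

definition pmono :: "('v \<Rightarrow>\<^sub>0 nat) \<Rightarrow> ('v \<Rightarrow> 'k::comm_ring_1) \<Rightarrow> 'k" where
  "pmono t z = (\<Prod>v\<in>Poly_Mapping.keys t. z v ^ Poly_Mapping.lookup t v)"

definition peval :: "(('v \<Rightarrow>\<^sub>0 nat) \<Rightarrow>\<^sub>0 'k::comm_ring_1) \<Rightarrow> ('v \<Rightarrow> 'k) \<Rightarrow> 'k" where
  "peval p z = (\<Sum>t\<in>Poly_Mapping.keys p. Poly_Mapping.lookup p t * pmono t z)"

lemma pmono_superset:
  assumes "finite S" "Poly_Mapping.keys t \<subseteq> S"
  shows "pmono t z = (\<Prod>v\<in>S. z v ^ Poly_Mapping.lookup t v)"
  unfolding pmono_def
  by (rule prod.mono_neutral_left) (use assms in \<open>auto simp: in_keys_iff\<close>)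

lemma pmono_add: "pmono (s + t) z = pmono s z * pmono t z"
proof -
  let ?S = "Poly_Mapping.keys s \<union> Poly_Mapping.keys t"
  have "Poly_Mapping.keys (s + t) \<subseteq> ?S" by (rule Poly_Mapping.keys_add)
  then show ?thesis
    by (subst (1 2 3) pmono_superset[of ?S])
      (auto simp: lookup_add power_add prod.distrib)
qed

lemma peval_superset:
  assumes "finite S" "Poly_Mapping.keys p \<subseteq> S"
  shows "peval p z = (\<Sum>t\<in>S. Poly_Mapping.lookup p t * pmono t z)"
  unfolding peval_def
  by (rule sum.mono_neutral_left) (use assms in \<open>auto simp: in_keys_iff\<close>)

lemma peval_add: "peval (p + q) z = peval p z + peval q z"
proof -
  let ?S = "Poly_Mapping.keys p \<union> Poly_Mapping.keys q"
  have "Poly_Mapping.keys (p + q) \<subseteq> ?S" by (rule Poly_Mapping.keys_add)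
  then show ?thesis
    by (subst (1 2 3) peval_superset[of ?S])
      (auto simp: lookup_add distrib_right sum.distrib)
qed

lemma peval_zero [simp]: "peval 0 z = 0"
  by (simp add: peval_def)

lemma peval_single: "peval (Poly_Mapping.single t c) z = c * pmono t z"
  by (simp add: peval_def)

lemma peval_one [simp]: "peval 1 z = 1"
  using peval_single[of 0 1 z] by (simp add: pmono_def)

lemma peval_poly_var [simp]: "peval (poly_var v) z = z v"
  by (simp add: poly_var_def peval_single pmono_def)

lemma peval_sum: "peval (sum f A) z = (\<Sum>a\<in>A. peval (f a) z)"
  by (induction A rule: infinite_finite_induct) (auto simp: peval_add)

lemma poly_mapping_sum_singles:
  "p = (\<Sum>t\<in>Poly_Mapping.keys p. Poly_Mapping.single t (Poly_Mapping.lookup p t))"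
proof (rule poly_mapping_eqI)
  fix t
  have "Poly_Mapping.lookup (\<Sum>t\<in>Poly_Mapping.keys p. Poly_Mapping.single t (Poly_Mapping.lookup p t)) t
      = (\<Sum>s\<in>Poly_Mapping.keys p. if s = t then Poly_Mapping.lookup p t else 0)"
    unfolding lookup_sum by (intro sum.cong) (auto simp: lookup_single when_def)
  also have "\<dots> = Poly_Mapping.lookup p t" by (simp add: in_keys_iff)
  finally show "Poly_Mapping.lookup p t = Poly_Mapping.lookup
    (\<Sum>t\<in>Poly_Mapping.keys p. Poly_Mapping.single t (Poly_Mapping.lookup p t)) t" ..
qed

lemma peval_mult: "peval (p * q) z = peval p z * peval q z"
proof -
  have "p * q = (\<Sum>s\<in>Poly_Mapping.keys p. \<Sum>t\<in>Poly_Mapping.keys q.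
      Poly_Mapping.single (s + t) (Poly_Mapping.lookup p s * Poly_Mapping.lookup q t))"
    by (subst poly_mapping_sum_singles[of p], subst poly_mapping_sum_singles[of q])
      (simp add: sum_product mult_single)
  then have "peval (p * q) z = (\<Sum>s\<in>Poly_Mapping.keys p. \<Sum>t\<in>Poly_Mapping.keys q.
      (Poly_Mapping.lookup p s * pmono s z) * (Poly_Mapping.lookup q t * pmono t z))"
    by (simp add: peval_sum peval_single pmono_add mult_ac)
  also have "\<dots> = peval p z * peval q z"
    by (simp add: peval_def sum_product)
  finally show ?thesis .
qed

lemma peval_minus: "peval (- p) z = - peval p z"
  using peval_add[of p "- p" z] by (simp add: eq_neg_iff_add_eq_0 add.commute)

lemma peval_diff: "peval (p - q) z = peval p z - peval q z"
  using peval_add[of p "- q" z] by (simp add: peval_minus)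

lemma peval_prod: "peval (prod f A) z = (\<Prod>a\<in>A. peval (f a) z)"
  by (induction A rule: infinite_finite_induct) (auto simp: peval_mult)

lemma peval_power: "peval (p ^ k) z = peval p z ^ k"
  by (induction k) (auto simp: peval_mult)

section \<open>Polynomials in a fixed set of variables, and the functions they define\<close>

abbreviation pcarrier :: "'v set \<Rightarrow> (('v \<Rightarrow>\<^sub>0 nat) \<Rightarrow>\<^sub>0 'k::comm_ring_1) set" where
  "pcarrier V \<equiv> carrier (poly_ring V)"

lemma pcarrier_iff: "p \<in> pcarrier V \<longleftrightarrow> (\<forall>t \<in> Poly_Mapping.keys p. Poly_Mapping.keys t \<subseteq> V)"
  by (simp add: poly_ring_def)

lemma poly_ring_ops [simp]:
  "p \<oplus>\<^bsub>poly_ring V\<^esub> q = p + q" "p \<otimes>\<^bsub>poly_ring V\<^esub> q = p * q"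
  "\<zero>\<^bsub>poly_ring V\<^esub> = 0" "\<one>\<^bsub>poly_ring V\<^esub> = 1"
  by (simp_all add: poly_ring_def)

lemma pcarrier_zero: "0 \<in> pcarrier V" and pcarrier_one: "1 \<in> pcarrier V"
  by (simp_all add: pcarrier_iff)

lemma pcarrier_const: "Poly_Mapping.single 0 c \<in> pcarrier V"
  by (simp add: pcarrier_iff)

lemma pcarrier_add: "p \<in> pcarrier V \<Longrightarrow> q \<in> pcarrier V \<Longrightarrow> p + q \<in> pcarrier V"
  using cring.cring_simprules(1)[OF cring_poly_ring, of p V q] by simp

lemma pcarrier_mult: "p \<in> pcarrier V \<Longrightarrow> q \<in> pcarrier V \<Longrightarrow> p * q \<in> pcarrier V"
  using cring.cring_simprules(5)[OF cring_poly_ring, of p V q] by simp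

lemma pcarrier_minus: "p \<in> pcarrier V \<Longrightarrow> - p \<in> pcarrier V"
  by (simp add: pcarrier_iff)

lemma pcarrier_diff: "p \<in> pcarrier V \<Longrightarrow> q \<in> pcarrier V \<Longrightarrow> p - q \<in> pcarrier V"
  using pcarrier_add[OF _ pcarrier_minus, of p V q] by simp

lemma pcarrier_power: "p \<in> pcarrier V \<Longrightarrow> p ^ k \<in> pcarrier V"
  by (induction k) (auto intro: pcarrier_one pcarrier_mult)

lemma pcarrier_sum: "(\<And>a. a \<in> A \<Longrightarrow> f a \<in> pcarrier V) \<Longrightarrow> sum f A \<in> pcarrier V"
  by (induction A rule: infinite_finite_induct) (auto intro: pcarrier_zero pcarrier_add)

lemma pcarrier_prod: "(\<And>a. a \<in> A \<Longrightarrow> f a \<in> pcarrier V) \<Longrightarrow> prod f A \<in> pcarrier V"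
  by (induction A rule: infinite_finite_induct) (auto intro: pcarrier_one pcarrier_mult)

lemma peval_cong:
  assumes "p \<in> pcarrier V" "\<And>v. v \<in> V \<Longrightarrow> z v = z' v"
  shows "peval p z = peval p z'"
  unfolding peval_def pmono_def using assms
  by (intro sum.cong prod.cong arg_cong2[where f="(*)"]) (auto simp: pcarrier_iff subset_iff)

text \<open>Evaluation uses only constants, sums, products and coordinates, so a class of functions
  closed under these contains all polynomial expressions. Composition, restriction to a line and
  clearing of denominators are instances with different \<open>C\<close>.\<close>

lemma peval_closure:
  fixes C :: "('a \<Rightarrow> 'k::comm_ring_1) set"
  assumes p: "p \<in> pcarrier V"
    and const: "\<And>c. (\<lambda>x. c) \<in> C"
    and add: "\<And>f g. f \<in> C \<Longrightarrow> g \<in> C \<Longrightarrow> (\<lambda>x. f x + g x) \<in> C"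
    and mult: "\<And>f g. f \<in> C \<Longrightarrow> g \<in> C \<Longrightarrow> (\<lambda>x. f x * g x) \<in> C"
    and var: "\<And>v. v \<in> V \<Longrightarrow> (\<lambda>x. F x v) \<in> C"
  shows "(\<lambda>x. peval p (F x)) \<in> C"
proof -
  have sum: "(\<lambda>x. \<Sum>a\<in>A. f a x) \<in> C" if "finite A" "\<And>a. a \<in> A \<Longrightarrow> f a \<in> C" for A :: "('v \<Rightarrow>\<^sub>0 nat) set" and f
    using that by (induction A rule: finite_induct) (auto intro: const add)
  have power: "(\<lambda>x. f x ^ k) \<in> C" if "f \<in> C" for f k
    using that by (induction k) (auto intro: const mult)
  have prod: "(\<lambda>x. \<Prod>a\<in>A. f a x) \<in> C" if "finite A" "\<And>a. a \<in> A \<Longrightarrow> f a \<in> C" for A :: "'v set" and f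
    using that by (induction A rule: finite_induct) (auto intro: const mult)
  have keys: "v \<in> V" if "t \<in> Poly_Mapping.keys p" "v \<in> Poly_Mapping.keys t" for t v
    using p that by (auto simp: pcarrier_iff)
  show ?thesis unfolding peval_def pmono_def
    by (intro sum mult const prod power var) (auto intro: keys)
qed

text \<open>Charts are handled as functions: feeding one parametrisation into another is then
  composition, and substituted polynomials need not be written out.\<close>

definition polyfun :: "'v set \<Rightarrow> (('v \<Rightarrow> 'k::comm_ring_1) \<Rightarrow> 'k) set" where
  "polyfun V = peval ` pcarrier V"

lemma polyfunE:
  assumes "f \<in> polyfun V" obtains p where "p \<in> pcarrier V" "\<And>z. f z = peval p z"
  using assms by (auto simp: polyfun_def)

lemma polyfunI: "p \<in> pcarrier V \<Longrightarrow> (\<And>z. f z = peval p z) \<Longrightarrow> f \<in> polyfun V"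
  by (auto simp: polyfun_def)

lemma polyfun_const [intro]: "(\<lambda>z. c) \<in> polyfun V"
  by (rule polyfunI[OF pcarrier_const[of c]]) (simp add: peval_single pmono_def)

lemma polyfun_var [intro]: "v \<in> V \<Longrightarrow> (\<lambda>z. z v) \<in> polyfun V"
  by (rule polyfunI[OF poly_var_closed]) auto

lemma polyfun_add [intro]: "f \<in> polyfun V \<Longrightarrow> g \<in> polyfun V \<Longrightarrow> (\<lambda>z. f z + g z) \<in> polyfun V"
  by (elim polyfunE, rule polyfunI[OF pcarrier_add]) (auto simp: peval_add)

lemma polyfun_mult [intro]: "f \<in> polyfun V \<Longrightarrow> g \<in> polyfun V \<Longrightarrow> (\<lambda>z. f z * g z) \<in> polyfun V"
  by (elim polyfunE, rule polyfunI[OF pcarrier_mult]) (auto simp: peval_mult)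

lemma polyfun_minus [intro]: "f \<in> polyfun V \<Longrightarrow> (\<lambda>z. - f z) \<in> polyfun V"
  by (elim polyfunE, rule polyfunI[OF pcarrier_minus]) (auto simp: peval_minus)

lemma polyfun_diff [intro]: "f \<in> polyfun V \<Longrightarrow> g \<in> polyfun V \<Longrightarrow> (\<lambda>z. f z - g z) \<in> polyfun V"
  by (elim polyfunE, rule polyfunI[OF pcarrier_diff]) (auto simp: peval_diff)

lemma polyfun_power [intro]: "f \<in> polyfun V \<Longrightarrow> (\<lambda>z. f z ^ k) \<in> polyfun V"
  by (elim polyfunE, rule polyfunI[OF pcarrier_power]) (auto simp: peval_power)

lemma polyfun_sum [intro]: "(\<And>a. a \<in> A \<Longrightarrow> f a \<in> polyfun V) \<Longrightarrow> (\<lambda>z. \<Sum>a\<in>A. f a z) \<in> polyfun V"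
  by (induction A rule: infinite_finite_induct) auto

lemma polyfun_mono: "f \<in> polyfun V \<Longrightarrow> V \<subseteq> W \<Longrightarrow> f \<in> polyfun W"
  by (elim polyfunE, rule polyfunI) (fastforce simp: pcarrier_iff)+

lemma polyfun_cong: "f \<in> polyfun V \<Longrightarrow> (\<And>v. v \<in> V \<Longrightarrow> z v = z' v) \<Longrightarrow> f z = f z'"
  by (elim polyfunE) (metis peval_cong)

lemma polyfun_compose:
  assumes "f \<in> polyfun V" "\<And>v. v \<in> V \<Longrightarrow> (\<lambda>t. F t v) \<in> polyfun T"
  shows "(\<lambda>t. f (F t)) \<in> polyfun T"
proof -
  obtain p where p: "p \<in> pcarrier V" "\<And>z. f z = peval p z" using assms(1) by (rule polyfunE) blast
  show ?thesis unfolding p(2)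
    by (rule peval_closure[OF p(1), where C="polyfun T"]) (auto intro: assms(2))
qed

text \<open>Both the density argument and the primality of vanishing ideals reduce, along a line, to
  a univariate polynomial with infinitely many zeros.\<close>

lemma polyfun_line:
  assumes "f \<in> polyfun V"
  shows "\<exists>q. \<forall>s. f (\<lambda>v. (1 - s) * a v + s * b v) = poly q s"
proof -
  obtain p where p: "p \<in> pcarrier V" "\<And>z. f z = peval p z" using assms by (rule polyfunE) blast
  let ?C = "{g. \<exists>q. \<forall>s. g s = poly q s}"
  have "(\<lambda>s. peval p (\<lambda>v. (1 - s) * a v + s * b v)) \<in> ?C"
  proof (rule peval_closure[OF p(1)])
    show "(\<lambda>x. c) \<in> ?C" for c by (auto intro: exI[of _ "[:c:]"])
    show "(\<lambda>x. f x + g x) \<in> ?C" if "f \<in> ?C" "g \<in> ?C" for f g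
      using that by (auto, metis poly_add)
    show "(\<lambda>x. f x * g x) \<in> ?C" if "f \<in> ?C" "g \<in> ?C" for f g
      using that by (auto, metis poly_mult)
    show "(\<lambda>s. (1 - s) * a v + s * b v) \<in> ?C" for v
      by (auto simp: algebra_simps intro!: exI[of _ "[:a v, b v - a v:]"])
  qed
  then show ?thesis using p(2) by auto
qed

section \<open>Ideals of the polynomial ring\<close>

text \<open>Negation needs no clause of its own on the right, since \<open>- p\<close> is the
  multiple of \<open>p\<close> by \<open>- 1\<close>.\<close>

lemma poly_ring_ideal_iff:
  fixes M :: "(('v \<Rightarrow>\<^sub>0 nat) \<Rightarrow>\<^sub>0 'k::comm_ring_1) set"
  shows "ideal M (poly_ring V) \<longleftrightarrow> M \<subseteq> pcarrier V \<and> 0 \<in> M \<and>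
    (\<forall>p\<in>M. \<forall>q\<in>M. p + q \<in> M) \<and> (\<forall>p\<in>M. \<forall>r\<in>pcarrier V. r * p \<in> M)"
proof
  assume "ideal M (poly_ring V)"
  then interpret ideal M "poly_ring V" .
  show "M \<subseteq> pcarrier V \<and> 0 \<in> M \<and>
    (\<forall>p\<in>M. \<forall>q\<in>M. p + q \<in> M) \<and> (\<forall>p\<in>M. \<forall>r\<in>pcarrier V. r * p \<in> M)"
    using a_subset additive_subgroup.zero_closed[OF is_additive_subgroup]
      additive_subgroup.a_closed[OF is_additive_subgroup] I_l_closed by auto
next
  assume M: "M \<subseteq> pcarrier V \<and> 0 \<in> M \<and>
    (\<forall>p\<in>M. \<forall>q\<in>M. p + q \<in> M) \<and> (\<forall>p\<in>M. \<forall>r\<in>pcarrier V. r * p \<in> M)"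
  interpret R: cring "poly_ring V :: (('v \<Rightarrow>\<^sub>0 nat) \<Rightarrow>\<^sub>0 'k) ring" by (rule cring_poly_ring)
  have neg: "\<ominus>\<^bsub>poly_ring V\<^esub> p = - p" if "p \<in> pcarrier V" for p :: "('v \<Rightarrow>\<^sub>0 nat) \<Rightarrow>\<^sub>0 'k"
    using R.minus_equality[of "- p" p] that pcarrier_minus[OF that] by simp
  show "ideal M (poly_ring V)"
  proof (rule idealI)
    show "ring (poly_ring V :: (('v \<Rightarrow>\<^sub>0 nat) \<Rightarrow>\<^sub>0 'k) ring)" by (rule R.ring_axioms)
    show "subgroup M (add_monoid (poly_ring V))"
    proof (rule R.add.subgroupI)
      show "\<ominus>\<^bsub>poly_ring V\<^esub> p \<in> M" if "p \<in> M" for p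
      proof -
        have "(- 1) * p \<in> M" using M that pcarrier_minus[OF pcarrier_one] by blast
        with M that show ?thesis by (auto simp: neg subset_iff)
      qed
    qed (use M in auto)
  qed (use M in \<open>auto simp: mult.commute\<close>)
qed

lemma poly_ring_primeideal_iff:
  fixes M :: "(('v \<Rightarrow>\<^sub>0 nat) \<Rightarrow>\<^sub>0 'k::comm_ring_1) set"
  shows "primeideal M (poly_ring V) \<longleftrightarrow> ideal M (poly_ring V) \<and> 1 \<notin> M \<and>
    (\<forall>p\<in>pcarrier V. \<forall>q\<in>pcarrier V. p * q \<in> M \<longrightarrow> p \<in> M \<or> q \<in> M)"
proof
  assume "primeideal M (poly_ring V)"
  then interpret primeideal M "poly_ring V" .
  have "1 \<notin> M" using I_notcarr one_imp_carrier by auto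
  then show "ideal M (poly_ring V) \<and> 1 \<notin> M \<and>
    (\<forall>p\<in>pcarrier V. \<forall>q\<in>pcarrier V. p * q \<in> M \<longrightarrow> p \<in> M \<or> q \<in> M)"
    using ideal_axioms I_prime by simp
next
  assume *: "ideal M (poly_ring V) \<and> 1 \<notin> M \<and>
    (\<forall>p\<in>pcarrier V. \<forall>q\<in>pcarrier V. p * q \<in> M \<longrightarrow> p \<in> M \<or> q \<in> M)"
  then show "primeideal M (poly_ring V)"
    using pcarrier_one[of V] by (intro primeidealI cring_poly_ring) auto
qed

lemma pideal_D:
  assumes "ideal M (poly_ring V)"
  shows "p \<in> M \<Longrightarrow> p \<in> pcarrier V" "0 \<in> M" "p \<in> M \<Longrightarrow> q \<in> M \<Longrightarrow> p + q \<in> M"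
    "p \<in> M \<Longrightarrow> r \<in> pcarrier V \<Longrightarrow> r * p \<in> M" "p \<in> M \<Longrightarrow> r \<in> pcarrier V \<Longrightarrow> p * r \<in> M"
    "p \<in> M \<Longrightarrow> - p \<in> M" "p \<in> M \<Longrightarrow> q \<in> M \<Longrightarrow> p - q \<in> M"
    "(\<And>a. a \<in> A \<Longrightarrow> f a \<in> M) \<Longrightarrow> sum f A \<in> M"
proof -
  note D = assms[unfolded poly_ring_ideal_iff]
  show "p \<in> M \<Longrightarrow> p \<in> pcarrier V" "0 \<in> M" "p \<in> M \<Longrightarrow> q \<in> M \<Longrightarrow> p + q \<in> M"
    and mult: "p \<in> M \<Longrightarrow> r \<in> pcarrier V \<Longrightarrow> r * p \<in> M" for p q r
    using D by auto
  then show "p \<in> M \<Longrightarrow> r \<in> pcarrier V \<Longrightarrow> p * r \<in> M" by (simp add: mult.commute)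
  show neg: "p \<in> M \<Longrightarrow> - p \<in> M" for p
    using mult[of p "- 1"] pcarrier_minus[OF pcarrier_one] by auto
  show "p \<in> M \<Longrightarrow> q \<in> M \<Longrightarrow> p - q \<in> M"
    using D neg[of q] by (metis add_uminus_conv_diff)
  show "(\<And>a. a \<in> A \<Longrightarrow> f a \<in> M) \<Longrightarrow> sum f A \<in> M"
    using D by (induction A rule: infinite_finite_induct) auto
qed

lemma pprime_D:
  assumes "primeideal M (poly_ring V)"
  shows "ideal M (poly_ring V)" "1 \<notin> M"
    "p \<in> pcarrier V \<Longrightarrow> q \<in> pcarrier V \<Longrightarrow> p * q \<in> M \<Longrightarrow> p \<in> M \<or> q \<in> M"
  using assms by (auto simp: poly_ring_primeideal_iff)

lemma pprime_power:
  assumes "primeideal M (poly_ring V)" "p \<in> pcarrier V" "p ^ k \<in> M"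
  shows "p \<in> M"
  using assms(3) pprime_D[OF assms(1)] assms(2) pcarrier_power[OF assms(2)]
  by (induction k) auto

lemma pprime_prod:
  assumes "primeideal M (poly_ring V)" "\<And>a. a \<in> A \<Longrightarrow> f a \<in> pcarrier V" "prod f A \<in> M"
  shows "\<exists>a\<in>A. f a \<in> M"
  using assms(2,3)
proof (induction A rule: infinite_finite_induct)
  case (insert a A)
  then have "f a \<in> M \<or> prod f A \<in> M"
    using pprime_D(3)[OF assms(1), of "f a" "prod f A"] pcarrier_prod[of A f V] by auto
  with insert show ?case by auto
qed (use pprime_D(2)[OF assms(1)] in auto)

lemma pideal_const:
  fixes M :: "(('v \<Rightarrow>\<^sub>0 nat) \<Rightarrow>\<^sub>0 'k::field) set"
  assumes "ideal M (poly_ring V)" "1 \<notin> M" "Poly_Mapping.single 0 c \<in> M"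
  shows "c = 0"
proof (rule ccontr)
  assume "c \<noteq> 0"
  have "Poly_Mapping.single 0 (inverse c) * Poly_Mapping.single 0 c \<in> M"
    by (rule pideal_D(4)[OF assms(1,3) pcarrier_const])
  with \<open>c \<noteq> 0\<close> assms(2) show False by (simp add: mult_single)
qed

section \<open>A Nullstellensatz over the complex numbers\<close>

text \<open>This plays the part of localising at \<open>f\<close>: an ideal maximal among those
  missing all powers of \<open>f\<close> is the trace of a maximal ideal of the localised ring, and
  the last clause says that each \<open>g\<close> outside it becomes invertible there.\<close>

lemma maximal_ideal_avoiding_powers:
  fixes f :: "('v \<Rightarrow>\<^sub>0 nat) \<Rightarrow>\<^sub>0 'k::comm_ring_1"
  assumes P: "ideal P (poly_ring V)" and f: "f \<in> pcarrier V" "\<And>k. f ^ k \<notin> P"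
  shows "\<exists>M. ideal M (poly_ring V) \<and> P \<subseteq> M \<and> (\<forall>k. f ^ k \<notin> M) \<and>
    (\<forall>g\<in>pcarrier V - M. \<exists>k. \<exists>m\<in>M. \<exists>h\<in>pcarrier V. f ^ k = m + h * g)"
proof -
  let ?A = "{M. ideal M (poly_ring V) \<and> P \<subseteq> M \<and> (\<forall>k. f ^ k \<notin> M)}"
  have "\<exists>M\<in>?A. \<forall>X\<in>?A. M \<subseteq> X \<longrightarrow> X = M"
  proof (rule subset_Zorn_nonempty)
    show "?A \<noteq> {}" using P f by auto
    fix C assume "C \<noteq> {}" and C: "subset.chain ?A C"
    have mem: "ideal M (poly_ring V)" "P \<subseteq> M" "\<And>k. f ^ k \<notin> M" if "M \<in> C" for M
      using C that by (auto simp: subset.chain_def)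
    have dir: "M \<subseteq> N \<or> N \<subseteq> M" if "M \<in> C" "N \<in> C" for M N
      using C that by (auto simp: subset.chain_def)
    have "ideal (\<Union>C) (poly_ring V)"
      unfolding poly_ring_ideal_iff
    proof (intro conjI ballI)
      show "\<Union>C \<subseteq> pcarrier V" using mem(1)[THEN pideal_D(1)] by blast
      show "0 \<in> \<Union>C" using \<open>C \<noteq> {}\<close> mem(1)[THEN pideal_D(2)] by blast
      show "p + q \<in> \<Union>C" if "p \<in> \<Union>C" "q \<in> \<Union>C" for p q
      proof -
        obtain M N where "M \<in> C" "N \<in> C" "p \<in> M" "q \<in> N" using \<open>p \<in> \<Union>C\<close> \<open>q \<in> \<Union>C\<close> by blast
        then show ?thesis using dir[of M N] mem(1)[THEN pideal_D(3), of _ p q] by blast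
      qed
      show "r * p \<in> \<Union>C" if "p \<in> \<Union>C" "r \<in> pcarrier V" for p r
        using that mem(1)[THEN pideal_D(4), of _ p r] by blast
    qed
    moreover have "P \<subseteq> \<Union>C" "\<forall>k. f ^ k \<notin> \<Union>C" using \<open>C \<noteq> {}\<close> mem by blast+
    ultimately show "\<Union>C \<in> ?A" by simp
  qed
  then obtain M where MA: "M \<in> ?A" and mx: "\<forall>X\<in>?A. M \<subseteq> X \<longrightarrow> X = M" ..
  from MA have M: "ideal M (poly_ring V)" "P \<subseteq> M" "\<And>k. f ^ k \<notin> M" by simp_all
  have "\<exists>k. \<exists>m\<in>M. \<exists>h\<in>pcarrier V. f ^ k = m + h * g" if g: "g \<in> pcarrier V" "g \<notin> M" for g
  proof (rule ccontr)
    assume no: "\<not> ?thesis"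
    define X where "X = {m + h * g | m h. m \<in> M \<and> h \<in> pcarrier V}"
    have XI: "m + h * g \<in> X" if "m \<in> M" "h \<in> pcarrier V" for m h
      using that by (auto simp: X_def)
    have "M \<subseteq> X" using XI[OF _ pcarrier_zero] by force
    have "g \<in> X" using XI[OF pideal_D(2)[OF M(1)] pcarrier_one] by simp
    have "ideal X (poly_ring V)"
      unfolding poly_ring_ideal_iff
    proof (intro conjI ballI)
      show "X \<subseteq> pcarrier V"
        unfolding X_def using pideal_D(1)[OF M(1)] g(1) by (blast intro: pcarrier_add pcarrier_mult)
      show "0 \<in> X" using pideal_D(2)[OF M(1)] \<open>M \<subseteq> X\<close> by blast
      show "p + q \<in> X" if pq: "p \<in> X" "q \<in> X" for p q
      proof -
        obtain m h m' h' where *: "m \<in> M" "h \<in> pcarrier V" "p = m + h * g"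
          "m' \<in> M" "h' \<in> pcarrier V" "q = m' + h' * g"
          using pq unfolding X_def by blast
        then have eq: "p + q = (m + m') + (h + h') * g" by (simp add: algebra_simps)
        show ?thesis unfolding eq by (intro XI pideal_D(3)[OF M(1)] pcarrier_add *)
      qed
      show "r * p \<in> X" if pr: "p \<in> X" "r \<in> pcarrier V" for p r
      proof -
        obtain m h where *: "m \<in> M" "h \<in> pcarrier V" "p = m + h * g"
          using pr unfolding X_def by blast
        then have eq: "r * p = r * m + (r * h) * g" by (simp add: algebra_simps)
        show ?thesis unfolding eq by (intro XI pideal_D(4)[OF M(1)] pcarrier_mult * pr)
      qed
    qed
    moreover have "\<forall>k. f ^ k \<notin> X" using no unfolding X_def by blast
    ultimately have "X \<in> ?A" using M(2) \<open>M \<subseteq> X\<close> by simp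
    then have "X = M" using mx \<open>M \<subseteq> X\<close> by simp
    with \<open>g \<in> X\<close> g(2) show False by simp
  qed
  then show ?thesis using M by blast
qed

text \<open>Bounding each exponent instead of the total degree makes the count a plain power, and
  the bounds add when polynomials are multiplied.\<close>

definition pbox :: "'v set \<Rightarrow> nat \<Rightarrow> ('v \<Rightarrow>\<^sub>0 nat) set" where
  "pbox V e = {t. Poly_Mapping.keys t \<subseteq> V \<and> (\<forall>v. Poly_Mapping.lookup t v \<le> e)}"

lemma pbox_finite_card:
  assumes "finite V"
  shows "finite (pbox V e)" "card (pbox V e) \<le> (e + 1) ^ card V"
proof -
  let ?F = "PiE V (\<lambda>_. {..e})"
  let ?r = "\<lambda>t :: 'a \<Rightarrow>\<^sub>0 nat. restrict (Poly_Mapping.lookup t) V"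
  have fin: "finite ?F" using assms by (intro finite_PiE) auto
  have sub: "?r ` pbox V e \<subseteq> ?F" by (auto simp: pbox_def)
  have inj: "inj_on ?r (pbox V e)"
  proof (rule inj_onI, rule poly_mapping_eqI)
    fix s t v assume *: "s \<in> pbox V e" "t \<in> pbox V e" "?r s = ?r t"
    show "Poly_Mapping.lookup s v = Poly_Mapping.lookup t v"
    proof (cases "v \<in> V")
      case True
      then show ?thesis using fun_cong[OF *(3), of v] by simp
    next
      case False
      then have "v \<notin> Poly_Mapping.keys s" "v \<notin> Poly_Mapping.keys t" using * by (auto simp: pbox_def)
      then show ?thesis by (simp add: in_keys_iff)
    qed
  qed
  show "finite (pbox V e)" using inj_on_finite[OF inj sub fin] .
  have "card (pbox V e) \<le> card ?F" by (rule card_inj_on_le[OF inj sub fin])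
  then show "card (pbox V e) \<le> (e + 1) ^ card V" by (simp add: card_PiE assms)
qed

lemma keys_subset_pbox:
  assumes "p \<in> pcarrier V"
  shows "\<exists>e. Poly_Mapping.keys p \<subseteq> pbox V e"
proof -
  let ?E = "\<Union>t\<in>Poly_Mapping.keys p. Poly_Mapping.lookup t ` Poly_Mapping.keys t"
  have "Poly_Mapping.lookup t v \<le> Max (insert 0 ?E)" if t: "t \<in> Poly_Mapping.keys p" for t v
  proof (cases "v \<in> Poly_Mapping.keys t")
    case True
    with t show ?thesis by (intro Max_ge) auto
  next
    case False
    then show ?thesis by (simp add: in_keys_iff)
  qed
  with assms show ?thesis by (intro exI[of _ "Max (insert 0 ?E)"]) (auto simp: pbox_def pcarrier_iff)
qed

lemma pbox_mono: "d \<le> e \<Longrightarrow> pbox V d \<subseteq> pbox V e"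
  unfolding pbox_def by (auto, meson le_trans)

lemma pcarrier_induct [consumes 1, case_names const add mult]:
  fixes p :: "('v \<Rightarrow>\<^sub>0 nat) \<Rightarrow>\<^sub>0 'k::comm_ring_1"
  assumes p: "p \<in> pcarrier V"
    and const: "\<And>c. Q (Poly_Mapping.single 0 c)"
    and add: "\<And>p q. p \<in> pcarrier V \<Longrightarrow> q \<in> pcarrier V \<Longrightarrow> Q p \<Longrightarrow> Q q \<Longrightarrow> Q (p + q)"
    and mult: "\<And>p v. p \<in> pcarrier V \<Longrightarrow> v \<in> V \<Longrightarrow> Q p \<Longrightarrow> Q (poly_var v * p)"
  shows "Q p"
proof -
  have power: "q \<in> pcarrier V \<Longrightarrow> Q q \<Longrightarrow> v \<in> V \<Longrightarrow> Q (Poly_Mapping.single (Poly_Mapping.single v k) 1 * q)" for q v k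
  proof (induction k arbitrary: q)
    case (Suc k)
    have "Poly_Mapping.single (Poly_Mapping.single v (Suc k)) (1 :: 'k) =
        Poly_Mapping.single (Poly_Mapping.single v k) 1 * poly_var v"
      by (simp add: poly_var_def mult_single flip: single_add)
    with Suc.IH[of "poly_var v * q"] mult[of q v] Suc.prems show ?case
      by (simp add: mult.assoc pcarrier_mult poly_var_closed)
  qed simp
  have single: "Q (Poly_Mapping.single t c)" if t: "Poly_Mapping.keys t \<subseteq> V" for t c
  proof -
    have "Q (Poly_Mapping.single (\<Sum>v\<in>A. Poly_Mapping.single v (Poly_Mapping.lookup t v)) c) \<and>
        Poly_Mapping.single (\<Sum>v\<in>A. Poly_Mapping.single v (Poly_Mapping.lookup t v)) c \<in> pcarrier V"
      if "finite A" "A \<subseteq> V" for A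
      using that
    proof (induction A rule: finite_induct)
      case (insert v A)
      let ?s = "\<Sum>v\<in>A. Poly_Mapping.single v (Poly_Mapping.lookup t v)"
      have eq: "Poly_Mapping.single (\<Sum>v\<in>insert v A. Poly_Mapping.single v (Poly_Mapping.lookup t v)) c
        = Poly_Mapping.single (Poly_Mapping.single v (Poly_Mapping.lookup t v)) 1 * Poly_Mapping.single ?s c"
        using insert.hyps by (simp add: mult_single)
      have "Poly_Mapping.single (Poly_Mapping.single v (Poly_Mapping.lookup t v)) (1 :: 'k) \<in> pcarrier V"
        using insert.prems by (simp add: pcarrier_iff)
      with insert show ?case unfolding eq by (auto intro!: power pcarrier_mult)
    qed (simp add: const pcarrier_const)
    from this[OF _ t] show ?thesis by (simp flip: poly_mapping_sum_singles[of t])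
  qed
  have "Q (\<Sum>t\<in>A. Poly_Mapping.single t (Poly_Mapping.lookup p t)) \<and>
      (\<Sum>t\<in>A. Poly_Mapping.single t (Poly_Mapping.lookup p t)) \<in> pcarrier V"
    if "finite A" "A \<subseteq> Poly_Mapping.keys p" for A
    using that
  proof (induction A rule: finite_induct)
    case empty
    show ?case using const[of 0] by (simp add: pcarrier_zero)
  next
    case (insert t A)
    then have t: "Poly_Mapping.keys t \<subseteq> V" using p by (auto simp: pcarrier_iff)
    then have "Poly_Mapping.single t (Poly_Mapping.lookup p t) \<in> pcarrier V"
      by (simp add: pcarrier_iff)
    with insert t show ?case by (auto intro!: add single pcarrier_add)
  qed
  from this[of "Poly_Mapping.keys p"] show ?thesis by (simp flip: poly_mapping_sum_singles[of p])
qed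

section \<open>Constants and univariate polynomials inside the polynomial ring\<close>

abbreviation pconst :: "'k::comm_ring_1 \<Rightarrow> ('v \<Rightarrow>\<^sub>0 nat) \<Rightarrow>\<^sub>0 'k" where
  "pconst c \<equiv> Poly_Mapping.single 0 c"

lemma peval_const [simp]: "peval (pconst c) z = c"
  by (simp add: peval_single pmono_def)

lemma lookup_pconst_mult [simp]:
  "Poly_Mapping.lookup (pconst c * p) t = c * Poly_Mapping.lookup p t"
  by (simp add: Poly_Mapping.map.rep_eq when_def flip: mult_map_scale_conv_mult)

lemma pconst_comm_ring_hom: "comm_ring_hom (pconst :: 'k::comm_ring_1 \<Rightarrow> ('v \<Rightarrow>\<^sub>0 nat) \<Rightarrow>\<^sub>0 'k)"
  by unfold_locales (simp_all add: single_add mult_single)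

text \<open>Over the complex numbers \<open>q\<close> splits into linear factors, and a prime ideal
  containing the product of their values at \<open>x\<close> contains one of them; the constant
  factor is a unit.\<close>

lemma prime_contains_linear_factor:
  fixes q :: "complex poly" and x :: "('v \<Rightarrow>\<^sub>0 nat) \<Rightarrow>\<^sub>0 complex"
  assumes M: "primeideal M (poly_ring V)" and x: "x \<in> pcarrier V"
    and q: "q \<noteq> 0" "poly (map_poly pconst q) x \<in> M"
  shows "\<exists>c. x - pconst c \<in> M"
  using q
proof (induction "degree q" arbitrary: q)
  case 0
  then obtain c where c: "q = [:c:]" by (metis degree_eq_zeroE)
  with 0 have "pconst c \<in> M" by (simp add: Polynomial.map_poly_pCons)
  then have "c = 0" using pideal_const pprime_D[OF M] by blast
  with c 0 show ?case by simp
next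
  case (Suc n)
  interpret pconst: comm_ring_hom "pconst :: complex \<Rightarrow> ('v \<Rightarrow>\<^sub>0 nat) \<Rightarrow>\<^sub>0 complex"
    by (rule pconst_comm_ring_hom)
  interpret map_poly_comm_ring_hom "pconst :: complex \<Rightarrow> ('v \<Rightarrow>\<^sub>0 nat) \<Rightarrow>\<^sub>0 complex" ..
  have car: "poly (map_poly pconst r) x \<in> pcarrier V" for r
    using x by (induction r) (auto intro: pcarrier_zero pcarrier_add pcarrier_mult pcarrier_const
        simp: Polynomial.map_poly_pCons)
  have "\<not> constant (poly q)" using Suc.hyps(2) constant_degree[of q] by simp
  then obtain c where "poly q c = 0" using fundamental_theorem_of_algebra by blast
  then obtain r where r: "q = [:- c, 1:] * r" by (metis poly_eq_0_iff_dvd dvdE)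
  have "r \<noteq> 0" using Suc.prems r by auto
  have "degree q = Suc (degree r)" unfolding r using \<open>r \<noteq> 0\<close> by (subst degree_mult_eq) auto
  then have deg: "n = degree r" using Suc.hyps(2) by simp
  have "poly (map_poly pconst q) x = (x - pconst c) * poly (map_poly pconst r) x"
    unfolding r hom_mult by (simp add: Polynomial.map_poly_pCons single_uminus algebra_simps)
  then have "x - pconst c \<in> M \<or> poly (map_poly pconst r) x \<in> M"
    using pprime_D(3)[OF M pcarrier_diff[OF x pcarrier_const[of c]] car[of r]] Suc.prems by simp
  then show ?case using Suc.hyps(1)[OF deg \<open>r \<noteq> 0\<close>] by blast
qed

text \<open>The inverses, up to powers of \<open>f\<close>, of the elements \<open>x - c\<close> modulo \<open>M\<close> form an uncountable
  family in a ring of countable dimension, hence are linearly dependent; so \<open>x\<close> is algebraic modulo \<open>M\<close>.\<close>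

lemma variable_congruent_constant:
  fixes M :: "(('v \<Rightarrow>\<^sub>0 nat) \<Rightarrow>\<^sub>0 complex) set"
  assumes V: "finite V" and M: "primeideal M (poly_ring V)" and f: "f \<in> pcarrier V" "f \<notin> M"
    and max: "\<And>g. g \<in> pcarrier V \<Longrightarrow> g \<notin> M \<Longrightarrow> \<exists>k. \<exists>m\<in>M. \<exists>h\<in>pcarrier V. f ^ k = m + h * g"
    and x: "x \<in> pcarrier V"
  shows "\<exists>c. x - pconst c \<in> M"
proof (rule ccontr)
  note ideal = pprime_D(1)[OF M]
  assume no: "\<not> ?thesis"
  have lin: "x - pconst c \<in> pcarrier V" for c by (intro pcarrier_diff x pcarrier_const)
  have "\<forall>c. \<exists>k e m h. m \<in> M \<and> h \<in> pcarrier V \<and> f ^ k = m + h * (x - pconst c) \<and>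
      Poly_Mapping.keys h \<subseteq> pbox V e"
    using max[OF lin] no keys_subset_pbox by metis
  then obtain k e m h where kemh: "\<And>c. m c \<in> M" "\<And>c. h c \<in> pcarrier V"
    "\<And>c. f ^ k c = m c + h c * (x - pconst c)" "\<And>c. Poly_Mapping.keys (h c) \<subseteq> pbox V (e c)"
    by metis
  \<comment> \<open>There are uncountably many \<open>c\<close> but only countably many pairs of an
    exponent and a box, so infinitely many \<open>c\<close> share both.\<close>
  have "\<exists>K E. infinite {c. k c = K \<and> e c = E}"
  proof (rule ccontr)
    assume "\<not> ?thesis"
    then have "countable {c. k c = K \<and> e c = E}" for K E
      by (intro countable_finite) simp
    then have "countable (\<Union>K. \<Union>E. {c. k c = K \<and> e c = E})"
      by (intro countable_UN countableI_type)
    moreover have "(\<Union>K. \<Union>E. {c. k c = K \<and> e c = E}) = UNIV" by auto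
    ultimately show False using uncountable_UNIV_complex by simp
  qed
  then obtain K E where inf: "infinite {c. k c = K \<and> e c = E}" by blast
  \<comment> \<open>One element more than there are monomials in the box forces a linear relation
    among the \<open>h a\<close>.\<close>
  obtain A where A: "A \<subseteq> {c. k c = K \<and> e c = E}" "finite A" "card A = Suc (card (pbox V E))"
    using infinite_arbitrarily_large[OF inf] by blast
  obtain l where l: "\<exists>a\<in>A. l a \<noteq> 0"
    "\<forall>t\<in>pbox V E. (\<Sum>a\<in>A. Poly_Mapping.lookup (h a) t * l a) = 0"
    using homogeneous_system_nontrivial[OF pbox_finite_card(1)[OF V] A(2), of E "\<lambda>t a. Poly_Mapping.lookup (h a) t"] A(3)
    by auto
  have dep: "(\<Sum>a\<in>A. pconst (l a) * h a) = 0"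
  proof (rule poly_mapping_eqI)
    fix t
    have "(\<Sum>a\<in>A. l a * Poly_Mapping.lookup (h a) t) = 0"
    proof (cases "t \<in> pbox V E")
      case True
      then show ?thesis using l(2) by (simp add: mult.commute)
    next
      case False
      then have "Poly_Mapping.lookup (h a) t = 0" if "a \<in> A" for a
        using kemh(4)[of a] A(1) that by (auto simp: in_keys_iff)
      then show ?thesis by simp
    qed
    then show "Poly_Mapping.lookup (\<Sum>a\<in>A. pconst (l a) * h a) t = Poly_Mapping.lookup 0 t"
      by (simp add: lookup_sum)
  qed
  \<comment> \<open>The numerator of the sum of the fractions \<open>l a / (x - a)\<close> over
    their common denominator. Its value at \<open>a0\<close> is a nonzero multiple of
    \<open>l a0\<close>, so it is not the zero polynomial.\<close>
  define q where "q = (\<Sum>a\<in>A. [:l a:] * (\<Prod>b\<in>A - {a}. [:- b, 1:]))"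
  interpret pconst: comm_ring_hom "pconst :: complex \<Rightarrow> ('v \<Rightarrow>\<^sub>0 nat) \<Rightarrow>\<^sub>0 complex"
    by (rule pconst_comm_ring_hom)
  interpret map_poly_comm_ring_hom "pconst :: complex \<Rightarrow> ('v \<Rightarrow>\<^sub>0 nat) \<Rightarrow>\<^sub>0 complex" ..
  obtain a0 where a0: "a0 \<in> A" "l a0 \<noteq> 0" using l(1) by blast
  have "poly q a0 = (\<Sum>a\<in>A. l a * (\<Prod>b\<in>A - {a}. a0 - b))"
    by (simp add: q_def poly_sum poly_prod)
  also have "\<dots> = l a0 * (\<Prod>b\<in>A - {a0}. a0 - b) + (\<Sum>a\<in>A - {a0}. l a * (\<Prod>b\<in>A - {a}. a0 - b))"
    by (rule sum.remove[OF A(2) a0(1)])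
  also have "(\<Sum>a\<in>A - {a0}. l a * (\<Prod>b\<in>A - {a}. a0 - b)) = 0"
  proof (rule sum.neutral, rule ballI)
    fix a assume "a \<in> A - {a0}"
    then have "(\<Prod>b\<in>A - {a}. a0 - b) = 0" using A(2) a0(1) by (intro prod_zero) auto
    then show "l a * (\<Prod>b\<in>A - {a}. a0 - b) = 0" by simp
  qed
  finally have "poly q a0 = l a0 * (\<Prod>b\<in>A - {a0}. a0 - b)" by simp
  then have "poly q a0 \<noteq> 0" using a0 A(2) by simp
  then have "q \<noteq> 0" by auto
  have const: "poly (map_poly pconst [:c:]) x = pconst c" for c
    by (simp add: Polynomial.map_poly_pCons)
  have Q: "poly (map_poly pconst q) x =
      (\<Sum>a\<in>A. pconst (l a) * (\<Prod>b\<in>A - {a}. x - pconst b))"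
    unfolding q_def hom_sum poly_sum hom_mult hom_prod poly_mult poly_prod const
    by (simp add: Polynomial.map_poly_pCons single_uminus)
  have fk: "f ^ K = m a + h a * (x - pconst a)" if "a \<in> A" for a
    using kemh(3)[of a] A(1) that by auto
  have prod: "(\<Prod>b\<in>A - {a}. x - pconst b) \<in> pcarrier V" for a by (intro pcarrier_prod lin)
  \<comment> \<open>Modulo \<open>M\<close>, the factor \<open>f ^ K\<close> supplies the missing
    \<open>x - pconst a\<close> in each summand. The full product then comes out, and its cofactor
    is the combination that vanishes by \<open>dep\<close>.\<close>
  have "poly (map_poly pconst q) x * f ^ K =
      (\<Sum>a\<in>A. pconst (l a) * (\<Prod>b\<in>A - {a}. x - pconst b) * (m a + h a * (x - pconst a)))"
    unfolding Q sum_distrib_right by (intro sum.cong) (simp_all add: fk)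
  also have "\<dots> = (\<Sum>a\<in>A. pconst (l a) * (\<Prod>b\<in>A - {a}. x - pconst b) * m a
      + (pconst (l a) * h a) * (\<Prod>b\<in>A. x - pconst b))"
    by (intro sum.cong) (simp_all add: prod.remove[OF A(2)] algebra_simps)
  also have "\<dots> = (\<Sum>a\<in>A. pconst (l a) * (\<Prod>b\<in>A - {a}. x - pconst b) * m a)"
    by (simp add: sum.distrib dep flip: sum_distrib_right)
  also have "\<dots> \<in> M"
    by (intro pideal_D(8)[OF ideal] pideal_D(4)[OF ideal] kemh pcarrier_mult pcarrier_const prod)
  finally have "poly (map_poly pconst q) x * f ^ K \<in> M" .
  moreover have "poly (map_poly pconst q) x \<in> pcarrier V"
    unfolding Q by (intro pcarrier_sum pcarrier_mult pcarrier_const prod)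
  ultimately have "poly (map_poly pconst q) x \<in> M"
    using pprime_D(3)[OF M _ pcarrier_power[OF f(1)]] pprime_power[OF M f(1)] f(2) by blast
  then show False using prime_contains_linear_factor[OF M x \<open>q \<noteq> 0\<close>] no by blast
qed

text \<open>The ideal \<open>M\<close> maximal away from \<open>f\<close> turns out to consist of
  the polynomials vanishing at one point, whose coordinates are the constants congruent to the
  variables. That \<open>f\<close> does not vanish there is what lets a prime ideal be recovered
  from its zeros.\<close>

theorem nullstellensatz:
  fixes P :: "(('v \<Rightarrow>\<^sub>0 nat) \<Rightarrow>\<^sub>0 complex) set"
  assumes V: "finite V" and P: "primeideal P (poly_ring V)" and f: "f \<in> pcarrier V" "f \<notin> P"
  shows "\<exists>z. (\<forall>p\<in>P. peval p z = 0) \<and> peval f z \<noteq> 0"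
proof -
  have "f ^ k \<notin> P" for k using pprime_power[OF P f(1)] f(2) by blast
  from maximal_ideal_avoiding_powers[OF pprime_D(1)[OF P] f(1) this]
  obtain M where ideal: "ideal M (poly_ring V)" and M: "P \<subseteq> M" "\<And>k. f ^ k \<notin> M"
    and max: "\<And>g. g \<in> pcarrier V \<Longrightarrow> g \<notin> M \<Longrightarrow> \<exists>k. \<exists>m\<in>M. \<exists>h\<in>pcarrier V. f ^ k = m + h * g"
    by (metis DiffI)
  have f1: "f \<notin> M" "1 \<notin> M" using M(2)[of 1] M(2)[of 0] by simp_all
  have prime: "primeideal M (poly_ring V)"
    unfolding poly_ring_primeideal_iff
  proof (intro conjI ballI impI ideal f1)
    fix p q assume pq: "p \<in> pcarrier V" "q \<in> pcarrier V" "p * q \<in> M"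
    show "p \<in> M \<or> q \<in> M"
    proof (rule ccontr)
      assume "\<not> ?thesis"
      then obtain k m h k' m' h' where *: "m \<in> M" "h \<in> pcarrier V" "f ^ k = m + h * p"
        "m' \<in> M" "h' \<in> pcarrier V" "f ^ k' = m' + h' * q"
        using max[OF pq(1)] max[OF pq(2)] by blast
      have "f ^ (k + k') = m * f ^ k' + (h * p) * m' + (h * h') * (p * q)"
        unfolding power_add *(3) by (simp add: * algebra_simps)
      also have "\<dots> \<in> M"
        by (intro pideal_D(3,4,5)[OF ideal] * pq pcarrier_mult pcarrier_power f)
      finally show False using M(2) by blast
    qed
  qed
  have "\<forall>v\<in>V. \<exists>c. poly_var v - pconst c \<in> M"
    by (intro ballI variable_congruent_constant[OF V prime f(1) f1(1) max] poly_var_closed)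
  then obtain z where z: "\<And>v. v \<in> V \<Longrightarrow> poly_var v - pconst (z v) \<in> M" by metis
  have cong: "p - pconst (peval p z) \<in> M" if "p \<in> pcarrier V" for p
    using that
  proof (induction p rule: pcarrier_induct)
    case (const c)
    show ?case using pideal_D(2)[OF ideal] by simp
  next
    case (add p q)
    have "p + q - pconst (peval (p + q) z) = (p - pconst (peval p z)) + (q - pconst (peval q z))"
      by (simp add: peval_add single_add)
    with add show ?case by (metis pideal_D(3)[OF ideal])
  next
    case (mult p v)
    have "poly_var v * p - pconst (peval (poly_var v * p) z) =
        (poly_var v - pconst (z v)) * p + pconst (z v) * (p - pconst (peval p z))"
      by (simp add: peval_mult algebra_simps mult_single)
    also have "\<dots> \<in> M"
      by (intro pideal_D(3,4,5)[OF ideal] z mult pcarrier_const)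
    finally show ?case .
  qed
  have "peval p z = 0" if "p \<in> P" for p
  proof -
    have "p \<in> M" using that M(1) by blast
    then have "p - (p - pconst (peval p z)) \<in> M"
      using cong pideal_D(1)[OF ideal] pideal_D(7)[OF ideal] by blast
    then show ?thesis using pideal_const[OF ideal f1(2)] by simp
  qed
  moreover have "peval f z \<noteq> 0" using cong[OF f(1)] f1(1) by auto
  ultimately show ?thesis by blast
qed

section \<open>Bounding chains of prime ideals\<close>

text \<open>Only the lexicographically lowest exponents matter: a relation modulo \<open>Q j\<close>, divided by the
  lowest power of \<open>x j\<close>, becomes a relation in the later variables modulo \<open>Q (Suc j)\<close>.\<close>

lemma prime_chain_independent:
  fixes Q :: "nat \<Rightarrow> (('v \<Rightarrow>\<^sub>0 nat) \<Rightarrow>\<^sub>0 'k::field) set"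
  assumes prime: "\<And>i. i \<le> n \<Longrightarrow> primeideal (Q i) (poly_ring V)"
    and sub: "\<And>i. i < n \<Longrightarrow> Q i \<subseteq> Q (Suc i)"
    and x: "\<And>i. i < n \<Longrightarrow> x i \<in> Q (Suc i) - Q i"
    and K: "finite K" "\<kappa> \<in> K" "\<And>\<kappa>. \<kappa> \<in> K \<Longrightarrow> c \<kappa> \<noteq> 0" "K \<subseteq> extensional {..<n}"
  shows "(\<Sum>\<kappa>\<in>K. pconst (c \<kappa>) * (\<Prod>i<n. x i ^ \<kappa> i)) \<notin> Q 0"
proof -
  have xc: "x i \<in> pcarrier V" if "i < n" for i
    using x[OF that] pideal_D(1)[OF pprime_D(1)[OF prime[of "Suc i"]]] that by auto
  \<comment> \<open>Stated for tails of the exponent vectors, which must determine the elements of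
    \<open>K\<close>. The condition passes to \<open>K'\<close>, on which the exponent at
    \<open>j\<close> is constant.\<close>
  have claim: "(\<Sum>\<kappa>\<in>K. pconst (c \<kappa>) * (\<Prod>i\<in>{j..<n}. x i ^ \<kappa> i)) \<notin> Q j"
    if "j \<le> n" "finite K" "K \<noteq> {}" "\<And>\<kappa>. \<kappa> \<in> K \<Longrightarrow> c \<kappa> \<noteq> 0"
      "\<And>\<kappa> \<kappa>'. \<kappa> \<in> K \<Longrightarrow> \<kappa>' \<in> K \<Longrightarrow> \<forall>i\<in>{j..<n}. \<kappa> i = \<kappa>' i \<Longrightarrow> \<kappa> = \<kappa>'" for j K
    using that
  proof (induction j arbitrary: K rule: inc_induct)
    case base
    then obtain \<kappa> where "\<kappa> \<in> K" by blast
    with base have "K = {\<kappa>}" by auto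
    then show ?case using base pideal_const[OF pprime_D(1,2)[OF prime[of n]]] by auto
  next
    case (step j)
    have j: "j < n" by fact
    define a where "a = Min ((\<lambda>\<kappa>. \<kappa> j) ` K)"
    define K' where "K' = {\<kappa>\<in>K. \<kappa> j = a}"
    have a: "a \<le> \<kappa> j" if "\<kappa> \<in> K" for \<kappa> unfolding a_def using that step.prems by auto
    have "a \<in> (\<lambda>\<kappa>. \<kappa> j) ` K" unfolding a_def using step.prems by (intro Min_in) auto
    then have "K' \<noteq> {}" by (auto simp: K'_def)
    let ?m = "\<lambda>\<kappa>. pconst (c \<kappa>) * (\<Prod>i\<in>{Suc j..<n}. x i ^ \<kappa> i)"
    have mc: "?m \<kappa> \<in> pcarrier V" for \<kappa>
      by (intro pcarrier_mult pcarrier_const pcarrier_prod pcarrier_power xc) auto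
    have IH: "(\<Sum>\<kappa>\<in>K'. ?m \<kappa>) \<notin> Q (Suc j)"
    proof (rule step.IH)
      show "finite K'" "K' \<noteq> {}" using step.prems \<open>K' \<noteq> {}\<close> by (auto simp: K'_def)
      show "c \<kappa> \<noteq> 0" if "\<kappa> \<in> K'" for \<kappa> using that step.prems by (auto simp: K'_def)
      show "\<kappa> = \<kappa>'" if "\<kappa> \<in> K'" "\<kappa>' \<in> K'" "\<forall>i\<in>{Suc j..<n}. \<kappa> i = \<kappa>' i" for \<kappa> \<kappa>'
      proof (rule step.prems(4))
        show "\<forall>i\<in>{j..<n}. \<kappa> i = \<kappa>' i"
        proof
          fix i assume "i \<in> {j..<n}"
          with that show "\<kappa> i = \<kappa>' i" by (cases "i = j") (auto simp: K'_def)
        qed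
      qed (use that in \<open>auto simp: K'_def\<close>)
    qed
    \<comment> \<open>The terms outside \<open>K'\<close> carry, after division by
      \<open>x j ^ a\<close>, a further factor \<open>x j\<close>, which lies in
      \<open>Q (Suc j)\<close>.\<close>
    let ?r = "\<Sum>\<kappa>\<in>K - K'. x j ^ (\<kappa> j - a - 1) * ?m \<kappa>"
    have rc: "?r \<in> pcarrier V"
      by (intro pcarrier_sum pcarrier_mult[OF pcarrier_power[OF xc[OF j]] mc])
    have "(\<Sum>\<kappa>\<in>K. pconst (c \<kappa>) * (\<Prod>i\<in>{j..<n}. x i ^ \<kappa> i)) = (\<Sum>\<kappa>\<in>K. x j ^ \<kappa> j * ?m \<kappa>)"
      using j by (intro sum.cong) (simp_all add: prod.atLeast_Suc_lessThan mult_ac)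
    also have "\<dots> = (\<Sum>\<kappa>\<in>K'. x j ^ \<kappa> j * ?m \<kappa>) + (\<Sum>\<kappa>\<in>K - K'. x j ^ \<kappa> j * ?m \<kappa>)"
      using step.prems by (subst sum.subset_diff[of K' K]) (auto simp: K'_def add.commute)
    also have "(\<Sum>\<kappa>\<in>K'. x j ^ \<kappa> j * ?m \<kappa>) = x j ^ a * (\<Sum>\<kappa>\<in>K'. ?m \<kappa>)"
      unfolding sum_distrib_left by (intro sum.cong) (auto simp: K'_def)
    also have "(\<Sum>\<kappa>\<in>K - K'. x j ^ \<kappa> j * ?m \<kappa>) = x j ^ a * (x j * ?r)"
      unfolding sum_distrib_left
    proof (intro sum.cong refl)
      fix \<kappa> assume "\<kappa> \<in> K - K'"
      with a[of \<kappa>] have "\<kappa> j = a + Suc (\<kappa> j - a - 1)" by (auto simp: K'_def)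
      then have "x j ^ \<kappa> j = x j ^ a * (x j * x j ^ (\<kappa> j - a - 1))"
        by (metis power_add power_Suc)
      then show "x j ^ \<kappa> j * ?m \<kappa> = x j ^ a * (x j * (x j ^ (\<kappa> j - a - 1) * ?m \<kappa>))"
        by (simp only: mult.assoc)
    qed
    finally have eq: "(\<Sum>\<kappa>\<in>K. pconst (c \<kappa>) * (\<Prod>i\<in>{j..<n}. x i ^ \<kappa> i)) =
        x j ^ a * ((\<Sum>\<kappa>\<in>K'. ?m \<kappa>) + x j * ?r)"
      by (simp only: distrib_left)
    show ?case
    proof
      assume "(\<Sum>\<kappa>\<in>K. pconst (c \<kappa>) * (\<Prod>i\<in>{j..<n}. x i ^ \<kappa> i)) \<in> Q j"
      then have *: "x j ^ a * ((\<Sum>\<kappa>\<in>K'. ?m \<kappa>) + x j * ?r) \<in> Q j" unfolding eq .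
      have pj: "primeideal (Q j) (poly_ring V)" using prime j by simp
      have ps: "ideal (Q (Suc j)) (poly_ring V)" using pprime_D(1)[OF prime[of "Suc j"]] j by simp
      have "(\<Sum>\<kappa>\<in>K'. ?m \<kappa>) + x j * ?r \<in> pcarrier V"
        by (intro pcarrier_add pcarrier_mult rc xc j pcarrier_sum mc)
      from pprime_D(3)[OF pj pcarrier_power[OF xc[OF j]] this *]
      have "(\<Sum>\<kappa>\<in>K'. ?m \<kappa>) + x j * ?r \<in> Q j"
        using pprime_power[OF pj xc[OF j]] x[OF j] by blast
      then have "(\<Sum>\<kappa>\<in>K'. ?m \<kappa>) + x j * ?r \<in> Q (Suc j)" using sub[OF j] by blast
      moreover have "x j * ?r \<in> Q (Suc j)"
        using pideal_D(5)[OF ps _ rc] x[OF j] by simp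
      ultimately have "(\<Sum>\<kappa>\<in>K'. ?m \<kappa>) + x j * ?r - x j * ?r \<in> Q (Suc j)"
        by (rule pideal_D(7)[OF ps])
      with IH show False by simp
    qed
  qed
  have "(\<Sum>\<kappa>\<in>K. pconst (c \<kappa>) * (\<Prod>i\<in>{0..<n}. x i ^ \<kappa> i)) \<notin> Q 0"
  proof (rule claim)
    show "\<kappa> = \<kappa>'" if "\<kappa> \<in> K" "\<kappa>' \<in> K" "\<forall>i\<in>{0..<n}. \<kappa> i = \<kappa>' i" for \<kappa> \<kappa>'
      using that K(4) by (intro extensionalityI[of \<kappa> "{..<n}" \<kappa>']) auto
  qed (use K in auto)
  then show ?thesis by (simp add: atLeast0LessThan)
qed

text \<open>Counting: there are more monomials in \<open>d + 1\<close> polynomials than the dimension of the space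
  of polynomials in \<open>d\<close> variables to which they belong.\<close>

lemma algebraic_dependence:
  fixes y :: "nat \<Rightarrow> (('v \<Rightarrow>\<^sub>0 nat) \<Rightarrow>\<^sub>0 'k::field)"
  assumes T: "finite T" "card T < n" and y: "\<And>i. i < n \<Longrightarrow> y i \<in> pcarrier T"
  shows "\<exists>K c. finite K \<and> K \<noteq> {} \<and> K \<subseteq> extensional {..<n} \<and> (\<forall>\<kappa>\<in>K. c \<kappa> \<noteq> 0) \<and>
    (\<Sum>\<kappa>\<in>K. pconst (c \<kappa>) * (\<Prod>i<n. y i ^ \<kappa> i)) = 0"
proof -
  have "\<forall>i. \<exists>e. i < n \<longrightarrow> Poly_Mapping.keys (y i) \<subseteq> pbox T e" using keys_subset_pbox y by blast
  then obtain e where e: "\<And>i. i < n \<Longrightarrow> Poly_Mapping.keys (y i) \<subseteq> pbox T (e i)" by metis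
  define E where "E = (\<Sum>i<n. e i)"
  \<comment> \<open>With \<open>N\<close> above \<open>(E + 1) ^ card T\<close>, the
    \<open>N ^ n\<close> exponent vectors outnumber the monomials available, of which there are at
    most \<open>(N * (E + 1)) ^ card T\<close>.\<close>
  define N where "N = Suc ((E + 1) ^ card T)"
  define A where "A = PiE {..<n} (\<lambda>_. {..<N})"
  have A: "finite A" "card A = N ^ n" by (simp_all add: A_def finite_PiE card_PiE)
  have pbox_mult: "Poly_Mapping.keys (p * q) \<subseteq> pbox T (a + b)"
    if pq: "Poly_Mapping.keys p \<subseteq> pbox T a" "Poly_Mapping.keys q \<subseteq> pbox T b" for p q :: "('v \<Rightarrow>\<^sub>0 nat) \<Rightarrow>\<^sub>0 'k" and a b
  proof
    fix t assume "t \<in> Poly_Mapping.keys (p * q)"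
    then obtain r s where rs: "t = r + s" "r \<in> pbox T a" "s \<in> pbox T b"
      using Poly_Mapping.keys_mult[of p q] pq by blast
    then show "t \<in> pbox T (a + b)"
      using Poly_Mapping.keys_add[of r s] unfolding pbox_def by (auto simp: lookup_add add_mono)
  qed
  have one: "Poly_Mapping.keys (1 :: ('v \<Rightarrow>\<^sub>0 nat) \<Rightarrow>\<^sub>0 'k) \<subseteq> pbox T 0"
    by (auto simp: pbox_def)
  have power: "Poly_Mapping.keys (p ^ k) \<subseteq> pbox T (k * a)"
    if "Poly_Mapping.keys p \<subseteq> pbox T a" for p :: "('v \<Rightarrow>\<^sub>0 nat) \<Rightarrow>\<^sub>0 'k" and a k
    using one pbox_mult[OF that] by (induction k) auto
  have prod: "Poly_Mapping.keys (\<Prod>i\<in>I. f i) \<subseteq> pbox T (\<Sum>i\<in>I. g i)"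
    if "finite I" "\<And>i. i \<in> I \<Longrightarrow> Poly_Mapping.keys (f i) \<subseteq> pbox T (g i)" for f :: "nat \<Rightarrow> ('v \<Rightarrow>\<^sub>0 nat) \<Rightarrow>\<^sub>0 'k" and g I
    using that
  proof (induction I rule: finite_induct)
    case (insert i I)
    then show ?case using pbox_mult[of "f i" "g i"] by simp
  qed (use one in simp)
  let ?Y = "\<lambda>\<kappa>. \<Prod>i<n. y i ^ \<kappa> i"
  have Y: "Poly_Mapping.keys (?Y \<kappa>) \<subseteq> pbox T (N * E)" if "\<kappa> \<in> A" for \<kappa>
  proof -
    have "Poly_Mapping.keys (?Y \<kappa>) \<subseteq> pbox T (\<Sum>i<n. \<kappa> i * e i)"
      by (intro prod power) (auto intro: e[THEN subsetD])
    moreover have "(\<Sum>i<n. \<kappa> i * e i) \<le> N * E"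
      unfolding E_def sum_distrib_left
      by (intro sum_mono mult_right_mono) (use that in \<open>auto simp: A_def PiE_iff intro: less_imp_le\<close>)
    ultimately show ?thesis using pbox_mono by blast
  qed
  have "card (pbox T (N * E)) \<le> (N * E + 1) ^ card T" by (rule pbox_finite_card[OF T(1)])
  also have "\<dots> \<le> (N * (E + 1)) ^ card T" by (intro power_mono) (auto simp: N_def)
  also have "\<dots> = N ^ card T * (E + 1) ^ card T" by (rule power_mult_distrib)
  also have "\<dots> < N ^ card T * N" by (simp add: N_def)
  also have "\<dots> = N ^ Suc (card T)" by simp
  also have "\<dots> \<le> N ^ n" using T(2) by (intro power_increasing) (auto simp: N_def)
  finally obtain c where c: "\<exists>\<kappa>\<in>A. c \<kappa> \<noteq> 0"
    "\<forall>t\<in>pbox T (N * E). (\<Sum>\<kappa>\<in>A. Poly_Mapping.lookup (?Y \<kappa>) t * c \<kappa>) = 0"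
    using homogeneous_system_nontrivial[OF pbox_finite_card(1)[OF T(1)] A(1), of "N * E"
        "\<lambda>t \<kappa>. Poly_Mapping.lookup (?Y \<kappa>) t"] A(2) by auto
  \<comment> \<open>Terms with coefficient 0 are dropped, since the independence along a prime chain
    is stated for nonzero coefficients.\<close>
  define K where "K = {\<kappa>\<in>A. c \<kappa> \<noteq> 0}"
  have "(\<Sum>\<kappa>\<in>K. pconst (c \<kappa>) * ?Y \<kappa>) = (\<Sum>\<kappa>\<in>A. pconst (c \<kappa>) * ?Y \<kappa>)"
    using A(1) by (intro sum.mono_neutral_left) (auto simp: K_def)
  also have "\<dots> = 0"
  proof (rule poly_mapping_eqI)
    fix t
    have "(\<Sum>\<kappa>\<in>A. c \<kappa> * Poly_Mapping.lookup (?Y \<kappa>) t) = 0"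
    proof (cases "t \<in> pbox T (N * E)")
      case True
      then show ?thesis using c(2) by (simp add: mult.commute)
    next
      case False
      then have "Poly_Mapping.lookup (?Y \<kappa>) t = 0" if "\<kappa> \<in> A" for \<kappa>
        using Y[OF that] by (auto simp: in_keys_iff)
      then show ?thesis by simp
    qed
    then show "Poly_Mapping.lookup (\<Sum>\<kappa>\<in>A. pconst (c \<kappa>) * ?Y \<kappa>) t = Poly_Mapping.lookup 0 t"
      by (simp add: lookup_sum)
  qed
  finally have rel: "(\<Sum>\<kappa>\<in>K. pconst (c \<kappa>) * ?Y \<kappa>) = 0" .
  have "finite K" using A(1) by (simp add: K_def)
  moreover have "K \<noteq> {}" using c(1) by (auto simp: K_def)
  moreover have "K \<subseteq> extensional {..<n}" by (auto simp: K_def A_def PiE_def)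
  moreover have "\<forall>\<kappa>\<in>K. c \<kappa> \<noteq> 0" by (simp add: K_def)
  ultimately show ?thesis using rel by blast
qed

section \<open>The equations on points\<close>

text \<open>Index sets are arbitrary, ordered as natural numbers: elimination deletes a column from
  the middle, and this avoids renumbering.\<close>

definition lu_pair :: "nat set \<Rightarrow> nat set \<Rightarrow> (nat \<Rightarrow> nat \<Rightarrow> 'k) \<Rightarrow> (nat \<Rightarrow> nat \<Rightarrow> 'k::comm_ring_1) \<Rightarrow> bool" where
  "lu_pair I J X Y \<longleftrightarrow>
    (\<forall>i\<in>I. \<forall>k\<in>I. i < k \<longrightarrow> (\<Sum>j\<in>J. X i j * Y j k) = 0) \<and>
    (\<forall>j\<in>J. \<forall>l\<in>J. l < j \<longrightarrow> (\<Sum>i\<in>I. Y j i * X i l) = 0)"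

text \<open>Elimination with the first nonzero entry \<open>a\<close> of the first row of \<open>X\<close> as pivot: \<open>a r\<close> is the
  rest of that row, \<open>a v\<close> the rest of the pivot column, and \<open>X'\<close> the Schur complement. The matrix
  that goes with \<open>X'\<close> is just a submatrix of \<open>Y\<close>, hence the restriction of \<open>Y\<close> to smaller index sets.\<close>

locale pivot =
  fixes I J :: "nat set" and i0 p :: nat and X Y X' :: "nat \<Rightarrow> nat \<Rightarrow> 'k::idom"
    and a :: 'k and r v :: "nat \<Rightarrow> 'k"
  assumes fin: "finite I" "finite J" and i0: "\<And>i. i \<in> I \<Longrightarrow> i0 < i" and p: "p \<notin> J"
    and Xa: "X i0 p = a"
    and Xr: "\<And>l. l \<in> J \<Longrightarrow> X i0 l = a * r l" and r0: "\<And>l. l \<in> J \<Longrightarrow> l < p \<Longrightarrow> r l = 0"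
    and Xv: "\<And>i. i \<in> I \<Longrightarrow> X i p = a * v i"
    and X': "\<And>i l. i \<in> I \<Longrightarrow> l \<in> J \<Longrightarrow> X i l = X' i l + a * v i * r l"
begin

text \<open>Entries of \<open>XY\<close> in the pivot row and of \<open>YX\<close> in the pivot
  column, with the factor \<open>a\<close> removed so that their vanishing remains a condition on
  \<open>Y\<close> when \<open>a = 0\<close>.\<close>

abbreviation "R k \<equiv> Y p k + (\<Sum>l\<in>J. r l * Y l k)"
abbreviation "C j \<equiv> Y j i0 + (\<Sum>i\<in>I. v i * Y j i)"

lemma i0_notin: "i0 \<notin> I" using i0 by blast

lemma XY_first: "(\<Sum>l\<in>insert p J. X i0 l * Y l k) = a * R k"
  using fin p by (simp add: Xa Xr sum_distrib_left distrib_left mult.assoc)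

lemma XY_rest: "i \<in> I \<Longrightarrow> (\<Sum>l\<in>insert p J. X i l * Y l k) = (\<Sum>l\<in>J. X' i l * Y l k) + v i * (a * R k)"
  using fin p by (simp add: Xv X' sum_distrib_left sum.distrib algebra_simps)

lemma YX_pivot: "(\<Sum>i\<in>insert i0 I. Y j i * X i p) = a * C j"
  using fin i0_notin by (simp add: Xa Xv sum_distrib_left algebra_simps)

lemma YX_rest: "l \<in> J \<Longrightarrow> (\<Sum>i\<in>insert i0 I. Y j i * X i l) = (\<Sum>i\<in>I. Y j i * X' i l) + a * r l * C j"
  using fin i0_notin by (simp add: Xr X' sum_distrib_left sum.distrib algebra_simps)

text \<open>The equations in row \<open>p\<close> of \<open>YX\<close> follow from the others
  because \<open>r\<close> vanishes before \<open>p\<close>. Nothing is divided by \<open>a\<close>,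
  so the charts stay on the scheme where a pivot parameter is 0.\<close>

lemma lu_pair_insertI:
  assumes E: "lu_pair I J X' Y" and R: "\<And>k. k \<in> I \<Longrightarrow> R k = 0"
    and C: "\<And>j. j \<in> J \<Longrightarrow> p < j \<Longrightarrow> C j = 0"
  shows "lu_pair (insert i0 I) (insert p J) X Y"
  unfolding lu_pair_def
proof (intro conjI ballI impI)
  fix i k assume "i \<in> insert i0 I" "k \<in> insert i0 I" "i < k"
  then have k: "k \<in> I" using i0 by force
  show "(\<Sum>j\<in>insert p J. X i j * Y j k) = 0"
  proof (cases "i = i0")
    case True
    then show ?thesis using XY_first[of k] R[OF k] by simp
  next
    case False
    with \<open>i \<in> insert i0 I\<close> have i: "i \<in> I" by simp
    have "(\<Sum>l\<in>J. X' i l * Y l k) = 0" using E i k \<open>i < k\<close> by (auto simp: lu_pair_def)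
    then show ?thesis using XY_rest[OF i, of k] R[OF k] by simp
  qed
next
  fix j l assume j: "j \<in> insert p J" and l: "l \<in> insert p J" and lt: "l < j"
  consider "l = p" | "l \<in> J" "j = p" | "l \<in> J" "j \<in> J" using j l by blast
  then show "(\<Sum>i\<in>insert i0 I. Y j i * X i l) = 0"
  proof cases
    case 1
    then have "j \<in> J" "p < j" using j lt by auto
    then show ?thesis using C 1 YX_pivot[of j] by simp
  next
    case 2
    \<comment> \<open>On \<open>I\<close>, row \<open>p\<close> of \<open>Y\<close> is minus the
      combination of the other rows with weights \<open>r\<close>. Only rows with index greater than
      \<open>p\<close> have nonzero weight, and their entries in column \<open>l\<close> of
      \<open>Y X'\<close> vanish already, as \<open>l < p\<close>.\<close>
    have Yp: "Y p i = - (\<Sum>l'\<in>J. r l' * Y l' i)" if "i \<in> I" for i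
      using R[OF that] by (simp add: eq_neg_iff_add_eq_0)
    have "(\<Sum>i\<in>I. Y p i * X' i l) = - (\<Sum>i\<in>I. \<Sum>l'\<in>J. r l' * (Y l' i * X' i l))"
      by (simp add: Yp sum_negf sum_distrib_right mult.assoc)
    also have "\<dots> = - (\<Sum>l'\<in>J. r l' * (\<Sum>i\<in>I. Y l' i * X' i l))"
      by (subst sum.swap) (simp add: sum_distrib_left)
    also have "(\<Sum>l'\<in>J. r l' * (\<Sum>i\<in>I. Y l' i * X' i l)) = 0"
    proof (rule sum.neutral, rule ballI)
      fix l' assume "l' \<in> J"
      show "r l' * (\<Sum>i\<in>I. Y l' i * X' i l) = 0"
      proof (cases "l' < p")
        case False
        then have "l < l'" using lt 2 by simp
        then have "(\<Sum>i\<in>I. Y l' i * X' i l) = 0" using E 2 \<open>l' \<in> J\<close> by (auto simp: lu_pair_def)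
        then show ?thesis by simp
      qed (simp add: r0 \<open>l' \<in> J\<close>)
    qed
    finally show ?thesis using YX_rest[of l p] r0[of l] 2 lt by simp
  next
    case 3
    have "(\<Sum>i\<in>I. Y j i * X' i l) = 0" using E 3 lt by (auto simp: lu_pair_def)
    moreover have "r l * C j = 0"
    proof (cases "l < p")
      case False
      then have "p < j" using lt by simp
      then show ?thesis using C 3 by simp
    qed (simp add: r0 3)
    ultimately show ?thesis using YX_rest[of l j] 3 by (simp add: mult.assoc)
  qed
qed

text \<open>For a nonzero pivot, \<open>a\<close> can be cancelled from \<open>a * R k\<close> and
  \<open>a * C j\<close>, and the remaining equations then lose their correction terms.\<close>

lemma lu_pair_insertD:
  assumes E: "lu_pair (insert i0 I) (insert p J) X Y" and a: "a \<noteq> 0"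
  shows "\<And>k. k \<in> I \<Longrightarrow> R k = 0" "\<And>j. j \<in> J \<Longrightarrow> p < j \<Longrightarrow> C j = 0" "lu_pair I J X' Y"
proof -
  show R: "R k = 0" if k: "k \<in> I" for k
  proof -
    have "(\<Sum>l\<in>insert p J. X i0 l * Y l k) = 0" using E k i0[OF k] unfolding lu_pair_def by blast
    then show ?thesis using a mult_eq_0_iff[of a "R k"] unfolding XY_first by blast
  qed
  show C: "C j = 0" if j: "j \<in> J" "p < j" for j
  proof -
    have "(\<Sum>i\<in>insert i0 I. Y j i * X i p) = 0" using E j unfolding lu_pair_def by blast
    then show ?thesis using a mult_eq_0_iff[of a "C j"] unfolding YX_pivot by blast
  qed
  show "lu_pair I J X' Y"
    unfolding lu_pair_def
  proof (intro conjI ballI impI)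
    fix i k assume *: "i \<in> I" "k \<in> I" "i < k"
    then have "(\<Sum>l\<in>insert p J. X i l * Y l k) = 0" using E unfolding lu_pair_def by blast
    then show "(\<Sum>l\<in>J. X' i l * Y l k) = 0" using XY_rest[OF *(1), of k] R[OF *(2)] by simp
  next
    fix j l assume *: "j \<in> J" "l \<in> J" "l < j"
    then have "(\<Sum>i\<in>insert i0 I. Y j i * X i l) = 0" using E unfolding lu_pair_def by blast
    moreover have "r l * C j = 0"
    proof (cases "l < p")
      case False
      then have "p < j" using * by simp
      then show ?thesis using C * by simp
    qed (simp add: r0 *)
    ultimately show "(\<Sum>i\<in>I. Y j i * X' i l) = 0" using YX_rest[of l j] * by (simp add: mult.assoc)
  qed
qed

end

section \<open>Elimination over a field, and a solution of full rank for a fixed factor\<close>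

lemma lu_pair_cong:
  assumes "\<And>i j. i \<in> I \<Longrightarrow> j \<in> J \<Longrightarrow> X i j = X' i j" "\<And>i j. i \<in> I \<Longrightarrow> j \<in> J \<Longrightarrow> Y j i = Y' j i"
  shows "lu_pair I J X Y = lu_pair I J X' Y'"
  using assms by (simp add: lu_pair_def)

lemma exists_first_pivot:
  fixes f :: "nat \<Rightarrow> 'k::zero"
  assumes "finite J" "\<exists>j\<in>J. f j \<noteq> 0"
  shows "\<exists>p\<in>J. f p \<noteq> 0 \<and> (\<forall>l\<in>J. l < p \<longrightarrow> f l = 0)"
proof -
  let ?S = "{j\<in>J. f j \<noteq> 0}"
  have S: "finite ?S" "?S \<noteq> {}" using assms by auto
  show ?thesis
  proof (intro bexI conjI ballI impI)
    show "f (Min ?S) \<noteq> 0" "Min ?S \<in> J" using Min_in[OF S] by auto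
    fix l assume "l \<in> J" "l < Min ?S"
    then show "f l = 0" using Min_le[OF S(1), of l] by force
  qed
qed

lemma pivot_schur:
  fixes X Y :: "nat \<Rightarrow> nat \<Rightarrow> 'k::field"
  assumes "finite I" "finite J" "\<And>i. i \<in> I \<Longrightarrow> i0 < i" "p \<notin> J" "X i0 p \<noteq> 0"
    "\<And>l. l \<in> J \<Longrightarrow> l < p \<Longrightarrow> X i0 l = 0"
  shows "pivot I J i0 p X (\<lambda>i l. X i l - X i p * X i0 l / X i0 p) (X i0 p)
    (\<lambda>l. X i0 l / X i0 p) (\<lambda>i. X i p / X i0 p)"
  using assms by unfold_locales auto

text \<open>\<open>Y\<close> is built along the elimination of \<open>X\<close>, whatever the rank
  of \<open>X\<close>. The left inverse \<open>B\<close> serves as a certificate of full rank that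
  can be extended explicitly at each step.\<close>

theorem exists_left_invertible:
  fixes X :: "nat \<Rightarrow> nat \<Rightarrow> 'k::field"
  assumes "finite I" "finite J" "card I \<le> card J"
  shows "\<exists>Y B. lu_pair I J X Y \<and> (\<forall>i\<in>I. \<forall>k\<in>I. (\<Sum>j\<in>J. B i j * Y j k) = (if i = k then 1 else 0))"
  using assms
proof (induction I arbitrary: J X rule: finite_linorder_min_induct)
  case empty
  show ?case by (auto simp: lu_pair_def)
next
  case (insert i0 I)
  have i0: "\<And>i. i \<in> I \<Longrightarrow> i0 < i" "i0 \<notin> I" using insert.hyps by auto
  have le: "card I < card J" using insert.prems insert.hyps(1) i0(2) by simp
  show ?case
  proof (cases "\<exists>j\<in>J. X i0 j \<noteq> 0")
    case False
    obtain Y B where Y: "lu_pair I J X Y"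
      "\<And>i k. i \<in> I \<Longrightarrow> k \<in> I \<Longrightarrow> (\<Sum>j\<in>J. B i j * Y j k) = (if i = k then 1 else 0)"
      using insert.IH[of J X] insert.prems le by auto
    \<comment> \<open>As row \<open>i0\<close> of \<open>X\<close> is zero, column \<open>i0\<close>
      of \<open>Y\<close> is unconstrained and may be any vector outside the span of the other
      columns. \<open>b\<close> is orthogonal to those columns, so the unit vector at an index where
      \<open>b\<close> is nonzero will do.\<close>
    obtain b where b: "\<exists>j\<in>J. b j \<noteq> 0" "\<And>i. i \<in> I \<Longrightarrow> (\<Sum>j\<in>J. Y j i * b j) = 0"
      using homogeneous_system_nontrivial[OF insert.hyps(1) insert.prems(1) le, of "\<lambda>i j. Y j i"] by blast
    then obtain q where q: "q \<in> J" "b q \<noteq> 0" by blast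
    define Y1 where "Y1 j i = (if i = i0 then if j = q then 1 else 0 else Y j i)" for j i
    define B1 where "B1 i j = (if i = i0 then b j / b q else B i j - B i q * b j / b q)" for i j
    have "lu_pair (insert i0 I) J X Y1"
      unfolding lu_pair_def
    proof (intro conjI ballI impI)
      fix i k assume *: "i \<in> insert i0 I" "k \<in> insert i0 I" "i < k"
      then have k: "k \<in> I" using i0 by force
      show "(\<Sum>j\<in>J. X i j * Y1 j k) = 0"
      proof (cases "i = i0")
        case False
        moreover have "k \<noteq> i0" using k i0(2) by blast
        ultimately show ?thesis using * k Y(1) unfolding lu_pair_def Y1_def by auto
      qed (use False in simp)
    next
      fix j l assume *: "j \<in> J" "l \<in> J" "l < j"
      have "(\<Sum>i\<in>insert i0 I. Y1 j i * X i l) = (\<Sum>i\<in>I. Y1 j i * X i l)"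
        using insert.hyps False * i0(2) by simp
      also have "\<dots> = (\<Sum>i\<in>I. Y j i * X i l)"
        by (intro sum.cong) (use i0(2) in \<open>auto simp: Y1_def\<close>)
      also have "\<dots> = 0" using Y(1) * by (auto simp: lu_pair_def)
      finally show "(\<Sum>i\<in>insert i0 I. Y1 j i * X i l) = 0" .
    qed
    moreover have "(\<Sum>j\<in>J. B1 i j * Y1 j k) = (if i = k then 1 else 0)"
      if ik: "i \<in> insert i0 I" "k \<in> insert i0 I" for i k
    proof (cases "k = i0")
      case True
      have "(\<Sum>j\<in>J. B1 i j * Y1 j k) = (\<Sum>j\<in>J. if j = q then B1 i j else 0)"
        using True by (intro sum.cong) (auto simp: Y1_def)
      also have "\<dots> = B1 i q" using q insert.prems by simp
      finally show ?thesis using True q by (auto simp: B1_def)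
    next
      case False
      then have k: "k \<in> I" using ik by simp
      have bY: "(\<Sum>j\<in>J. b j * c * Y j k) = 0" for c
        using b(2)[OF k] by (simp add: mult_ac flip: sum_distrib_left sum_distrib_right)
      have Y1: "Y1 j k = Y j k" for j using False by (simp add: Y1_def)
      show ?thesis
      proof (cases "i = i0")
        case True
        have "(\<Sum>j\<in>J. B1 i j * Y1 j k) = (\<Sum>j\<in>J. b j * (1 / b q) * Y j k)"
          by (simp add: Y1 B1_def True)
        also have "\<dots> = 0" by (rule bY)
        finally show ?thesis using True False by simp
      next
        case ii: False
        then have i: "i \<in> I" using ik by simp
        have "(\<Sum>j\<in>J. B1 i j * Y1 j k) = (\<Sum>j\<in>J. B i j * Y j k - b j * (B i q / b q) * Y j k)"
          by (intro sum.cong) (simp_all add: Y1 B1_def ii algebra_simps)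
        also have "\<dots> = (\<Sum>j\<in>J. B i j * Y j k)" by (simp only: sum_subtractf bY) simp
        finally show ?thesis using Y(2)[OF i k] by simp
      qed
    qed
    ultimately show ?thesis by blast
  next
    case True
    obtain p where p: "p \<in> J" "X i0 p \<noteq> 0" "\<And>l. l \<in> J \<Longrightarrow> l < p \<Longrightarrow> X i0 l = 0"
      using exists_first_pivot[OF insert.prems(1) True] by blast
    define J' where "J' = J - {p}"
    have J: "J = insert p J'" "p \<notin> J'" "finite J'" "card I \<le> card J'"
      using p(1) insert.prems le by (auto simp: J'_def)
    define r where "r l = X i0 l / X i0 p" for l
    define v where "v i = X i p / X i0 p" for i
    define X' where "X' i l = X i l - X i p * X i0 l / X i0 p" for i l
    interpret pivot I J' i0 p X Z X' "X i0 p" r v for Z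
      unfolding X'_def[abs_def] r_def[abs_def] v_def[abs_def]
      by (rule pivot_schur) (use insert.hyps J p i0 in auto)
    obtain Y B where Y: "lu_pair I J' X' Y"
      "\<And>i k. i \<in> I \<Longrightarrow> k \<in> I \<Longrightarrow> (\<Sum>j\<in>J'. B i j * Y j k) = (if i = k then 1 else 0)"
      using insert.IH[of J' X'] J by auto
    define s where "s i = (\<Sum>l\<in>J'. r l * Y l i)" for i
    \<comment> \<open>Row \<open>p\<close> makes \<open>R k\<close> vanish on \<open>I\<close>, and
      the entries of column \<open>i0\<close> outside row \<open>p\<close> make \<open>C j\<close>
      vanish. The corner entry is chosen so that \<open>(1, r)\<close> times column
      \<open>i0\<close> is 1.\<close>
    define Y1 where "Y1 j i = (if j = p then if i = i0 then 1 + (\<Sum>k\<in>I. s k * v k) else - s i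
      else if i = i0 then - (\<Sum>k\<in>I. v k * Y j k) else Y j i)" for j i
    \<comment> \<open>Row \<open>i0\<close> is \<open>(1, r)\<close>. Every other row is the old row
      of \<open>B\<close>, with 0 at \<open>p\<close>, plus \<open>v i\<close> times
      \<open>(1, r)\<close>, which cancels the \<open>- v i\<close> that the old row yields in
      column \<open>i0\<close>.\<close>
    define B1 where "B1 i j = (if i = i0 then if j = p then 1 else r j
      else if j = p then v i else B i j + v i * r j)" for i j
    have Y1: "Y1 j i = Y j i" if "j \<in> J'" "i \<in> I" for i j
      using that J i0 by (auto simp: Y1_def)
    have "lu_pair (insert i0 I) J X Y1"
      unfolding J(1)
    proof (rule lu_pair_insertI)
      show "lu_pair I J' X' Y1" using Y(1) lu_pair_cong[of I J' X' X' Y Y1] Y1 by simp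
      show "Y1 p k + (\<Sum>l\<in>J'. r l * Y1 l k) = 0" if "k \<in> I" for k
        using that i0_notin by (auto simp: Y1 s_def Y1_def[of p])
      show "Y1 j i0 + (\<Sum>i\<in>I. v i * Y1 j i) = 0" if "j \<in> J'" for j
        using that J(2) by (auto simp: Y1 Y1_def[of _ i0])
    qed
    moreover have "(\<Sum>j\<in>J. B1 i j * Y1 j k) = (if i = k then 1 else 0)"
      if ik: "i \<in> insert i0 I" "k \<in> insert i0 I" for i k
    proof -
      let ?c = "if k = i0 then 1 else 0 :: 'k"
      have first: "Y1 p k + (\<Sum>j\<in>J'. r j * Y1 j k) = ?c"
      proof (cases "k = i0")
        case True
        have "(\<Sum>j\<in>J'. r j * Y1 j k) = (\<Sum>j\<in>J'. - (\<Sum>i\<in>I. r j * Y j i * v i))"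
          using J(2) by (intro sum.cong)
            (auto simp: Y1_def True sum_distrib_left mult_ac simp flip: sum_negf)
        also have "\<dots> = - (\<Sum>i\<in>I. s i * v i)"
          unfolding sum_negf s_def sum_distrib_right by (subst sum.swap) simp
        finally show ?thesis by (simp add: True Y1_def)
      next
        case False
        then have "k \<in> I" using ik by simp
        then show ?thesis using False by (simp add: Y1 s_def Y1_def[of p])
      qed
      show ?thesis
      proof (cases "i = i0")
        case True
        then have "(\<Sum>j\<in>J. B1 i j * Y1 j k) = Y1 p k + (\<Sum>j\<in>J'. r j * Y1 j k)"
          unfolding J(1) using J(2,3) by (auto simp: B1_def intro!: sum.cong)
        then show ?thesis using first True by auto
      next
        case False
        then have i: "i \<in> I" using ik by simp
        have "(\<Sum>j\<in>J'. B1 i j * Y1 j k) = (\<Sum>j\<in>J'. B i j * Y1 j k + v i * (r j * Y1 j k))"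
          using J(2) False by (intro sum.cong) (auto simp: B1_def algebra_simps)
        then have "(\<Sum>j\<in>J. B1 i j * Y1 j k) =
            (\<Sum>j\<in>J'. B i j * Y1 j k) + v i * (Y1 p k + (\<Sum>j\<in>J'. r j * Y1 j k))"
          unfolding J(1) using J(2,3) False
          by (simp add: B1_def[of i p] sum.distrib sum_distrib_left algebra_simps)
        also have "\<dots> = (\<Sum>j\<in>J'. B i j * Y1 j k) + v i * ?c" by (simp only: first)
        also have "\<dots> = (if i = k then 1 else 0)"
        proof (cases "k = i0")
          case True
          have "(\<Sum>j\<in>J'. B i j * Y1 j k) = - (\<Sum>j\<in>J'. \<Sum>q\<in>I. B i j * Y j q * v q)"
            unfolding sum_negf[symmetric, of _ J'] using J(2)
            by (intro sum.cong) (auto simp: Y1_def True sum_distrib_left mult_ac)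
          also have "(\<Sum>j\<in>J'. \<Sum>q\<in>I. B i j * Y j q * v q) = (\<Sum>q\<in>I. (\<Sum>j\<in>J'. B i j * Y j q) * v q)"
            by (subst sum.swap) (simp add: sum_distrib_right)
          also have "\<dots> = (\<Sum>q\<in>I. if q = i then v q else 0)"
            using i by (intro sum.cong) (auto simp: Y(2))
          also have "\<dots> = v i" using i insert.hyps by simp
          finally show ?thesis using True False by simp
        next
          case kk: False
          then have k: "k \<in> I" using ik by simp
          have "(\<Sum>j\<in>J'. B i j * Y1 j k) = (\<Sum>j\<in>J'. B i j * Y j k)" using Y1 k by simp
          then show ?thesis using Y(2)[OF i k] kk by simp
        qed
        finally show ?thesis .
      qed
    qed
    ultimately show ?thesis by blast
  qed
qed

section \<open>Polynomial charts\<close>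

definition lu_index :: "nat set \<Rightarrow> nat set \<Rightarrow> lu_var set" where
  "lu_index I J = {VX i j | i j. i \<in> I \<and> j \<in> J} \<union> {VY j i | i j. i \<in> I \<and> j \<in> J}"

lemma lu_index_simps [simp]:
  "VX i j \<in> lu_index I J \<longleftrightarrow> i \<in> I \<and> j \<in> J" "VY j i \<in> lu_index I J \<longleftrightarrow> i \<in> I \<and> j \<in> J"
  by (auto simp: lu_index_def)

definition lu_points :: "nat set \<Rightarrow> nat set \<Rightarrow> (lu_var \<Rightarrow> complex) set" where
  "lu_points I J = {z. lu_pair I J (\<lambda>i j. z (VX i j)) (\<lambda>j i. z (VY j i))}"

text \<open>The last clause is the rational left inverse: on the image each parameter is a quotient
  \<open>h / f\<close>. It is demanded only where all parameters are nonzero, which keeps every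
  pivot invertible, while the map itself lives on the whole affine space.\<close>

definition lu_chart :: "nat set \<Rightarrow> nat set \<Rightarrow> lu_var set \<Rightarrow>
    ((lu_var \<Rightarrow> complex) \<Rightarrow> (lu_var \<Rightarrow> complex)) \<Rightarrow> bool" where
  "lu_chart I J T \<Psi> \<longleftrightarrow> finite T \<and> T \<subseteq> lu_index I J \<and> card T = card I * card J + card I \<and>
    (\<forall>v\<in>lu_index I J. (\<lambda>t. \<Psi> t v) \<in> polyfun T) \<and> (\<forall>t. \<Psi> t \<in> lu_points I J) \<and>
    (\<forall>k\<in>T. \<exists>h\<in>polyfun (lu_index I J). \<exists>f\<in>polyfun (lu_index I J).
      \<forall>t. (\<forall>k\<in>T. t k \<noteq> 0) \<longrightarrow> f (\<Psi> t) \<noteq> 0 \<and> h (\<Psi> t) = t k * f (\<Psi> t))"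

text \<open>The parameters of \<open>lu_step\<close> are named after the variables they replace: with the notation
  of the pivot elimination, \<open>t (VX i0 p) = a\<close>, \<open>t (VX i0 j) = r j\<close>, \<open>t (VX i p) = v i\<close>.\<close>

fun lu_step :: "nat \<Rightarrow> nat \<Rightarrow> nat set \<Rightarrow> nat set \<Rightarrow> (lu_var \<Rightarrow> complex) \<Rightarrow> (lu_var \<Rightarrow> complex) \<Rightarrow> lu_var \<Rightarrow> complex" where
  "lu_step i0 p I J t z (VX i j) =
    (if i = i0 then if j < p then 0 else if j = p then t (VX i0 p) else t (VX i0 p) * t (VX i0 j)
     else if j = p then t (VX i0 p) * t (VX i p)
     else z (VX i j) + (if j < p then 0 else t (VX i0 p) * t (VX i p) * t (VX i0 j)))"
| "lu_step i0 p I J t z (VY j i) =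
    (if i = i0 then if j \<le> p then t (VY j i0) else - (\<Sum>k\<in>I. t (VX k p) * z (VY j k))
     else if j = p then - (\<Sum>l\<in>J. (if l < p then 0 else t (VX i0 l)) * z (VY l i))
     else z (VY j i))"

text \<open>If the coordinates of \<open>F\<close> are polynomials divided by powers of
  \<open>b\<close>, so is every polynomial in them. This carries the inverse of a chart through a
  Schur complement, whose only denominator is the pivot.\<close>

lemma polyfun_clear_denominators:
  fixes b :: "('w \<Rightarrow> 'k::comm_ring_1) \<Rightarrow> 'k"
  assumes g: "g \<in> polyfun V" and b: "b \<in> polyfun W"
    and F: "\<And>v. v \<in> V \<Longrightarrow> \<exists>N. \<exists>G\<in>polyfun W. \<forall>z\<in>D. G z = b z ^ N * F z v"
  shows "\<exists>N. \<exists>G\<in>polyfun W. \<forall>z\<in>D. G z = b z ^ N * g (F z)"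
proof -
  obtain q where q: "q \<in> pcarrier V" "\<And>z. g z = peval q z" using g by (rule polyfunE) blast
  let ?C = "{g. \<exists>N. \<exists>G\<in>polyfun W. \<forall>z\<in>D. G z = b z ^ N * g z}"
  have "(\<lambda>z. peval q (F z)) \<in> ?C"
  proof (rule peval_closure[OF q(1)])
    show "(\<lambda>x. c) \<in> ?C" for c by (auto intro!: exI[of _ 0] bexI[of _ "\<lambda>x. c"])
  next
    fix f g assume "f \<in> ?C" "g \<in> ?C"
    then obtain N G N' G' where *: "G \<in> polyfun W" "\<forall>z\<in>D. G z = b z ^ N * f z"
      "G' \<in> polyfun W" "\<forall>z\<in>D. G' z = b z ^ N' * g z" by auto
    have "(\<lambda>z. b z ^ N' * G z + b z ^ N * G' z) \<in> polyfun W"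
      using * b by (intro polyfun_add polyfun_mult polyfun_power)
    moreover have "\<forall>z\<in>D. b z ^ N' * G z + b z ^ N * G' z = b z ^ (N + N') * (f z + g z)"
      using * by (simp add: power_add algebra_simps)
    ultimately show "(\<lambda>x. f x + g x) \<in> ?C"
      by (intro CollectI exI[of _ "N + N'"] bexI[of _ "\<lambda>z. b z ^ N' * G z + b z ^ N * G' z"])
    have "(\<lambda>z. G z * G' z) \<in> polyfun W" using * by (intro polyfun_mult)
    moreover have "\<forall>z\<in>D. G z * G' z = b z ^ (N + N') * (f z * g z)"
      using * by (simp add: power_add algebra_simps)
    ultimately show "(\<lambda>x. f x * g x) \<in> ?C"
      by (intro CollectI exI[of _ "N + N'"] bexI[of _ "\<lambda>z. G z * G' z"])
  next
    show "(\<lambda>x. F x v) \<in> ?C" if "v \<in> V" for v using F[OF that] by simp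
  qed
  then show ?thesis using q(2) by simp
qed

definition step_params :: "nat \<Rightarrow> nat \<Rightarrow> nat set \<Rightarrow> nat set \<Rightarrow> lu_var set" where
  "step_params i0 p I J = insert (VX i0 p) (VX i0 ` {l\<in>J. p < l} \<union> (\<lambda>i. VX i p) ` I \<union>
     (\<lambda>j. VY j i0) ` insert p {j\<in>J. j < p})"

text \<open>Indices of \<open>J\<close> after \<open>p\<close> are counted in the row of
  \<open>X\<close> and those before \<open>p\<close> in the column of \<open>Y\<close>, so each is
  counted once.\<close>

lemma card_step_params:
  assumes "finite I" "finite J" "i0 \<notin> I" "p \<notin> J"
  shows "card (step_params i0 p I J) = Suc (card I) + Suc (card J)"
proof -
  have J: "card J = card {l\<in>J. p < l} + card {l\<in>J. l < p}"
  proof -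
    have "J = {l\<in>J. p < l} \<union> {l\<in>J. l < p}" using assms(4) by (auto intro: linorder_neqE_nat)
    then have "card J = card ({l\<in>J. p < l} \<union> {l\<in>J. l < p})" by simp
    also have "\<dots> = card {l\<in>J. p < l} + card {l\<in>J. l < p}"
      using assms by (intro card_Un_disjoint) auto
    finally show ?thesis .
  qed
  have c: "card (VX i0 ` {l\<in>J. p < l}) = card {l\<in>J. p < l}" "card ((\<lambda>i. VX i p) ` I) = card I"
    "card ((\<lambda>j. VY j i0) ` insert p {j\<in>J. j < p}) = Suc (card {l\<in>J. l < p})"
    using assms by (subst card_image; auto simp: inj_on_def)+
  have "card (step_params i0 p I J) = Suc (card (VX i0 ` {l\<in>J. p < l} \<union> (\<lambda>i. VX i p) ` I \<union>
     (\<lambda>j. VY j i0) ` insert p {j\<in>J. j < p}))"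
    unfolding step_params_def using assms by (intro card_insert_disjoint) auto
  also have "card (VX i0 ` {l\<in>J. p < l} \<union> (\<lambda>i. VX i p) ` I \<union> (\<lambda>j. VY j i0) ` insert p {j\<in>J. j < p})
      = card (VX i0 ` {l\<in>J. p < l} \<union> (\<lambda>i. VX i p) ` I) + card ((\<lambda>j. VY j i0) ` insert p {j\<in>J. j < p})"
    using assms by (intro card_Un_disjoint) auto
  also have "card (VX i0 ` {l\<in>J. p < l} \<union> (\<lambda>i. VX i p) ` I) =
      card (VX i0 ` {l\<in>J. p < l}) + card ((\<lambda>i. VX i p) ` I)"
    using assms by (intro card_Un_disjoint) auto
  finally show ?thesis unfolding c J by simp
qed

lemma lu_step_points:
  assumes fin: "finite I" "finite J" and i0: "\<And>i. i \<in> I \<Longrightarrow> i0 < i" and p: "p \<notin> J"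
    and z: "z \<in> lu_points I J"
  shows "lu_step i0 p I J t z \<in> lu_points (insert i0 I) (insert p J)"
proof -
  let ?z = "lu_step i0 p I J t z"
  let ?r = "\<lambda>l. if l < p then 0 else t (VX i0 l)"
  have ne: "i \<noteq> i0" if "i \<in> I" for i using i0[OF that] by simp
  have ne': "j \<noteq> p" if "j \<in> J" for j using p that by blast
  interpret pivot I J i0 p "\<lambda>i j. ?z (VX i j)" "\<lambda>j i. ?z (VY j i)" "\<lambda>i j. z (VX i j)"
    "t (VX i0 p)" ?r "\<lambda>i. t (VX i p)"
    by unfold_locales (use fin i0 p ne ne' in auto)
  have "lu_pair (insert i0 I) (insert p J) (\<lambda>i j. ?z (VX i j)) (\<lambda>j i. ?z (VY j i))"
  proof (rule lu_pair_insertI)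
    show "lu_pair I J (\<lambda>i j. z (VX i j)) (\<lambda>j i. ?z (VY j i))"
      using z ne ne' by (simp add: lu_points_def lu_pair_def)
    show "?z (VY p k) + (\<Sum>l\<in>J. ?r l * ?z (VY l k)) = 0" if "k \<in> I" for k
    proof -
      have "(\<Sum>l\<in>J. ?r l * ?z (VY l k)) = (\<Sum>l\<in>J. ?r l * z (VY l k))"
        by (intro sum.cong) (use ne[OF that] ne' in auto)
      then show ?thesis using ne[OF that] by simp
    qed
    show "?z (VY j i0) + (\<Sum>i\<in>I. t (VX i p) * ?z (VY j i)) = 0" if "j \<in> J" "p < j" for j
    proof -
      have "(\<Sum>i\<in>I. t (VX i p) * ?z (VY j i)) = (\<Sum>i\<in>I. t (VX i p) * z (VY j i))"
        by (intro sum.cong) (use ne ne'[OF that(1)] in auto)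
      then show ?thesis using that by simp
    qed
  qed
  then show ?thesis by (simp add: lu_points_def)
qed

lemma lu_chart_step:
  assumes fin: "finite I" "finite J" and i0: "\<forall>i\<in>I. i0 < i" and p: "p \<notin> J"
    and chart: "lu_chart I J T \<Psi>"
  shows "lu_chart (insert i0 I) (insert p J) (T \<union> step_params i0 p I J)
    (\<lambda>t. lu_step i0 p I J t (\<Psi> t))"
proof -
  let ?V = "lu_index (insert i0 I) (insert p J)" and ?T = "T \<union> step_params i0 p I J"
  let ?\<Psi> = "\<lambda>t. lu_step i0 p I J t (\<Psi> t)"
  have ne: "i \<noteq> i0" if "i \<in> I" for i using i0 that by fastforce
  have ne': "j \<noteq> p" if "j \<in> J" for j using p that by blast
  have i0n: "i0 \<notin> I" using ne by blast
  note C = chart[unfolded lu_chart_def]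
  have T: "finite T" "T \<subseteq> lu_index I J" "card T = card I * card J + card I"
    and pf: "\<And>v. v \<in> lu_index I J \<Longrightarrow> (\<lambda>t. \<Psi> t v) \<in> polyfun T"
    and pts: "\<And>t. \<Psi> t \<in> lu_points I J"
    and inv: "\<And>k. k \<in> T \<Longrightarrow> \<exists>h\<in>polyfun (lu_index I J). \<exists>f\<in>polyfun (lu_index I J).
      \<forall>t. (\<forall>k\<in>T. t k \<noteq> 0) \<longrightarrow> f (\<Psi> t) \<noteq> 0 \<and> h (\<Psi> t) = t k * f (\<Psi> t)"
    using C by blast+
  have finS: "finite (step_params i0 p I J)" using fin by (simp add: step_params_def)
  have disj: "T \<inter> step_params i0 p I J = {}" using T(2) i0n p by (auto simp: step_params_def)
  have "card ?T = card T + card (step_params i0 p I J)"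
    by (rule card_Un_disjoint[OF T(1) finS disj])
  also have "\<dots> = card (insert i0 I) * card (insert p J) + card (insert i0 I)"
    using card_step_params[OF fin i0n p] T(3) fin i0n p by simp
  finally have card: "card ?T = card (insert i0 I) * card (insert p J) + card (insert i0 I)" .
  have sub: "?T \<subseteq> ?V" using T(2) by (auto simp: step_params_def lu_index_def)
  have par: "VX i0 p \<in> ?T" "\<And>l. l \<in> J \<Longrightarrow> p < l \<Longrightarrow> VX i0 l \<in> ?T" "\<And>i. i \<in> I \<Longrightarrow> VX i p \<in> ?T"
    "\<And>j. j \<in> insert p J \<Longrightarrow> j \<le> p \<Longrightarrow> VY j i0 \<in> ?T"
    by (auto simp: step_params_def)
  have pf': "(\<lambda>t. \<Psi> t v) \<in> polyfun ?T" if "v \<in> lu_index I J" for v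
    using pf[OF that] by (rule polyfun_mono) blast
  have poly: "(\<lambda>t. ?\<Psi> t v) \<in> polyfun ?T" if v: "v \<in> ?V" for v
  proof (cases v)
    case (VX i j)
    then have ij: "i \<in> insert i0 I" "j \<in> insert p J" using v by auto
    consider "i = i0" "j < p" | "i = i0" "j = p" | "i = i0" "p < j" "j \<in> J" | "i \<in> I" "j = p"
      | "i \<in> I" "j \<in> J" "j < p" | "i \<in> I" "j \<in> J" "p < j"
      using ij by fastforce
    then show ?thesis
      by cases (use par ne ne' in \<open>auto simp: VX intro!: polyfun_mult polyfun_add polyfun_var pf'\<close>)
  next
    case (VY j i)
    then have ij: "i \<in> insert i0 I" "j \<in> insert p J" using v by auto
    consider "i = i0" "j \<le> p" | "i = i0" "p < j" "j \<in> J" | "i \<in> I" "j = p" | "i \<in> I" "j \<in> J"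
      using ij by fastforce
    then show ?thesis
    proof cases
      case 1
      then show ?thesis using par(4)[of j] ij by (auto simp: VY)
    next
      case 2
      have "(\<lambda>t. - (\<Sum>k\<in>I. t (VX k p) * \<Psi> t (VY j k))) \<in> polyfun ?T"
        using 2 by (intro polyfun_minus polyfun_sum polyfun_mult polyfun_var par pf') auto
      then show ?thesis using 2 by (simp add: VY)
    next
      case 3
      have "(\<lambda>t. (if l < p then 0 else t (VX i0 l))) \<in> polyfun ?T" if "l \<in> J" for l
        using par(2)[OF that] ne'[OF that] by (cases "l < p") auto
      then have "(\<lambda>t. - (\<Sum>l\<in>J. (if l < p then 0 else t (VX i0 l)) * \<Psi> t (VY l i))) \<in> polyfun ?T"
        using 3 by (intro polyfun_minus polyfun_sum polyfun_mult pf') auto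
      then show ?thesis using 3 ne by (simp add: VY)
    next
      case 4
      then show ?thesis using ne ne' by (simp add: VY pf')
    qed
  qed
  define b where "b = (\<lambda>z :: lu_var \<Rightarrow> complex. z (VX i0 p))"
  \<comment> \<open>The Schur complement, which undoes the step: it recovers \<open>\<Psi> t\<close>
    on \<open>lu_index I J\<close> when the pivot parameter is nonzero.\<close>
  define F where "F = (\<lambda>(z :: lu_var \<Rightarrow> complex) v. case v of
    VX i l \<Rightarrow> z (VX i l) - z (VX i p) * z (VX i0 l) / z (VX i0 p) | VY j i \<Rightarrow> z (VY j i))"
  let ?D = "{z. b z \<noteq> 0}"
  have b: "b \<in> polyfun ?V" by (auto simp: b_def)
  have Fpoly: "\<exists>N. \<exists>G\<in>polyfun ?V. \<forall>z\<in>?D. G z = b z ^ N * F z v" if "v \<in> lu_index I J" for v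
  proof (cases v)
    case (VX i l)
    have "(\<lambda>z. z (VX i0 p) * z (VX i l) - z (VX i p) * z (VX i0 l)) \<in> polyfun ?V"
      using that VX by (intro polyfun_diff polyfun_mult polyfun_var) auto
    moreover have "\<forall>z\<in>?D. z (VX i0 p) * z (VX i l) - z (VX i p) * z (VX i0 l) = b z ^ 1 * F z v"
      by (simp add: b_def F_def VX field_simps)
    ultimately show ?thesis
      by (intro exI[of _ 1] bexI[of _ "\<lambda>z. z (VX i0 p) * z (VX i l) - z (VX i p) * z (VX i0 l)"])
  next
    case (VY j i)
    have "(\<lambda>z. z (VY j i)) \<in> polyfun ?V" using that VY by (intro polyfun_var) auto
    moreover have "\<forall>z\<in>?D. z (VY j i) = b z ^ 0 * F z v" by (simp add: F_def VY)
    ultimately show ?thesis by (intro exI[of _ 0] bexI[of _ "\<lambda>z. z (VY j i)"])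
  qed
  have clear: "\<exists>N. \<exists>G\<in>polyfun ?V. \<forall>z\<in>?D. G z = b z ^ N * g (F z)"
    if "g \<in> polyfun (lu_index I J)" for g
    by (rule polyfun_clear_denominators[OF that b Fpoly])
  have F\<Psi>: "g (F (?\<Psi> t)) = g (\<Psi> t)" if "g \<in> polyfun (lu_index I J)" "t (VX i0 p) \<noteq> 0" for g t
    using that(1)
  proof (rule polyfun_cong)
    fix v assume v: "v \<in> lu_index I J"
    show "F (?\<Psi> t) v = \<Psi> t v"
    proof (cases v)
      case (VX i l)
      with v have "i \<noteq> i0" "l \<noteq> p" using ne ne' by auto
      then show ?thesis using that(2) by (simp add: VX F_def)
    next
      case (VY j i)
      with v have "i \<noteq> i0" "j \<noteq> p" using ne ne' by auto
      then show ?thesis by (simp add: VY F_def)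
    qed
  qed
  have inverse: "\<exists>h\<in>polyfun ?V. \<exists>f\<in>polyfun ?V.
      \<forall>t. (\<forall>k\<in>?T. t k \<noteq> 0) \<longrightarrow> f (?\<Psi> t) \<noteq> 0 \<and> h (?\<Psi> t) = t k * f (?\<Psi> t)" if k: "k \<in> ?T" for k
  proof (cases "k \<in> T")
    case True
    obtain h f where hf: "h \<in> polyfun (lu_index I J)" "f \<in> polyfun (lu_index I J)"
      "\<And>t. (\<forall>k\<in>T. t k \<noteq> 0) \<Longrightarrow> f (\<Psi> t) \<noteq> 0 \<and> h (\<Psi> t) = t k * f (\<Psi> t)"
      using inv[OF True] by blast
    obtain N H where H: "H \<in> polyfun ?V" "\<forall>z\<in>?D. H z = b z ^ N * h (F z)"
      using clear[OF hf(1)] by (elim exE bexE)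
    obtain M G where G: "G \<in> polyfun ?V" "\<forall>z\<in>?D. G z = b z ^ M * f (F z)"
      using clear[OF hf(2)] by (elim exE bexE)
    show ?thesis
    \<comment> \<open>The powers of \<open>b\<close> cleared from \<open>h\<close> and from
      \<open>f\<close> may differ; multiplying crosswise restores their quotient.\<close>
    proof (rule bexI[of _ "\<lambda>z. b z ^ M * H z"], rule bexI[of _ "\<lambda>z. b z ^ N * G z"], intro allI impI)
      show "(\<lambda>z. b z ^ M * H z) \<in> polyfun ?V" "(\<lambda>z. b z ^ N * G z) \<in> polyfun ?V"
        using b H G by (auto intro!: polyfun_mult polyfun_power)
      fix t :: "lu_var \<Rightarrow> complex" assume t: "\<forall>k\<in>?T. t k \<noteq> 0"
      have "t (VX i0 p) \<noteq> 0" using t par(1) by blast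
      moreover have "b (?\<Psi> t) = t (VX i0 p)" by (simp add: b_def)
      moreover have "f (\<Psi> t) \<noteq> 0 \<and> h (\<Psi> t) = t k * f (\<Psi> t)" using hf(3) t by blast
      ultimately show "b (?\<Psi> t) ^ N * G (?\<Psi> t) \<noteq> 0 \<and>
          b (?\<Psi> t) ^ M * H (?\<Psi> t) = t k * (b (?\<Psi> t) ^ N * G (?\<Psi> t))"
        using H(2) G(2) F\<Psi>[OF hf(1)] F\<Psi>[OF hf(2)] by simp
    qed
  next
    case False
    then have "k \<in> step_params i0 p I J" using k by blast
    then consider "k = VX i0 p" | l where "k = VX i0 l" "l \<in> J" "p < l" | i where "k = VX i p" "i \<in> I"
      | j where "k = VY j i0" "j \<in> insert p J" "j \<le> p"
      by (auto simp: step_params_def)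
    then show ?thesis
    proof cases
      case 1
      show ?thesis
        by (rule bexI[of _ "\<lambda>z. z (VX i0 p)"], rule bexI[of _ "\<lambda>z. 1"], use 1 in auto)
    next
      case 2
      show ?thesis
        by (rule bexI[of _ "\<lambda>z. z (VX i0 l)"], rule bexI[of _ "\<lambda>z. z (VX i0 p)"], use 2 par(1) in auto)
    next
      case 3
      show ?thesis
        by (rule bexI[of _ "\<lambda>z. z (VX i p)"], rule bexI[of _ "\<lambda>z. z (VX i0 p)"], use 3 par(1) ne in auto)
    next
      case 4
      show ?thesis
        by (rule bexI[of _ "\<lambda>z. z (VY j i0)"], rule bexI[of _ "\<lambda>z. 1"], use 4 in auto)
    qed
  qed
  show ?thesis
    unfolding lu_chart_def
    using T(1) finS sub card poly lu_step_points[OF fin _ p pts] i0 inverse by blast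
qed

section \<open>Covering the points with independent rows\<close>

definition rows_independent :: "nat set \<Rightarrow> nat set \<Rightarrow> (lu_var \<Rightarrow> complex) \<Rightarrow> bool" where
  "rows_independent I J z \<longleftrightarrow> (\<forall>c. (\<forall>j\<in>J. (\<Sum>i\<in>I. c i * z (VX i j)) = 0) \<longrightarrow> (\<forall>i\<in>I. c i = 0))"

text \<open>The old parameters are variables in \<open>lu_index I J\<close>, while each new one
  involves row \<open>i0\<close> or column \<open>p\<close> of \<open>X\<close>, or column
  \<open>i0\<close> of \<open>Y\<close>. So parameters reaching the Schur complement and the pivot
  data of \<open>z\<close> merge into one \<open>t\<close>.\<close>

lemma lu_step_cover:
  assumes fin: "finite I" "finite J" and i0: "\<forall>i\<in>I. i0 < i" and p: "p \<notin> J"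
    and z: "z \<in> lu_points (insert i0 I) (insert p J)" and rows: "rows_independent (insert i0 I) (insert p J) z"
    and nz: "z (VX i0 p) \<noteq> 0" and first: "\<forall>l\<in>J. l < p \<longrightarrow> z (VX i0 l) = 0"
    and z': "z' = (\<lambda>v. case v of
      VX i l \<Rightarrow> z (VX i l) - z (VX i p) * z (VX i0 l) / z (VX i0 p) | VY j i \<Rightarrow> z (VY j i))"
  shows "z' \<in> lu_points I J" "rows_independent I J z'"
    "lu_chart I J T \<Psi> \<Longrightarrow> \<forall>v\<in>lu_index I J. \<Psi> t' v = z' v \<Longrightarrow>
      \<exists>t. \<forall>v\<in>lu_index (insert i0 I) (insert p J). lu_step i0 p I J t (\<Psi> t) v = z v"
proof -
  have ne: "i \<noteq> i0" if "i \<in> I" for i using i0 that by fastforce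
  have ne': "j \<noteq> p" if "j \<in> J" for j using p that by blast
  define a where "a = z (VX i0 p)"
  define r where "r l = z (VX i0 l) / z (VX i0 p)" for l
  define v where "v i = z (VX i p) / z (VX i0 p)" for i
  interpret pivot I J i0 p "\<lambda>i j. z (VX i j)" "\<lambda>j i. z (VY j i)" "\<lambda>i j. z' (VX i j)" a r v
    by unfold_locales (use fin i0 p nz first in \<open>auto simp: z' a_def r_def v_def\<close>)
  have a: "a \<noteq> 0" using nz by (simp add: a_def)
  note D = lu_pair_insertD[OF _ a]
  have zp: "lu_pair (insert i0 I) (insert p J) (\<lambda>i j. z (VX i j)) (\<lambda>j i. z (VY j i))"
    using z by (simp add: lu_points_def)
  show "z' \<in> lu_points I J"
    using D(3)[OF zp] by (simp add: lu_points_def z')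
  show "rows_independent I J z'"
    unfolding rows_independent_def
  proof (intro allI impI)
    fix c assume c: "\<forall>j\<in>J. (\<Sum>i\<in>I. c i * z' (VX i j)) = 0"
    \<comment> \<open>The coefficient of row \<open>i0\<close> makes the combination vanish in the
      pivot column; in the other columns it then equals the combination of the Schur
      complement.\<close>
    define c' where "c' i = (if i = i0 then - (\<Sum>i\<in>I. c i * v i) else c i)" for i
    have c': "(\<Sum>i\<in>insert i0 I. c' i * x i) = (\<Sum>i\<in>I. c i * x i) - (\<Sum>i\<in>I. c i * v i) * x i0" for x
    proof -
      have "(\<Sum>i\<in>I. c' i * x i) = (\<Sum>i\<in>I. c i * x i)"
        by (intro sum.cong) (use ne in \<open>auto simp: c'_def\<close>)
      then show ?thesis using fin i0_notin by (simp add: c'_def)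
    qed
    have "(\<Sum>i\<in>insert i0 I. c' i * z (VX i j)) = 0" if "j \<in> insert p J" for j
    proof (cases "j = p")
      case True
      then show ?thesis unfolding c' by (simp add: Xv Xa sum_distrib_left sum_distrib_right mult_ac)
    next
      case False
      then have j: "j \<in> J" using that by simp
      have "(\<Sum>i\<in>I. c i * z (VX i j)) = (\<Sum>i\<in>I. c i * z' (VX i j)) + (\<Sum>i\<in>I. c i * v i) * z (VX i0 j)"
        by (simp add: X' j Xr sum_distrib_left sum_distrib_right sum.distrib algebra_simps)
      then show ?thesis unfolding c' using c j by simp
    qed
    then have "\<forall>i\<in>insert i0 I. c' i = 0" using rows unfolding rows_independent_def by blast
    then show "\<forall>i\<in>I. c i = 0" using ne by (auto simp: c'_def)
  qed
  assume chart: "lu_chart I J T \<Psi>" and t': "\<forall>v\<in>lu_index I J. \<Psi> t' v = z' v"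
  define t where "t = (\<lambda>w. if w \<in> lu_index I J then t' w else case w of
    VX i j \<Rightarrow> if i = i0 then if j = p then a else r j else v i | VY j i \<Rightarrow> z (VY j i))"
  have t: "t (VX i0 p) = a" "\<And>j. j \<in> J \<Longrightarrow> t (VX i0 j) = r j" "\<And>i. i \<in> I \<Longrightarrow> t (VX i p) = v i"
    "\<And>j. t (VY j i0) = z (VY j i0)"
    using i0_notin p ne ne' by (auto simp: t_def)
  have \<Psi>: "\<Psi> t w = z' w" if "w \<in> lu_index I J" for w
  proof -
    have pf: "(\<lambda>t. \<Psi> t w) \<in> polyfun T" and T: "T \<subseteq> lu_index I J"
      using chart that by (auto simp: lu_chart_def)
    have "\<Psi> t w = \<Psi> t' w" by (rule polyfun_cong[OF pf]) (use T in \<open>auto simp: t_def\<close>)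
    then show ?thesis using t' that by simp
  qed
  have "lu_step i0 p I J t (\<Psi> t) w = z w" if w: "w \<in> lu_index (insert i0 I) (insert p J)" for w
  proof (cases w)
    case (VX i j)
    then have ij: "i \<in> insert i0 I" "j \<in> insert p J" using w by auto
    then consider "i = i0" "j = p" | "i = i0" "j \<in> J" | "i \<in> I" "j = p" | "i \<in> I" "j \<in> J" by blast
    then show ?thesis
    proof cases
      case 2
      then show ?thesis using first ne'[of j] by (simp add: VX t Xr)
    next
      case 4
      then show ?thesis using ne[of i] ne'[of j] by (simp add: VX t \<Psi> X' r0)
    qed (use ne in \<open>auto simp: VX t Xa Xv\<close>)
  next
    case (VY j i)
    then have ij: "i \<in> insert i0 I" "j \<in> insert p J" using w by auto
    then consider "i = i0" "j \<le> p" | "i = i0" "j \<in> J" "p < j" | "i \<in> I" "j = p" | "i \<in> I" "j \<in> J"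
      by fastforce
    then show ?thesis
    proof cases
      case 1
      then show ?thesis by (simp add: VY t)
    next
      case 2
      have "(\<Sum>k\<in>I. t (VX k p) * \<Psi> t (VY j k)) = (\<Sum>k\<in>I. v k * z (VY j k))"
        using 2 by (intro sum.cong) (auto simp: t \<Psi> z')
      then show ?thesis using 2 D(2)[OF zp, of j] by (simp add: VY neg_eq_iff_add_eq_0 add.commute)
    next
      case 3
      have "(\<Sum>l\<in>J. (if l < p then 0 else t (VX i0 l)) * \<Psi> t (VY l i)) = (\<Sum>l\<in>J. r l * z (VY l i))"
        using 3 r0 by (intro sum.cong) (auto simp: t \<Psi> z')
      then show ?thesis using 3 ne[of i] D(1)[OF zp, of i] by (simp add: VY neg_eq_iff_add_eq_0 add.commute)
    next
      case 4
      then show ?thesis using ne[of i] ne'[of j] by (simp add: VY \<Psi> z')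
    qed
  qed
  then show "\<exists>t. \<forall>v\<in>lu_index (insert i0 I) (insert p J). lu_step i0 p I J t (\<Psi> t) v = z v" by blast
qed

text \<open>Independence of the rows provides a pivot in the first row of each successive
  complement. Finitely many pivot columns are possible at each step, so finitely many charts
  suffice.\<close>

theorem lu_charts_cover:
  assumes "finite I" "finite J"
  shows "\<exists>W. finite W \<and> (\<forall>\<Psi>\<in>W. \<exists>T. lu_chart I J T \<Psi>) \<and>
    (\<forall>z\<in>lu_points I J. rows_independent I J z \<longrightarrow> (\<exists>\<Psi>\<in>W. \<exists>t. \<forall>v\<in>lu_index I J. \<Psi> t v = z v))"
  using assms
proof (induction I arbitrary: J rule: finite_linorder_min_induct)
  case empty
  have "lu_chart {} J {} (\<lambda>t v. 0)"
    by (auto simp: lu_chart_def lu_points_def lu_pair_def)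
  then show ?case by (intro exI[of _ "{\<lambda>t v. 0}"]) (auto simp: lu_index_def)
next
  case (insert i0 I)
  have i0: "\<forall>i\<in>I. i0 < i" using insert.hyps by auto
  have "\<forall>p\<in>J. \<exists>W. finite W \<and> (\<forall>\<Psi>\<in>W. \<exists>T. lu_chart I (J - {p}) T \<Psi>) \<and>
    (\<forall>z\<in>lu_points I (J - {p}). rows_independent I (J - {p}) z \<longrightarrow>
      (\<exists>\<Psi>\<in>W. \<exists>t. \<forall>v\<in>lu_index I (J - {p}). \<Psi> t v = z v))"
    by (intro ballI insert.IH) (use insert.prems in simp)
  from bchoice[OF this] obtain W where WJ: "\<forall>p\<in>J. finite (W p) \<and>
    (\<forall>\<Psi>\<in>W p. \<exists>T. lu_chart I (J - {p}) T \<Psi>) \<and>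
    (\<forall>z\<in>lu_points I (J - {p}). rows_independent I (J - {p}) z \<longrightarrow>
      (\<exists>\<Psi>\<in>W p. \<exists>t. \<forall>v\<in>lu_index I (J - {p}). \<Psi> t v = z v))" ..
  then have W: "\<And>p. p \<in> J \<Longrightarrow> finite (W p)"
    "\<And>p \<Psi>. p \<in> J \<Longrightarrow> \<Psi> \<in> W p \<Longrightarrow> \<exists>T. lu_chart I (J - {p}) T \<Psi>"
    "\<And>p z. p \<in> J \<Longrightarrow> z \<in> lu_points I (J - {p}) \<Longrightarrow> rows_independent I (J - {p}) z \<Longrightarrow>
      \<exists>\<Psi>\<in>W p. \<exists>t. \<forall>v\<in>lu_index I (J - {p}). \<Psi> t v = z v"
    by blast+
  define U where "U = (\<Union>p\<in>J. (\<lambda>\<Psi> t. lu_step i0 p I (J - {p}) t (\<Psi> t)) ` W p)"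
  have ins: "insert p (J - {p}) = J" if "p \<in> J" for p using that by blast
  have finJ: "finite (J - {p})" for p using insert.prems by simp
  have "finite U" using insert.prems W(1) by (auto simp: U_def)
  moreover have "\<exists>T. lu_chart (insert i0 I) J T \<Phi>" if \<Phi>: "\<Phi> \<in> U" for \<Phi>
  proof -
    obtain p \<Psi> where p: "p \<in> J" "\<Psi> \<in> W p" "\<Phi> = (\<lambda>t. lu_step i0 p I (J - {p}) t (\<Psi> t))"
      using \<Phi> unfolding U_def by blast
    obtain T where T: "lu_chart I (J - {p}) T \<Psi>" using W(2)[OF p(1,2)] by blast
    have "p \<notin> J - {p}" by blast
    from lu_chart_step[OF insert.hyps(1) finJ i0 this T] show ?thesis
      unfolding p(3) ins[OF p(1)] by blast
  qed
  moreover have "\<exists>\<Phi>\<in>U. \<exists>t. \<forall>v\<in>lu_index (insert i0 I) J. \<Phi> t v = z v"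
    if z: "z \<in> lu_points (insert i0 I) J" "rows_independent (insert i0 I) J z" for z
  proof -
    have "\<exists>j\<in>J. z (VX i0 j) \<noteq> 0"
    proof (rule ccontr)
      assume no: "\<not> ?thesis"
      have "(\<Sum>i\<in>insert i0 I. (if i = i0 then 1 else 0) * z (VX i j)) = 0" if "j \<in> J" for j
      proof (rule sum.neutral, rule ballI)
        fix i show "(if i = i0 then 1 else 0) * z (VX i j) = 0" using no that by auto
      qed
      then have "\<forall>i\<in>insert i0 I. (if i = i0 then 1 else 0 :: complex) = 0"
        using z(2)[unfolded rows_independent_def, THEN spec[of _ "\<lambda>i. if i = i0 then 1 else 0"]] by blast
      then show False by simp
    qed
    then obtain p where p: "p \<in> J" "z (VX i0 p) \<noteq> 0" "\<And>l. l \<in> J \<Longrightarrow> l < p \<Longrightarrow> z (VX i0 l) = 0"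
      using exists_first_pivot[OF insert.prems, of "\<lambda>j. z (VX i0 j)"] by blast
    define z' where "z' = (\<lambda>v. case v of
      VX i l \<Rightarrow> z (VX i l) - z (VX i p) * z (VX i0 l) / z (VX i0 p) | VY j i \<Rightarrow> z (VY j i))"
    have z1: "z \<in> lu_points (insert i0 I) (insert p (J - {p}))"
      "rows_independent (insert i0 I) (insert p (J - {p})) z" using z ins[OF p(1)] by simp_all
    have pn: "p \<notin> J - {p}" and p3: "\<forall>l\<in>J - {p}. l < p \<longrightarrow> z (VX i0 l) = 0"
      using p(3) by blast+
    note cover = lu_step_cover[OF insert.hyps(1) finJ i0 pn z1 p(2) p3 z'_def]
    obtain \<Psi> t' where \<Psi>: "\<Psi> \<in> W p" "\<forall>v\<in>lu_index I (J - {p}). \<Psi> t' v = z' v"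
      using W(3)[OF p(1) cover(1,2)] by blast
    obtain T where T: "lu_chart I (J - {p}) T \<Psi>" using W(2)[OF p(1) \<Psi>(1)] by blast
    have "\<exists>t. \<forall>v\<in>lu_index (insert i0 I) J. lu_step i0 p I (J - {p}) t (\<Psi> t) v = z v"
      using cover(3)[OF T \<Psi>(2)] ins[OF p(1)] by simp
    moreover have "(\<lambda>t. lu_step i0 p I (J - {p}) t (\<Psi> t)) \<in> U" using p(1) \<Psi>(1) by (auto simp: U_def)
    ultimately show ?thesis by (intro bexI[of _ "\<lambda>t. lu_step i0 p I (J - {p}) t (\<Psi> t)"])
  qed
  ultimately show ?case by blast
qed

section \<open>Density of the points with independent rows\<close>

text \<open>Reflection in the antidiagonal reverses products and preserves both kinds of
  triangularity, so the two factors exchange their roles.\<close>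

lemma lu_pair_flip:
  fixes X Y :: "nat \<Rightarrow> nat \<Rightarrow> 'k::comm_ring_1"
  assumes "lu_pair {..<m} {..<n} X Y"
  shows "lu_pair {..<m} {..<n} (\<lambda>i j. Y (n - 1 - j) (m - 1 - i)) (\<lambda>j i. X (m - 1 - i) (n - 1 - j))"
proof -
  have rev: "(\<Sum>j<N. g (N - 1 - j)) = (\<Sum>j<N. g j)" for g :: "nat \<Rightarrow> 'k" and N
    using sum.nat_diff_reindex[of g N] by simp
  have "(\<Sum>j<n. Y (n - 1 - j) (m - 1 - i) * X (m - 1 - k) (n - 1 - j)) = 0"
    if "i < m" "k < m" "i < k" for i k
  proof -
    have "(\<Sum>j<n. X (m - 1 - k) j * Y j (m - 1 - i)) = 0"
      using assms that unfolding lu_pair_def by auto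
    then show ?thesis
      using rev[where g = "\<lambda>j. X (m - 1 - k) j * Y j (m - 1 - i)" and N = n] by (simp add: mult.commute)
  qed
  moreover have "(\<Sum>i<m. X (m - 1 - i) (n - 1 - j) * Y (n - 1 - l) (m - 1 - i)) = 0"
    if "j < n" "l < n" "l < j" for j l
  proof -
    have "(\<Sum>i<m. Y (n - 1 - l) i * X i (n - 1 - j)) = 0"
      using assms that unfolding lu_pair_def by auto
    then show ?thesis
      using rev[where g = "\<lambda>i. Y (n - 1 - l) i * X i (n - 1 - j)" and N = m] by (simp add: mult.commute)
  qed
  ultimately show ?thesis by (simp add: lu_pair_def)
qed

lemma exists_right_invertible:
  fixes Y :: "nat \<Rightarrow> nat \<Rightarrow> 'k::field"
  assumes "m \<le> n"
  shows "\<exists>A B. lu_pair {..<m} {..<n} A Y \<and>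
    (\<forall>i<m. \<forall>k<m. (\<Sum>j<n. A i j * B j k) = (if i = k then 1 else 0))"
proof -
  obtain Z B where Z: "lu_pair {..<m} {..<n} (\<lambda>i j. Y (n - 1 - j) (m - 1 - i)) Z"
    "\<And>i k. i < m \<Longrightarrow> k < m \<Longrightarrow> (\<Sum>j<n. B i j * Z j k) = (if i = k then 1 else 0)"
    using exists_left_invertible[of "{..<m}" "{..<n}" "\<lambda>i j. Y (n - 1 - j) (m - 1 - i)"] assms
    by auto
  have "lu_pair {..<m} {..<n} (\<lambda>i j. Z (n - 1 - j) (m - 1 - i)) Y"
    using lu_pair_flip[OF Z(1)]
    by (rule lu_pair_cong[THEN iffD1, rotated 2]) auto
  moreover have "(\<Sum>j<n. Z (n - 1 - j) (m - 1 - i) * B (m - 1 - k) (n - 1 - j)) = (if i = k then 1 else 0)"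
    if "i < m" "k < m" for i k
  proof -
    have "(\<Sum>j<n. Z (n - 1 - j) (m - 1 - i) * B (m - 1 - k) (n - 1 - j)) =
        (\<Sum>j<n. Z j (m - 1 - i) * B (m - 1 - k) j)"
      using sum.nat_diff_reindex[of "\<lambda>j. Z j (m - 1 - i) * B (m - 1 - k) j" n] by simp
    also have "\<dots> = (if m - 1 - k = m - 1 - i then 1 else 0)"
      using Z(2)[of "m - 1 - k" "m - 1 - i"] that by (simp add: mult.commute)
    also have "(m - 1 - k = m - 1 - i) = (i = k)" using that by auto
    finally show ?thesis .
  qed
  ultimately show ?thesis
    by (intro exI[of _ "\<lambda>i j. Z (n - 1 - j) (m - 1 - i)"] exI conjI allI impI)
qed

text \<open>Multiply a vanishing combination \<open>c\<close> of the rows of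
  \<open>(1 - s) X + s A\<close> by the right inverse \<open>B\<close> of \<open>A\<close>. For
  \<open>s\<close> other than 1, \<open>c\<close> becomes an eigenvector of the transpose of
  \<open>X B\<close> with eigenvalue \<open>- (s / (1 - s))\<close>. The spectrum is finite and the
  eigenvalue determines \<open>s\<close>.\<close>

lemma finite_dependent_rows:
  fixes A B X :: "nat \<Rightarrow> nat \<Rightarrow> complex"
  assumes inv: "\<And>i k. i < m \<Longrightarrow> k < m \<Longrightarrow> (\<Sum>j<n. A i j * B j k) = (if i = k then 1 else 0)"
  shows "finite {s. \<exists>c. (\<forall>j<n. (\<Sum>i<m. c i * ((1 - s) * X i j + s * A i j)) = 0) \<and> (\<exists>i<m. c i \<noteq> 0)}"
    (is "finite ?S")
proof -
  define N where "N = mat m m (\<lambda>(k, i). \<Sum>j<n. X i j * B j k)"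
  have N: "N \<in> carrier_mat m m" by (simp add: N_def)
  have "?S \<subseteq> insert 1 ((\<lambda>s. - (s / (1 - s))) -` spectrum N \<inter> (- {1}))"
  proof
    fix s assume "s \<in> ?S"
    then obtain c i0 where c: "\<And>j. j < n \<Longrightarrow> (\<Sum>i<m. c i * ((1 - s) * X i j + s * A i j)) = 0"
      "i0 < m" "c i0 \<noteq> 0" by auto
    show "s \<in> insert 1 ((\<lambda>s. - (s / (1 - s))) -` spectrum N \<inter> (- {1}))"
    proof (cases "s = 1")
      case False
      define w where "w = vec m c"
      have key: "(1 - s) * (\<Sum>i<m. (\<Sum>j<n. X i j * B j k) * c i) + s * c k = 0" if k: "k < m" for k
      proof -
        have "0 = (\<Sum>j<n. (\<Sum>i<m. c i * ((1 - s) * X i j + s * A i j)) * B j k)"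
          using c(1) by simp
        also have "\<dots> = (\<Sum>j<n. \<Sum>i<m. (1 - s) * (c i * (X i j * B j k)) + s * (c i * (A i j * B j k)))"
          unfolding sum_distrib_right by (intro sum.cong) (simp_all add: algebra_simps)
        also have "\<dots> = (\<Sum>i<m. \<Sum>j<n. (1 - s) * (c i * (X i j * B j k)) + s * (c i * (A i j * B j k)))"
          by (rule sum.swap)
        also have "\<dots> = (\<Sum>i<m. (1 - s) * (c i * (\<Sum>j<n. X i j * B j k)) + s * (c i * (\<Sum>j<n. A i j * B j k)))"
          by (simp add: sum.distrib sum_distrib_left)
        also have "\<dots> = (1 - s) * (\<Sum>i<m. (\<Sum>j<n. X i j * B j k) * c i) + s * (\<Sum>i<m. c i * (\<Sum>j<n. A i j * B j k))"
          by (simp add: sum.distrib sum_distrib_left mult_ac)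
        also have "(\<Sum>i<m. c i * (\<Sum>j<n. A i j * B j k)) = (\<Sum>i<m. if i = k then c i else 0)"
          using inv k by (intro sum.cong) auto
        also have "\<dots> = c k" using k by simp
        finally show ?thesis by simp
      qed
      have "eigenvector N w (- (s / (1 - s)))"
        unfolding eigenvector_def
      proof (intro conjI)
        show "w \<in> carrier_vec (dim_row N)" by (simp add: N_def w_def)
        show "w \<noteq> 0\<^sub>v (dim_row N)" using c(2,3) by (auto simp: N_def w_def vec_eq_iff)
        show "N *\<^sub>v w = - (s / (1 - s)) \<cdot>\<^sub>v w"
        proof (rule eq_vecI)
          fix k assume "k < dim_vec (- (s / (1 - s)) \<cdot>\<^sub>v w)"
          then have k: "k < m" by (simp add: w_def)
          have "(N *\<^sub>v w) $ k = (\<Sum>i<m. (\<Sum>j<n. X i j * B j k) * c i)"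
            using k by (simp add: N_def w_def scalar_prod_def lessThan_atLeast0)
          also have "\<dots> = - (s / (1 - s)) * c k"
            using key[OF k] False by (simp add: field_simps add_eq_0_iff)
          finally show "(N *\<^sub>v w) $ k = (- (s / (1 - s)) \<cdot>\<^sub>v w) $ k" using k by (simp add: w_def)
        qed (simp add: N_def w_def)
      qed
      then show ?thesis using False by (auto simp: spectrum_def eigenvalue_def)
    qed simp
  qed
  moreover have "finite ((\<lambda>s. - (s / (1 - s))) -` spectrum N \<inter> (- {1}))"
  proof (rule finite_vimage_IntI[OF card_finite_spectrum(1)[OF N]])
    show "inj_on (\<lambda>s. - (s / (1 - s))) (- {1 :: complex})"
      by (rule inj_onI) (auto simp: frac_eq_eq algebra_simps)
  qed
  ultimately show ?thesis by (meson finite_insert finite_subset)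
qed

lemma polyfun_vanishes_on_line:
  fixes f :: "('v \<Rightarrow> complex) \<Rightarrow> complex"
  assumes f: "f \<in> polyfun V" and S: "finite S"
    and zero: "\<And>s. s \<notin> S \<Longrightarrow> f (\<lambda>v. (1 - s) * a v + s * b v) = 0"
  shows "f a = 0"
proof -
  obtain q where q: "\<And>s. f (\<lambda>v. (1 - s) * a v + s * b v) = poly q s"
    using polyfun_line[OF f] by blast
  have "infinite (- S)" using S infinite_UNIV_char_0[where ?'a=complex] by (simp add: Compl_eq_Diff_UNIV Diff_infinite_finite)
  moreover have "- S \<subseteq> {s. poly q s = 0}" using zero q by auto
  ultimately have "q = 0" using poly_roots_finite[of q] finite_subset by blast
  then show ?thesis using q[of 0] by simp
qed

theorem lu_density:
  assumes mn: "m \<le> n" and f: "f \<in> polyfun V"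
    and zero: "\<And>z. z \<in> lu_points {..<m} {..<n} \<Longrightarrow> rows_independent {..<m} {..<n} z \<Longrightarrow> f z = 0"
    and z: "z \<in> lu_points {..<m} {..<n}"
  shows "f z = 0"
proof -
  let ?X = "\<lambda>i j. z (VX i j)" and ?Y = "\<lambda>j i. z (VY j i)"
  have pz: "lu_pair {..<m} {..<n} ?X ?Y" using z by (simp add: lu_points_def)
  obtain A B where A: "lu_pair {..<m} {..<n} A ?Y"
    and B: "\<And>i k. i < m \<Longrightarrow> k < m \<Longrightarrow> (\<Sum>j<n. A i j * B j k) = (if i = k then 1 else 0)"
    using exists_right_invertible[OF mn, of ?Y] by blast
  define b where "b = (\<lambda>v. case v of VX i j \<Rightarrow> A i j | VY j i \<Rightarrow> z (VY j i))"
  show ?thesis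
  proof (rule polyfun_vanishes_on_line[OF f finite_dependent_rows[OF B, where X = ?X]])
    fix s assume s: "s \<notin> {s. \<exists>c. (\<forall>j<n. (\<Sum>i<m. c i * ((1 - s) * ?X i j + s * A i j)) = 0) \<and> (\<exists>i<m. c i \<noteq> 0)}"
    let ?w = "\<lambda>v. (1 - s) * z v + s * b v"
    have w: "?w (VX i j) = (1 - s) * ?X i j + s * A i j" "?w (VY j i) = ?Y j i" for i j
      by (simp_all add: b_def algebra_simps)
    show "f ?w = 0"
    proof (rule zero)
      show "rows_independent {..<m} {..<n} ?w"
        unfolding rows_independent_def w using s by auto
      have "(\<Sum>j<n. ((1 - s) * ?X i j + s * A i j) * ?Y j k) =
          (1 - s) * (\<Sum>j<n. ?X i j * ?Y j k) + s * (\<Sum>j<n. A i j * ?Y j k)" for i k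
        by (simp add: sum.distrib sum_subtractf sum_distrib_left algebra_simps)
      moreover have "(\<Sum>i<m. ?Y j i * ((1 - s) * ?X i l + s * A i l)) =
          (1 - s) * (\<Sum>i<m. ?Y j i * ?X i l) + s * (\<Sum>i<m. ?Y j i * A i l)" for j l
        by (simp add: sum.distrib sum_subtractf sum_distrib_left algebra_simps)
      ultimately show "?w \<in> lu_points {..<m} {..<n}"
        using pz A unfolding lu_points_def lu_pair_def mem_Collect_eq w by simp
    qed
  qed
qed

section \<open>Dimension of the components of a spectrum\<close>

lemma irreducible_in_subtopology_closed:
  assumes Z: "closedin T Z"
  shows "irreducible_in (subtopology T Z) W \<longleftrightarrow> W \<subseteq> Z \<and> irreducible_in T W"
proof (intro iffI conjI)
  assume W: "irreducible_in (subtopology T Z) W"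
  then show "W \<subseteq> Z" by (auto simp: irreducible_in_def topspace_subtopology)
  show "irreducible_in T W"
    unfolding irreducible_in_def
  proof (intro conjI allI impI)
    show "W \<subseteq> topspace T" "W \<noteq> {}"
      using W by (auto simp: irreducible_in_def topspace_subtopology)
    fix F G assume FG: "closedin T F \<and> closedin T G \<and> W \<subseteq> F \<union> G"
    have "closedin (subtopology T Z) (F \<inter> Z)" "closedin (subtopology T Z) (G \<inter> Z)"
      using FG by (auto simp: closedin_subtopology)
    moreover have "W \<subseteq> F \<inter> Z \<union> G \<inter> Z" using FG \<open>W \<subseteq> Z\<close> by blast
    ultimately have "W \<subseteq> F \<inter> Z \<or> W \<subseteq> G \<inter> Z" using W unfolding irreducible_in_def by blast
    then show "W \<subseteq> F \<or> W \<subseteq> G" by blast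
  qed
next
  assume W: "W \<subseteq> Z \<and> irreducible_in T W"
  show "irreducible_in (subtopology T Z) W"
    unfolding irreducible_in_def
  proof (intro conjI allI impI)
    show "W \<subseteq> topspace (subtopology T Z)" "W \<noteq> {}"
      using W by (auto simp: irreducible_in_def topspace_subtopology)
    fix F G assume FG: "closedin (subtopology T Z) F \<and> closedin (subtopology T Z) G \<and> W \<subseteq> F \<union> G"
    then have "closedin T F" "closedin T G" using closedin_trans_full[OF _ Z] by blast+
    then show "W \<subseteq> F \<or> W \<subseteq> G" using W FG unfolding irreducible_in_def by blast
  qed
qed

section \<open>Irreducible closed sets and prime ideals\<close>

context cring
begin

lemma prime_subset_carrier: "primeideal P R \<Longrightarrow> P \<subseteq> carrier R"
  by (meson additive_subgroup.a_subset ideal.axioms(1) primeideal.axioms(1))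

lemma closedin_zariski_prime: "primeideal P R \<Longrightarrow> closedin (Spec R) (zariski_closed R P)"
  unfolding closedin_Spec using prime_subset_carrier by blast

lemma irreducible_zariski_prime:
  assumes P: "primeideal P R"
  shows "irreducible_in (Spec R) (zariski_closed R P)"
  unfolding irreducible_in_def
proof (intro conjI allI impI)
  show "zariski_closed R P \<subseteq> topspace (Spec R)" by (auto simp: zariski_closed_def topspace_Spec)
  have gen: "P \<in> zariski_closed R P" using P by (simp add: zariski_closed_def)
  then show "zariski_closed R P \<noteq> {}" by blast
  have contains: "zariski_closed R P \<subseteq> F" if "closedin (Spec R) F" "P \<in> F" for F
    using that by (auto simp: closedin_Spec zariski_closed_def)
  fix F G assume "closedin (Spec R) F \<and> closedin (Spec R) G \<and> zariski_closed R P \<subseteq> F \<union> G"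
  then show "zariski_closed R P \<subseteq> F \<or> zariski_closed R P \<subseteq> G" using gen contains by blast
qed

lemma prime_Inter_irreducible:
  assumes F: "irreducible_in (Spec R) F"
  shows "primeideal (\<Inter>F) R"
proof -
  have primes: "primeideal P R" if "P \<in> F" for P
    using F that by (auto simp: irreducible_in_def topspace_Spec)
  have ne: "F \<noteq> {}" using F by (simp add: irreducible_in_def)
  then obtain P0 where P0: "P0 \<in> F" by blast
  show ?thesis
  proof (rule primeidealI)
    show "ideal (\<Inter>F) R" using i_Intersect[OF _ ne] primes primeideal.axioms(1) by blast
    show "cring R" by (rule is_cring)
    show "carrier R \<noteq> \<Inter>F"
    proof
      assume "carrier R = \<Inter>F"
      then have "carrier R \<subseteq> P0" using P0 by blast
      then show False
        using primeideal.I_notcarr[OF primes[OF P0]] prime_subset_carrier[OF primes[OF P0]] by blast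
    qed
    fix a b assume ab: "a \<in> carrier R" "b \<in> carrier R" "a \<otimes> b \<in> \<Inter>F"
    have "closedin (Spec R) (zariski_closed R {a})" "closedin (Spec R) (zariski_closed R {b})"
      using ab unfolding closedin_Spec by blast+
    moreover have "F \<subseteq> zariski_closed R {a} \<union> zariski_closed R {b}"
    proof
      fix P assume P: "P \<in> F"
      then have "a \<in> P \<or> b \<in> P" using primeideal.I_prime[OF primes[OF P]] ab by blast
      then show "P \<in> zariski_closed R {a} \<union> zariski_closed R {b}"
        using primes[OF P] by (auto simp: zariski_closed_def)
    qed
    ultimately have "F \<subseteq> zariski_closed R {a} \<or> F \<subseteq> zariski_closed R {b}"
      using F unfolding irreducible_in_def by blast
    then show "a \<in> \<Inter>F \<or> b \<in> \<Inter>F" by (auto simp: zariski_closed_def)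
  qed
qed

lemma irreducible_subset_zariski:
  "irreducible_in (Spec R) F \<Longrightarrow> F \<subseteq> zariski_closed R (\<Inter>F)"
  by (auto simp: irreducible_in_def topspace_Spec zariski_closed_def)

lemma closed_irreducible_eq_zariski:
  assumes "closedin (Spec R) F" "irreducible_in (Spec R) F"
  shows "F = zariski_closed R (\<Inter>F)"
proof
  show "F \<subseteq> zariski_closed R (\<Inter>F)" by (rule irreducible_subset_zariski[OF assms(2)])
  obtain S where "F = zariski_closed R S" using assms(1) by (auto simp: closedin_Spec)
  then show "zariski_closed R (\<Inter>F) \<subseteq> F" by (auto simp: zariski_closed_def)
qed

lemma component_zariski_prime:
  assumes Z: "Z \<in> irreducible_components (Spec R)"
  shows "Z = zariski_closed R (\<Inter>Z)" "primeideal (\<Inter>Z) R"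
    "\<And>P. primeideal P R \<Longrightarrow> P \<subseteq> \<Inter>Z \<Longrightarrow> P = \<Inter>Z"
proof -
  have irr: "irreducible_in (Spec R) Z"
    and max: "\<And>W. irreducible_in (Spec R) W \<Longrightarrow> Z \<subseteq> W \<Longrightarrow> W = Z"
    using Z by (auto simp: irreducible_components_def)
  show prime: "primeideal (\<Inter>Z) R" by (rule prime_Inter_irreducible[OF irr])
  show eq: "Z = zariski_closed R (\<Inter>Z)"
    using max[OF irreducible_zariski_prime[OF prime] irreducible_subset_zariski[OF irr]] ..
  fix P assume P: "primeideal P R" "P \<subseteq> \<Inter>Z"
  have "Z \<subseteq> zariski_closed R P" using P(2) irr by (auto simp: irreducible_in_def topspace_Spec zariski_closed_def)
  then have "zariski_closed R P = Z" using max irreducible_zariski_prime[OF P(1)] by blast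
  then have "P \<in> Z" using P(1) by (auto simp: zariski_closed_def)
  with P(2) show "P = \<Inter>Z" by blast
qed

text \<open>The upper bound is asked of all prime chains in the ring, without reference to
  \<open>P\<close>, because in the application one bound serves all components.\<close>

lemma krull_dim_zariski_prime:
  assumes P: "primeideal P R"
    and chain: "\<And>i. i \<le> d \<Longrightarrow> primeideal (Q i) R" "\<And>i. i < d \<Longrightarrow> Q i \<subset> Q (Suc i)" "P \<subseteq> Q 0"
    and bound: "\<And>k Q. (\<And>i. i \<le> k \<Longrightarrow> primeideal (Q i) R) \<Longrightarrow> (\<And>i. i < k \<Longrightarrow> Q i \<subset> Q (Suc i)) \<Longrightarrow> k \<le> d"
  shows "krull_dim (subtopology (Spec R) (zariski_closed R P)) = enat d"
proof -
  let ?V = "zariski_closed R P"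
  let ?T = "subtopology (Spec R) ?V"
  let ?D = "{enat k | k. \<exists>Z. (\<forall>i\<le>k. closedin ?T (Z i) \<and> irreducible_in ?T (Z i)) \<and> (\<forall>i<k. Z i \<subset> Z (Suc i))}"
  have V: "closedin (Spec R) ?V" by (rule closedin_zariski_prime[OF P])
  have "enat d \<in> ?D"
  proof -
    \<comment> \<open>The index is reversed because larger primes give smaller closed sets.\<close>
    let ?Z = "\<lambda>i. zariski_closed R (Q (d - i))"
    have mono: "Q 0 \<subseteq> Q i" if "i \<le> d" for i
      using that
    proof (induction i)
      case (Suc i)
      then show ?case using chain(2)[of i] by auto
    qed simp
    have "closedin ?T (?Z i) \<and> irreducible_in ?T (?Z i)" if "i \<le> d" for i
    proof -
      have prime: "primeideal (Q (d - i)) R" using chain(1) by simp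
      have "?Z i \<subseteq> ?V" using mono[of "d - i"] chain(3) by (auto simp: zariski_closed_def)
      then show ?thesis
        using irreducible_zariski_prime[OF prime] closedin_zariski_prime[OF prime]
        by (simp add: irreducible_in_subtopology_closed[OF V] closedin_closed_subtopology[OF V])
    qed
    moreover have "?Z i \<subset> ?Z (Suc i)" if i: "i < d" for i
    proof -
      have "Suc (d - Suc i) = d - i" using i by simp
      then have lt: "Q (d - Suc i) \<subset> Q (d - i)" using chain(2)[of "d - Suc i"] i by simp
      have prime: "primeideal (Q (d - Suc i)) R" using chain(1) by simp
      have "?Z i \<subseteq> ?Z (Suc i)" using lt by (auto simp: zariski_closed_def)
      moreover have "Q (d - Suc i) \<in> ?Z (Suc i)" "Q (d - Suc i) \<notin> ?Z i"
        using prime lt by (auto simp: zariski_closed_def)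
      ultimately show ?thesis by blast
    qed
    ultimately have Z: "(\<forall>i\<le>d. closedin ?T (?Z i) \<and> irreducible_in ?T (?Z i)) \<and> (\<forall>i<d. ?Z i \<subset> ?Z (Suc i))"
      by simp
    show ?thesis by (intro CollectI exI[of _ d] conjI[OF refl] exI[of _ ?Z] Z)
  qed
  moreover have "x \<le> enat d" if x: "x \<in> ?D" for x
  proof -
    obtain k Z where k: "x = enat k" and Z: "\<And>i. i \<le> k \<Longrightarrow> closedin ?T (Z i) \<and> irreducible_in ?T (Z i)"
      "\<And>i. i < k \<Longrightarrow> Z i \<subset> Z (Suc i)" using x by blast
    have Z': "closedin (Spec R) (Z i)" "irreducible_in (Spec R) (Z i)" if "i \<le> k" for i
      using Z(1)[OF that] closedin_trans_full[OF _ V] irreducible_in_subtopology_closed[OF V] by blast+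
    have "k \<le> d"
    proof (rule bound)
      show "primeideal (\<Inter> (Z (k - i))) R" for i
        by (rule prime_Inter_irreducible[OF Z'(2)]) simp
      fix i assume i: "i < k"
      then have "Suc (k - Suc i) = k - i" by simp
      then have lt: "Z (k - Suc i) \<subset> Z (k - i)" using Z(2)[of "k - Suc i"] i by simp
      then have "\<Inter> (Z (k - i)) \<subseteq> \<Inter> (Z (k - Suc i))" by blast
      moreover have "\<Inter> (Z (k - i)) \<noteq> \<Inter> (Z (k - Suc i))"
        using lt closed_irreducible_eq_zariski[OF Z'] by (metis diff_le_self psubset_eq)
      ultimately show "\<Inter> (Z (k - i)) \<subset> \<Inter> (Z (k - Suc i))" by blast
    qed
    then show ?thesis by (simp add: k)
  qed
  ultimately show ?thesis
    unfolding krull_dim_def by (intro antisym Sup_least Sup_upper)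
qed

text \<open>The prime of a component is minimal, so it equals the \<open>P0\<close> supplied below
  it, and the chain over \<open>P0\<close> is a chain over it.\<close>

theorem equidimensional_SpecI:
  assumes chain: "\<And>P. primeideal P R \<Longrightarrow> \<exists>P0 Q. primeideal P0 R \<and> P0 \<subseteq> P \<and> P0 \<subseteq> Q 0 \<and>
      (\<forall>i\<le>d. primeideal (Q i) R) \<and> (\<forall>i<d. Q i \<subset> Q (Suc i))"
    and bound: "\<And>k Q. (\<And>i. i \<le> k \<Longrightarrow> primeideal (Q i) R) \<Longrightarrow> (\<And>i. i < k \<Longrightarrow> Q i \<subset> Q (Suc i)) \<Longrightarrow> k \<le> d"
  shows "equidimensional (Spec R)"
proof -
  have "krull_dim (subtopology (Spec R) Z) = enat d" if Z: "Z \<in> irreducible_components (Spec R)" for Z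
  proof -
    note comp = component_zariski_prime[OF Z]
    obtain P0 Q where Q: "primeideal P0 R" "P0 \<subseteq> \<Inter>Z" "P0 \<subseteq> Q 0"
      "\<And>i. i \<le> d \<Longrightarrow> primeideal (Q i) R" "\<And>i. i < d \<Longrightarrow> Q i \<subset> Q (Suc i)"
      using chain[OF comp(2)] by blast
    have "\<Inter>Z \<subseteq> Q 0" using comp(3)[OF Q(1,2)] Q(3) by simp
    have "krull_dim (subtopology (Spec R) (zariski_closed R (\<Inter>Z))) = enat d"
    proof (rule krull_dim_zariski_prime[OF comp(2)])
      show "\<And>i. i \<le> d \<Longrightarrow> primeideal (Q i) R" "\<And>i. i < d \<Longrightarrow> Q i \<subset> Q (Suc i)" "\<Inter>Z \<subseteq> Q 0"
        by fact+
    qed (rule bound)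
    then show ?thesis by (simp flip: comp(1))
  qed
  then show ?thesis by (simp add: equidimensional_def)
qed

section \<open>Primes of a quotient ring\<close>

lemma prime_image_quotient:
  assumes I: "ideal I R" and P: "primeideal P R" "I \<subseteq> P"
  shows "primeideal ((+>) I ` P) (R Quot I)" "\<Union> ((+>) I ` P) = P"
proof -
  have idP: "ideal P R" using P(1) by (rule primeideal.axioms(1))
  show U: "\<Union> ((+>) I ` P) = P" using ideal_incl_iff[OF I idP] P(2) by simp
  have id: "ideal ((+>) I ` P) (R Quot I)" by (rule ring_ideal_imp_quot_ideal[OF I idP])
  have sub: "(+>) I ` P \<subseteq> carrier (R Quot I)"
    by (rule additive_subgroup.a_subset[OF ideal.axioms(1)[OF id]])
  have mem: "I +> a \<in> (+>) I ` P \<longleftrightarrow> a \<in> P" if "a \<in> carrier R" for a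
    using canonical_proj_vimage_mem_iff[OF I sub that] U by simp
  show "primeideal ((+>) I ` P) (R Quot I)"
  proof (rule primeidealI[OF id])
    show "cring (R Quot I)" by (rule ideal.quotient_is_cring[OF I is_cring])
    show "carrier (R Quot I) \<noteq> (+>) I ` P"
    proof
      assume eq: "carrier (R Quot I) = (+>) I ` P"
      have "a \<in> P" if "a \<in> carrier R" for a
      proof -
        have "I +> a \<in> carrier (R Quot I)" using that by (auto simp: FactRing_def A_RCOSETS_def')
        then show ?thesis using mem[OF that] eq by simp
      qed
      then have "carrier R \<subseteq> P" by (rule subsetI)
      then show False using primeideal.I_notcarr[OF P(1)] prime_subset_carrier[OF P(1)] by blast
    qed
    fix A B assume "A \<in> carrier (R Quot I)" "B \<in> carrier (R Quot I)"
      and AB: "A \<otimes>\<^bsub>R Quot I\<^esub> B \<in> (+>) I ` P"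
    then obtain a b where ab: "a \<in> carrier R" "A = I +> a" "b \<in> carrier R" "B = I +> b"
      by (auto simp: FactRing_def A_RCOSETS_def')
    have "A \<otimes>\<^bsub>R Quot I\<^esub> B = I +> (a \<otimes> b)"
      using ideal.rcoset_mult_add[OF I ab(1,3)] by (simp add: FactRing_def ab)
    then have "a \<otimes> b \<in> P" using AB mem[of "a \<otimes> b"] ab by simp
    then show "A \<in> (+>) I ` P \<or> B \<in> (+>) I ` P"
      using primeideal.I_prime[OF P(1) ab(1,3)] ab mem by auto
  qed
qed

lemma prime_Union_quotient:
  assumes I: "ideal I R" and P: "primeideal P (R Quot I)"
  shows "primeideal (\<Union>P) R" "I \<subseteq> \<Union>P" "(+>) I ` (\<Union>P) = P"
proof -
  have idP: "ideal P (R Quot I)" using P by (rule primeideal.axioms(1))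
  have sub: "P \<subseteq> carrier (R Quot I)"
    by (rule additive_subgroup.a_subset[OF ideal.axioms(1)[OF idP]])
  have eq: "\<Union>P = {r \<in> carrier R. I +> r \<in> P}"
    using canonical_proj_vimage_in_carrier[OF I sub] canonical_proj_vimage_mem_iff[OF I sub] by blast
  show "primeideal (\<Union>P) R"
    unfolding eq by (rule ring_hom_ring.primeideal_vimage[OF ideal.rcos_ring_hom_ring[OF I] is_cring P])
  have "I \<in> P"
    using additive_subgroup.zero_closed[OF ideal.axioms(1)[OF idP]] by (simp add: FactRing_def)
  then show "I \<subseteq> \<Union>P" by blast
  show "(+>) I ` (\<Union>P) = P"
  proof
    show "(+>) I ` (\<Union>P) \<subseteq> P" unfolding eq by blast
    show "P \<subseteq> (+>) I ` (\<Union>P)"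
    proof
      fix A assume A: "A \<in> P"
      then obtain a where "a \<in> carrier R" "A = I +> a" using sub by (auto simp: FactRing_def A_RCOSETS_def')
      then show "A \<in> (+>) I ` (\<Union>P)" using A unfolding eq by blast
    qed
  qed
qed

theorem equidimensional_Spec_quotientI:
  assumes I: "ideal I R"
    and chain: "\<And>P. primeideal P R \<Longrightarrow> I \<subseteq> P \<Longrightarrow> \<exists>P0 Q. primeideal P0 R \<and> I \<subseteq> P0 \<and> P0 \<subseteq> P \<and> P0 \<subseteq> Q 0 \<and>
      (\<forall>i\<le>d. primeideal (Q i) R) \<and> (\<forall>i<d. Q i \<subset> Q (Suc i))"
    and bound: "\<And>k Q. (\<And>i. i \<le> k \<Longrightarrow> primeideal (Q i) R) \<Longrightarrow> I \<subseteq> Q 0 \<Longrightarrow>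
      (\<And>i. i < k \<Longrightarrow> Q i \<subset> Q (Suc i)) \<Longrightarrow> k \<le> d"
  shows "equidimensional (Spec (R Quot I))"
proof (rule cring.equidimensional_SpecI)
  let ?f = "\<lambda>P. (+>) I ` P"
  show "cring (R Quot I)" by (rule ideal.quotient_is_cring[OF I is_cring])
  fix P assume P: "primeideal P (R Quot I)"
  note UP = prime_Union_quotient[OF I P]
  obtain P0 Q where Q: "primeideal P0 R" "I \<subseteq> P0" "P0 \<subseteq> \<Union>P" "P0 \<subseteq> Q 0"
    "\<And>i. i \<le> d \<Longrightarrow> primeideal (Q i) R" "\<And>i. i < d \<Longrightarrow> Q i \<subset> Q (Suc i)"
    using chain[OF UP(1,2)] by blast
  have IQ: "I \<subseteq> Q i" if "i \<le> d" for i
    using that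
  proof (induction i)
    case 0
    then show ?case using Q(2,4) by blast
  next
    case (Suc i)
    then show ?case using Q(6)[of i] by auto
  qed
  have "primeideal (?f P0) (R Quot I)" by (rule prime_image_quotient(1)[OF I Q(1,2)])
  moreover have "?f P0 \<subseteq> P" using Q(3) UP(3) by blast
  moreover have "?f P0 \<subseteq> ?f (Q 0)" using Q(4) by blast
  moreover have "primeideal (?f (Q i)) (R Quot I)" if "i \<le> d" for i
    by (rule prime_image_quotient(1)[OF I Q(5)[OF that] IQ[OF that]])
  moreover have "?f (Q i) \<subset> ?f (Q (Suc i))" if "i < d" for i
  proof -
    have "\<Union> (?f (Q i)) = Q i" "\<Union> (?f (Q (Suc i))) = Q (Suc i)"
      using prime_image_quotient(2)[OF I Q(5) IQ] that by simp_all
    then show ?thesis using Q(6)[OF that] by (metis image_mono psubset_eq)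
  qed
  ultimately show "\<exists>P0 Q. primeideal P0 (R Quot I) \<and> P0 \<subseteq> P \<and> P0 \<subseteq> Q 0 \<and>
      (\<forall>i\<le>d. primeideal (Q i) (R Quot I)) \<and> (\<forall>i<d. Q i \<subset> Q (Suc i))"
    by (intro exI[of _ "?f P0"] exI[of _ "\<lambda>i. ?f (Q i)"]) simp
next
  fix k and Q :: "nat \<Rightarrow> 'a set set"
  assume Q: "\<And>i. i \<le> k \<Longrightarrow> primeideal (Q i) (R Quot I)" "\<And>i. i < k \<Longrightarrow> Q i \<subset> Q (Suc i)"
  show "k \<le> d"
  proof (rule bound)
    show "primeideal (\<Union> (Q i)) R" if "i \<le> k" for i by (rule prime_Union_quotient(1)[OF I Q(1)[OF that]])
    show "I \<subseteq> \<Union> (Q 0)" by (rule prime_Union_quotient(2)[OF I Q(1)]) simp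
    show "\<Union> (Q i) \<subset> \<Union> (Q (Suc i))" if "i < k" for i
    proof -
      have "(+>) I ` \<Union> (Q i) = Q i" "(+>) I ` \<Union> (Q (Suc i)) = Q (Suc i)"
        using prime_Union_quotient(3)[OF I Q(1)] that by simp_all
      then show ?thesis using Q(2)[OF that] by (metis Union_mono psubset_eq)
    qed
  qed
qed

end

section \<open>Vanishing ideals of parametrised sets\<close>

definition vanishing_ideal :: "'v set \<Rightarrow> ('v \<Rightarrow> complex) set \<Rightarrow> (('v \<Rightarrow>\<^sub>0 nat) \<Rightarrow>\<^sub>0 complex) set" where
  "vanishing_ideal V S = {p \<in> pcarrier V. \<forall>z\<in>S. peval p z = 0}"

lemma vanishing_ideal_ideal: "ideal (vanishing_ideal V S) (poly_ring V)"
  unfolding poly_ring_ideal_iff vanishing_ideal_def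
  by (auto simp: peval_add peval_mult intro: pcarrier_add pcarrier_mult pcarrier_zero)

lemma vanishing_ideal_mono: "S \<subseteq> S' \<Longrightarrow> vanishing_ideal V S' \<subseteq> vanishing_ideal V S"
  by (auto simp: vanishing_ideal_def)

lemma peval_param_polyfun:
  assumes "\<forall>v\<in>V. (\<lambda>t. \<Psi> t v) \<in> polyfun T" "p \<in> pcarrier V"
  shows "(\<lambda>t. peval p (\<Psi> t)) \<in> polyfun T"
  using polyfun_compose[of "peval p" V \<Psi> T] assms by (auto simp: polyfun_def)

text \<open>Any two points of \<open>M\<close> lie on a line almost contained in \<open>M\<close>, which makes \<open>M\<close> irreducible.\<close>

lemma vanishing_ideal_prime:
  assumes \<Psi>: "\<forall>v\<in>V. (\<lambda>t. \<Psi> t v) \<in> polyfun T" and M: "M \<noteq> {}"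
    and line: "\<And>a b. a \<in> M \<Longrightarrow> b \<in> M \<Longrightarrow> \<exists>S. finite S \<and> (\<forall>s. s \<notin> S \<longrightarrow> (\<lambda>v. (1 - s) * a v + s * b v) \<in> M)"
  shows "primeideal (vanishing_ideal V (\<Psi> ` M)) (poly_ring V)"
  unfolding poly_ring_primeideal_iff
proof (intro conjI ballI impI vanishing_ideal_ideal)
  show "1 \<notin> vanishing_ideal V (\<Psi> ` M)" using M by (auto simp: vanishing_ideal_def)
  fix p q assume pq: "p \<in> pcarrier V" "q \<in> pcarrier V" "p * q \<in> vanishing_ideal V (\<Psi> ` M)"
  show "p \<in> vanishing_ideal V (\<Psi> ` M) \<or> q \<in> vanishing_ideal V (\<Psi> ` M)"
  proof (rule ccontr)
    assume "\<not> ?thesis"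
    then obtain a b where ab: "a \<in> M" "peval p (\<Psi> a) \<noteq> 0" "b \<in> M" "peval q (\<Psi> b) \<noteq> 0"
      using pq by (auto simp: vanishing_ideal_def)
    \<comment> \<open>The line passes through \<open>a\<close> at 0 and through \<open>b\<close> at
      1. So neither restricted polynomial is zero, although their product has infinitely many
      zeros.\<close>
    let ?l = "\<lambda>s v. (1 - s) * a v + s * b v"
    obtain f where f: "\<And>s. peval p (\<Psi> (?l s)) = poly f s"
      using polyfun_line[OF peval_param_polyfun[OF \<Psi> pq(1)], of a b] by auto
    obtain g where g: "\<And>s. peval q (\<Psi> (?l s)) = poly g s"
      using polyfun_line[OF peval_param_polyfun[OF \<Psi> pq(2)], of a b] by auto
    obtain S where S: "finite S" "\<And>s. s \<notin> S \<Longrightarrow> ?l s \<in> M" using line[OF ab(1,3)] by blast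
    have "poly (f * g) s = 0" if "s \<notin> S" for s
    proof -
      have "peval (p * q) (\<Psi> (?l s)) = 0"
        using pq(3) S(2)[OF that] unfolding vanishing_ideal_def by blast
      then show ?thesis by (simp only: peval_mult f g poly_mult)
    qed
    then have "- S \<subseteq> {s. poly (f * g) s = 0}" by blast
    moreover have "infinite (- S)"
      using S(1) infinite_UNIV_char_0[where ?'a=complex] by (simp add: Compl_eq_Diff_UNIV Diff_infinite_finite)
    ultimately have "f * g = 0" using poly_roots_finite[of "f * g"] finite_subset by blast
    then have "f = 0 \<or> g = 0" by simp
    moreover have "poly f 0 \<noteq> 0" using f[of 0] ab(2) by simp
    moreover have "poly g 1 \<noteq> 0" using g[of 1] ab(4) by simp
    ultimately show False by auto
  qed
qed

text \<open>Elements separating consecutive primes pull back along \<open>\<Psi>\<close> to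
  polynomials in \<open>card T\<close> variables. If there are more than \<open>card T\<close> of
  them, a relation holds; on the original elements it vanishes on the image, hence lies in
  \<open>Q 0\<close>, against the independence along the chain.\<close>

theorem prime_chain_length_le:
  fixes Q :: "nat \<Rightarrow> (('v \<Rightarrow>\<^sub>0 nat) \<Rightarrow>\<^sub>0 complex) set"
  assumes T: "finite T" and \<Psi>: "\<forall>v\<in>V. (\<lambda>t. \<Psi> t v) \<in> polyfun T"
    and prime: "\<And>i. i \<le> k \<Longrightarrow> primeideal (Q i) (poly_ring V)"
    and chain: "\<And>i. i < k \<Longrightarrow> Q i \<subset> Q (Suc i)"
    and Q0: "vanishing_ideal V (range \<Psi>) \<subseteq> Q 0"
  shows "k \<le> card T"
proof (rule ccontr)
  assume "\<not> k \<le> card T"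
  then have lt: "card T < k" by simp
  have "\<forall>i. \<exists>x. i < k \<longrightarrow> x \<in> Q (Suc i) - Q i" using chain by blast
  then obtain x where x: "\<And>i. i < k \<Longrightarrow> x i \<in> Q (Suc i) - Q i" by metis
  have xc: "x i \<in> pcarrier V" if "i < k" for i
    using x[OF that] pideal_D(1)[OF pprime_D(1)[OF prime[of "Suc i"]]] that by auto
  have "\<exists>y. y \<in> pcarrier T \<and> (\<forall>t. peval y t = peval (x i) (\<Psi> t))" if "i < k" for i
    using polyfunE[OF peval_param_polyfun[OF \<Psi> xc[OF that]]] by metis
  then obtain y where y: "\<And>i. i < k \<Longrightarrow> y i \<in> pcarrier T"
    "\<And>i t. i < k \<Longrightarrow> peval (y i) t = peval (x i) (\<Psi> t)" by metis
  obtain K c where K: "finite K" "K \<noteq> {}" "K \<subseteq> extensional {..<k}" "\<forall>\<kappa>\<in>K. c \<kappa> \<noteq> 0"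
    "(\<Sum>\<kappa>\<in>K. pconst (c \<kappa>) * (\<Prod>i<k. y i ^ \<kappa> i)) = 0"
    using algebraic_dependence[OF T lt, of y] y(1) by (metis (no_types, lifting))
  let ?r = "\<Sum>\<kappa>\<in>K. pconst (c \<kappa>) * (\<Prod>i<k. x i ^ \<kappa> i)"
  have "peval ?r (\<Psi> t) = peval (\<Sum>\<kappa>\<in>K. pconst (c \<kappa>) * (\<Prod>i<k. y i ^ \<kappa> i)) t" for t
    by (simp add: peval_sum peval_mult peval_prod peval_power y(2))
  then have "peval ?r (\<Psi> t) = 0" for t by (simp add: K(5))
  moreover have "?r \<in> pcarrier V"
    by (intro pcarrier_sum pcarrier_mult pcarrier_const pcarrier_prod pcarrier_power xc) auto
  ultimately have "?r \<in> Q 0" using Q0 by (auto simp: vanishing_ideal_def)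
  moreover obtain \<kappa> where "\<kappa> \<in> K" using K(2) by blast
  ultimately show False
    using prime_chain_independent[of k Q V x K \<kappa> c, OF prime psubset_imp_subset[OF chain] x K(1) _ _ K(3)]
      K(4) by blast
qed

text \<open>The chain consists of the vanishing ideals of the images of the subtori on which the first \<open>i\<close>
  parameters are \<open>1\<close>; the rational inverse of the chart separates consecutive ones.\<close>

theorem lu_chart_prime_chain:
  assumes chart: "lu_chart I J T \<Psi>"
  shows "\<exists>Q. (\<forall>i\<le>card T. primeideal (Q i) (poly_ring (lu_index I J))) \<and>
    (\<forall>i<card T. Q i \<subset> Q (Suc i)) \<and> vanishing_ideal (lu_index I J) (range \<Psi>) \<subseteq> Q 0"
proof -
  let ?V = "lu_index I J"
  have T: "finite T" and \<Psi>: "\<forall>v\<in>?V. (\<lambda>t. \<Psi> t v) \<in> polyfun T"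
    using chart by (simp_all add: lu_chart_def)
  obtain e where e: "bij_betw e {..<card T} T"
    using ex_bij_betw_nat_finite[OF T] by (auto simp: atLeast0LessThan)
  define M where "M i = {t. (\<forall>k\<in>T. t k \<noteq> (0 :: complex)) \<and> (\<forall>j<i. t (e j) = 1)}" for i
  define Q where "Q i = vanishing_ideal ?V (\<Psi> ` M i)" for i
  have one: "(\<lambda>_. 1) \<in> M i" for i by (simp add: M_def)
  have "primeideal (Q i) (poly_ring ?V)" for i
    unfolding Q_def
  proof (rule vanishing_ideal_prime[OF \<Psi>])
    show "M i \<noteq> {}" using one by blast
    fix a b assume a: "a \<in> M i" and b: "b \<in> M i"
    \<comment> \<open>The excluded \<open>s\<close> are those at which a coordinate vanishes. Where
      \<open>a\<close> and \<open>b\<close> agree, division by 0 excludes only the value 0, which is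
      harmless.\<close>
    have "(\<lambda>v. (1 - s) * a v + s * b v) \<in> M i" if s: "s \<notin> (\<lambda>v. a v / (a v - b v)) ` T" for s
      unfolding M_def
    proof (intro CollectI conjI ballI allI impI)
      fix k assume k: "k \<in> T"
      have ak: "a k \<noteq> 0" using a k by (simp add: M_def)
      show "(1 - s) * a k + s * b k \<noteq> 0"
      proof
        assume "(1 - s) * a k + s * b k = 0"
        then have eq: "s * (a k - b k) = a k" by (simp add: algebra_simps)
        then have "a k - b k \<noteq> 0" using ak by auto
        then have "s = a k / (a k - b k)" using eq by (simp add: field_simps)
        then show False using s k by blast
      qed
    next
      fix j assume "j < i"
      then show "(1 - s) * a (e j) + s * b (e j) = 1" using a b by (simp add: M_def)
    qed
    then show "\<exists>S. finite S \<and> (\<forall>s. s \<notin> S \<longrightarrow> (\<lambda>v. (1 - s) * a v + s * b v) \<in> M i)"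
      using T by (intro exI[of _ "(\<lambda>v. a v / (a v - b v)) ` T"]) simp
  qed
  moreover have "Q i \<subset> Q (Suc i)" if i: "i < card T" for i
  proof -
    have "M (Suc i) \<subseteq> M i" by (auto simp: M_def)
    then have "Q i \<subseteq> Q (Suc i)" unfolding Q_def by (intro vanishing_ideal_mono image_mono)
    moreover have ei: "e i \<in> T" using e i by (auto simp: bij_betw_def)
    obtain h f where h: "h \<in> polyfun ?V" and f: "f \<in> polyfun ?V"
      and inv: "\<And>t. (\<forall>k\<in>T. t k \<noteq> 0) \<Longrightarrow> f (\<Psi> t) \<noteq> 0 \<and> h (\<Psi> t) = t (e i) * f (\<Psi> t)"
      using chart ei unfolding lu_chart_def by blast
    \<comment> \<open>At the image of a torus point, \<open>h - f\<close> is
      \<open>(t (e i) - 1) * f\<close>, so it vanishes exactly when that parameter is 1.\<close>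
    obtain p where p: "p \<in> pcarrier ?V" "\<And>z. h z - f z = peval p z"
      using polyfunE[OF polyfun_diff[OF h f]] by metis
    have "p \<in> Q (Suc i)"
      unfolding Q_def vanishing_ideal_def
    proof (intro CollectI conjI p ballI)
      fix z assume "z \<in> \<Psi> ` M (Suc i)"
      then obtain t where t: "z = \<Psi> t" "\<forall>k\<in>T. t k \<noteq> 0" "t (e i) = 1" by (auto simp: M_def)
      show "peval p z = 0" using inv[OF t(2)] t(1,3) by (simp flip: p(2))
    qed
    moreover have "p \<notin> Q i"
    proof
      assume pQ: "p \<in> Q i"
      \<comment> \<open>The value 2 is neither 0 nor 1: the point stays in the torus, but
        \<open>h - f\<close> does not vanish at its image.\<close>
      define t where "t = (\<lambda>v. if v = e i then 2 else 1 :: complex)"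
      have "e j \<noteq> e i" if "j < i" for j
        using e that i by (auto simp: bij_betw_def dest: inj_onD)
      then have "t \<in> M i" by (auto simp: M_def t_def)
      then have "peval p (\<Psi> t) = 0" using pQ by (auto simp: Q_def vanishing_ideal_def)
      then have "h (\<Psi> t) = f (\<Psi> t)" using p(2)[of "\<Psi> t"] by simp
      moreover have "f (\<Psi> t) \<noteq> 0 \<and> h (\<Psi> t) = t (e i) * f (\<Psi> t)" by (rule inv) (simp add: t_def)
      ultimately show False by (simp add: t_def)
    qed
    ultimately show ?thesis by blast
  qed
  moreover have "vanishing_ideal ?V (range \<Psi>) \<subseteq> Q 0"
    unfolding Q_def by (rule vanishing_ideal_mono) blast
  ultimately show ?thesis by blast
qed

section \<open>Equidimensionality of the lower-upper scheme\<close>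

lemma lu_vars_eq_index: "lu_vars m n = lu_index {..<m} {..<n}"
  by (simp add: lu_vars_def lu_index_def)

lemma finite_lu_vars: "finite (lu_vars m n)"
proof -
  have "lu_vars m n = (\<lambda>(i, j). VX i j) ` ({..<m} \<times> {..<n}) \<union> (\<lambda>(i, j). VY j i) ` ({..<m} \<times> {..<n})"
    by (auto simp: lu_vars_def)
  then show ?thesis by simp
qed

lemma lu_equations_vanish_iff_points:
  "(\<forall>p\<in>lu_equations m n. peval p z = 0) \<longleftrightarrow> z \<in> lu_points {..<m} {..<n}"
proof -
  have XY: "peval ((generic_X m n * generic_Y m n) $$ (i, j)) z = (\<Sum>k<n. z (VX i k) * z (VY k j))"
    if "i < j" "j < m" for i j
    using that by (simp add: generic_X_def generic_Y_def scalar_prod_def peval_sum peval_mult lessThan_atLeast0)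
  have YX: "peval ((generic_Y m n * generic_X m n) $$ (i, j)) z = (\<Sum>k<m. z (VY i k) * z (VX k j))"
    if "j < i" "i < n" for i j
    using that by (simp add: generic_X_def generic_Y_def scalar_prod_def peval_sum peval_mult lessThan_atLeast0)
  have "(\<forall>p\<in>lu_equations m n. peval p z = 0) \<longleftrightarrow>
    (\<forall>i j. i < j \<and> j < m \<longrightarrow> peval ((generic_X m n * generic_Y m n) $$ (i, j)) z = 0) \<and>
    (\<forall>i j. j < i \<and> i < n \<longrightarrow> peval ((generic_Y m n * generic_X m n) $$ (i, j)) z = 0)"
    unfolding lu_equations_def by blast
  also have "\<dots> \<longleftrightarrow> (\<forall>i j. i < j \<and> j < m \<longrightarrow> (\<Sum>k<n. z (VX i k) * z (VY k j)) = 0) \<and>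
    (\<forall>i j. j < i \<and> i < n \<longrightarrow> (\<Sum>k<m. z (VY i k) * z (VX k j)) = 0)"
    using XY YX by simp
  also have "\<dots> \<longleftrightarrow> z \<in> lu_points {..<m} {..<n}"
    unfolding lu_points_def lu_pair_def by (auto intro: less_trans)
  finally show ?thesis .
qed

theorem theoremA3:
  fixes m n :: nat
  assumes "1 \<le> m" and "m \<le> n"
  shows "equidimensional (lower_upper_scheme m n)"
proof -
  let ?V = "lu_vars m n" and ?E = "lu_equations m n" and ?P = "lu_points {..<m} {..<n}"
  let ?R = "poly_ring ?V :: lu_poly ring"
  let ?d = "m * n + m"
  interpret R: cring ?R by (rule cring_poly_ring)
  obtain W where W: "finite W" "\<And>\<Psi>. \<Psi> \<in> W \<Longrightarrow> \<exists>T. lu_chart {..<m} {..<n} T \<Psi>"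
    and cover: "\<And>z. z \<in> ?P \<Longrightarrow> rows_independent {..<m} {..<n} z \<Longrightarrow>
      \<exists>\<Psi>\<in>W. \<exists>t. \<forall>v\<in>?V. \<Psi> t v = z v"
    using lu_charts_cover[of "{..<m}" "{..<n}"] unfolding lu_vars_eq_index by auto
  have chartE: "\<exists>T. lu_chart {..<m} {..<n} T \<Psi> \<and> finite T \<and> card T = ?d \<and>
      (\<forall>v\<in>?V. (\<lambda>t. \<Psi> t v) \<in> polyfun T) \<and> range \<Psi> \<subseteq> ?P" if \<Psi>: "\<Psi> \<in> W" for \<Psi>
  proof -
    obtain T where T: "lu_chart {..<m} {..<n} T \<Psi>" using W(2)[OF \<Psi>] ..
    have "finite T" "card T = ?d" "\<forall>v\<in>?V. (\<lambda>t. \<Psi> t v) \<in> polyfun T" "\<forall>t. \<Psi> t \<in> ?P"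
      using T by (simp_all add: lu_chart_def lu_vars_eq_index)
    with T show ?thesis by (intro exI[of _ T]) auto
  qed
  \<comment> \<open>Otherwise take one polynomial outside \<open>P\<close> from each vanishing
    ideal. Their product vanishes at all points with independent rows, hence by density wherever the
    equations hold. Yet it is not in the prime \<open>P\<close>, so by the Nullstellensatz it is
    nonzero at some zero of \<open>P\<close>.\<close>
  have below: "\<exists>\<Psi>\<in>W. vanishing_ideal ?V (range \<Psi>) \<subseteq> P"
    if P: "primeideal P ?R" "?E \<subseteq> P" for P
  proof (rule ccontr)
    assume "\<not> ?thesis"
    then have "\<forall>\<Psi>\<in>W. \<exists>f. f \<in> vanishing_ideal ?V (range \<Psi>) - P" by blast
    then obtain f where f: "\<And>\<Psi>. \<Psi> \<in> W \<Longrightarrow> f \<Psi> \<in> vanishing_ideal ?V (range \<Psi>) - P" by metis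
    have fc: "f \<Psi> \<in> pcarrier ?V" if "\<Psi> \<in> W" for \<Psi>
      using f[OF that] by (simp add: vanishing_ideal_def)
    define F where "F = (\<Prod>\<Psi>\<in>W. f \<Psi>)"
    have F: "F \<in> pcarrier ?V" "F \<notin> P"
      using pcarrier_prod[of W f] fc pprime_prod[OF P(1), of W f] f unfolding F_def by blast+
    obtain z where z: "\<forall>p\<in>P. peval p z = 0" "peval F z \<noteq> 0"
      using nullstellensatz[OF finite_lu_vars P(1) F] by blast
    have zP: "z \<in> ?P" using z(1) P(2) lu_equations_vanish_iff_points[of m n z] by blast
    have "peval F z = 0"
    proof (rule lu_density[OF assms(2) _ _ zP])
      show "peval F \<in> polyfun ?V" using F(1) by (simp add: polyfun_def)
      fix w assume w: "w \<in> ?P" "rows_independent {..<m} {..<n} w"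
      obtain \<Psi> t where \<Psi>: "\<Psi> \<in> W" "\<forall>v\<in>?V. \<Psi> t v = w v" using cover[OF w] by blast
      have "peval (f \<Psi>) (\<Psi> t) = 0" using f[OF \<Psi>(1)] by (simp add: vanishing_ideal_def)
      moreover have "peval (f \<Psi>) (\<Psi> t) = peval (f \<Psi>) w"
        using \<Psi>(2) by (intro peval_cong[OF fc[OF \<Psi>(1)]]) simp
      ultimately show "peval F w = 0"
        unfolding F_def peval_prod using W(1) \<Psi>(1) by (intro prod_zero) auto
    qed
    with z(2) show False by simp
  qed
  let ?I = "Idl\<^bsub>?R\<^esub> ?E"
  have I: "ideal ?I ?R" by (rule R.genideal_ideal[OF lu_equations_closed])
  have EI: "?E \<subseteq> ?I" by (rule R.genideal_self[OF lu_equations_closed])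
  have "equidimensional (Spec (?R Quot ?I))"
  proof (rule R.equidimensional_Spec_quotientI[OF I, where d = ?d])
    fix P assume P: "primeideal P ?R" "?I \<subseteq> P"
    then obtain \<Psi> where \<Psi>: "\<Psi> \<in> W" "vanishing_ideal ?V (range \<Psi>) \<subseteq> P" using below EI by blast
    obtain T where T: "lu_chart {..<m} {..<n} T \<Psi>" "finite T" "card T = ?d"
      "\<forall>v\<in>?V. (\<lambda>t. \<Psi> t v) \<in> polyfun T" "range \<Psi> \<subseteq> ?P"
      using chartE[OF \<Psi>(1)] by (elim exE conjE)
    obtain Q where Q: "\<forall>i\<le>?d. primeideal (Q i) ?R" "\<forall>i<?d. Q i \<subset> Q (Suc i)"
      "vanishing_ideal ?V (range \<Psi>) \<subseteq> Q 0"
      using lu_chart_prime_chain[OF T(1)] unfolding T(3) lu_vars_eq_index by (elim exE conjE)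
    \<comment> \<open>Here the parameter set is the whole space, which contains every line.\<close>
    have "primeideal (vanishing_ideal ?V (range \<Psi>)) ?R"
      by (rule vanishing_ideal_prime[OF T(4)]) auto
    moreover have "?I \<subseteq> vanishing_ideal ?V (range \<Psi>)"
    proof (rule R.genideal_minimal[OF vanishing_ideal_ideal])
      show "?E \<subseteq> vanishing_ideal ?V (range \<Psi>)"
        using lu_equations_closed[of m n] T(5) lu_equations_vanish_iff_points[of m n]
        unfolding vanishing_ideal_def by blast
    qed
    ultimately show "\<exists>P0 Q. primeideal P0 ?R \<and> ?I \<subseteq> P0 \<and> P0 \<subseteq> P \<and> P0 \<subseteq> Q 0 \<and>
        (\<forall>i\<le>?d. primeideal (Q i) ?R) \<and> (\<forall>i<?d. Q i \<subset> Q (Suc i))"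
      using \<Psi>(2) Q by (intro exI[of _ "vanishing_ideal ?V (range \<Psi>)"] exI[of _ Q] conjI)
  next
    fix k Q assume Q: "\<And>i. i \<le> k \<Longrightarrow> primeideal (Q i) ?R" "?I \<subseteq> Q 0"
      "\<And>i. i < k \<Longrightarrow> Q i \<subset> Q (Suc i)"
    \<comment> \<open>The smallest prime of the chain lies over some chart ideal, and that chart has
      \<open>?d\<close> parameters.\<close>
    obtain \<Psi> where \<Psi>: "\<Psi> \<in> W" "vanishing_ideal ?V (range \<Psi>) \<subseteq> Q 0"
      using below[OF Q(1)[of 0]] EI Q(2) by auto
    obtain T where T: "lu_chart {..<m} {..<n} T \<Psi>" "finite T" "card T = ?d"
      "\<forall>v\<in>?V. (\<lambda>t. \<Psi> t v) \<in> polyfun T" "range \<Psi> \<subseteq> ?P"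
      using chartE[OF \<Psi>(1)] by (elim exE conjE)
    have "k \<le> card T" by (rule prime_chain_length_le[OF T(2,4) Q(1,3) \<Psi>(2)])
    then show "k \<le> ?d" using T(3) by simp
  qed
  then show ?thesis unfolding lower_upper_scheme_def lu_coordinate_ring_def .
qed

end
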